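(* Let $g$ be a totally positive function of Gaussian type. If $\Lambda\subseteq\mathbb{R}$ is separated and $D^-(\Lambda)>1$, then $\Lambda$ is a sampling set for $V^2(g)$.
   Context: Fourier transform: $\hat f(\xi)=\int_{\mathbb{R}} f(x)e^{-2\pi i x\xi}\,dx$. A function $g$ on $\mathbb{R}$ is called totally positive of Gaussian type if its Fourier transform factors as $\hat g(\xi)=\prod_{j=1}^n(1+2\pi i\delta_j\xi)^{-1}e^{-c\xi^2}$ for some $n\in\mathbb{N}\cup\{0\}$, $\delta_1,\dots,\delta_n\in\mathbb{R}$ and $c>0$. Shift-invariant space: $V^2(g)=\{f\in L^2(\mathbb{R}): f=\sum_{k\in\mathbb{Z}}c_k g(\cdot-k),\ c\in\ell^2(\mathbb{Z})\}$; its elements are continuous functions. A set $\Lambda\subseteq\mathbb{R}$ is separated if $\inf\{|\lambda-\mu|:\lambda,\mu\in\Lambda,\lambda\neq\mu\}>0$. Lower Beurling density: $D^-(\Lambda)=\liminf_{R\to\infty}\inf_{x\in\mathbb{R}}\frac{\#(\Lambda\cap[x-R,x+R])}{2R}$. $\Lambda$ is a sampling set for $V^2(g)$ if there exist constants $A,B>0$ such that $A\|f\|_2^2\le\sum_{\lambda\in\Lambda}|f(\lambda)|^2\le B\|f\|_2^2$ for all $f\in V^2(g)$. *)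

theory Defs
  imports "HOL-Analysis.Analysis"
begin

definition fourier_transform :: "(real \<Rightarrow> complex) \<Rightarrow> real \<Rightarrow> complex" where
  "fourier_transform f \<xi> =
     (LINT x|lborel. f x * exp (- (2 * complex_of_real pi * \<i> * complex_of_real (x * \<xi>))))"

text \<open>
  The Fourier transform determines an integrable function only up to null sets.  Since functions
  will be evaluated pointwise, the continuous representative is required explicitly; it exists
  because of the Gaussian decay of the transform.
\<close>

definition tp_gaussian_type :: "(real \<Rightarrow> complex) \<Rightarrow> bool" where
  "tp_gaussian_type g \<longleftrightarrow>
     continuous_on UNIV g \<and> integrable lborel g \<and>
     (\<exists>(n::nat) (\<delta>::nat \<Rightarrow> real) (c::real). c > 0 \<and>
        (\<forall>\<xi>::real. fourier_transform g \<xi> =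
           (\<Prod>j=1..n. inverse (1 + 2 * complex_of_real pi * \<i> * complex_of_real (\<delta> j * \<xi>)))
             * exp (- complex_of_real (c * \<xi>\<^sup>2))))"

definition square_integrable :: "(real \<Rightarrow> complex) \<Rightarrow> bool" where
  "square_integrable f \<longleftrightarrow>
     f \<in> borel_measurable lborel \<and> integrable lborel (\<lambda>x. (cmod (f x))\<^sup>2)"

definition l2_norm_sq :: "(real \<Rightarrow> complex) \<Rightarrow> real" where
  "l2_norm_sq f = (LINT x|lborel. (cmod (f x))\<^sup>2)"

text \<open>
  The series is understood pointwise (with unconditional convergence), which selects the
  continuous representative of each element.
\<close>

definition shift_invariant_space :: "(real \<Rightarrow> complex) \<Rightarrow> (real \<Rightarrow> complex) set" where
  "shift_invariant_space g =
     {f. square_integrable f \<and>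
         (\<exists>c::int \<Rightarrow> complex. (\<lambda>k. (cmod (c k))\<^sup>2) summable_on UNIV \<and>
            (\<forall>x. ((\<lambda>k. c k * g (x - of_int k)) has_sum f x) UNIV))}"

text \<open>
  The infimum is taken in the extended reals, so that sets with at most one point are separated
  (infimum of the empty set is infinite).
\<close>

definition separated :: "real set \<Rightarrow> bool" where
  "separated \<Lambda> \<longleftrightarrow>
     0 < Inf {ereal \<bar>l - m\<bar> | l m. l \<in> \<Lambda> \<and> m \<in> \<Lambda> \<and> l \<noteq> m}"

lemma separated_iff_uniform_discrete: "separated \<Lambda> \<longleftrightarrow> uniform_discrete \<Lambda>"
proof -
  define D where "D = {ereal \<bar>l - m\<bar> | l m. l \<in> \<Lambda> \<and> m \<in> \<Lambda> \<and> l \<noteq> m}"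
  have sep: "separated \<Lambda> \<longleftrightarrow> 0 < Inf D"
    unfolding separated_def D_def ..
  have D_I: "ereal (dist l m) \<in> D" if "l \<in> \<Lambda>" "m \<in> \<Lambda>" "l \<noteq> m" for l m
    unfolding D_def dist_real_def using that by blast
  have D_E: "\<exists>l m. z = ereal (dist l m) \<and> l \<in> \<Lambda> \<and> m \<in> \<Lambda> \<and> l \<noteq> m" if "z \<in> D" for z
    using that unfolding D_def dist_real_def by blast
  show ?thesis
  proof
    assume "separated \<Lambda>"
    then have "0 < Inf D" by (simp only: sep)
    from ereal_dense2[OF this] obtain e where e: "0 < ereal e" "ereal e < Inf D"
      by (elim exE conjE)
    show "uniform_discrete \<Lambda>" unfolding uniform_discrete_def
    proof (intro exI[of _ e] conjI ballI impI)
      show "e > 0" using e(1) by simp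
      fix l m assume lm: "l \<in> \<Lambda>" "m \<in> \<Lambda>" "dist l m < e"
      show "l = m"
      proof (rule ccontr)
        assume "l \<noteq> m"
        then have "Inf D \<le> ereal (dist l m)" by (intro Inf_lower D_I lm)
        with e(2) have "ereal e < ereal (dist l m)" by (rule less_le_trans)
        then have "e < dist l m" by (simp only: ereal_less_eq less_ereal.simps)
        with lm(3) show False by (rule less_asym)
      qed
    qed
  next
    assume "uniform_discrete \<Lambda>"
    then obtain e where "e > 0" and e: "\<forall>l\<in>\<Lambda>. \<forall>m\<in>\<Lambda>. dist l m < e \<longrightarrow> l = m"
      unfolding uniform_discrete_def by (elim exE conjE)
    have "ereal e \<le> Inf D"
    proof (rule Inf_greatest)
      fix z assume "z \<in> D"
      then obtain l m where z: "z = ereal (dist l m)" and lm: "l \<in> \<Lambda>" "m \<in> \<Lambda>" "l \<noteq> m"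
        using D_E by blast
      have "\<not> dist l m < e" using e lm by blast
      then show "ereal e \<le> z" unfolding z by (simp only: not_less ereal_less_eq)
    qed
    moreover have "0 < ereal e" using \<open>e > 0\<close> by simp
    ultimately have "0 < Inf D" by (rule less_le_trans[rotated])
    then show "separated \<Lambda>" by (simp only: sep)
  qed
qed

text \<open>
  The cardinality is counting measure, so that infinite sets have infinite cardinality (rather
  than the value \<open>0\<close> given by \<^const>\<open>card\<close>).
\<close>

definition lower_beurling_density :: "real set \<Rightarrow> ennreal" where
  "lower_beurling_density \<Lambda> =
     Liminf at_top (\<lambda>R::real. INF x::real.
       emeasure (count_space UNIV) (\<Lambda> \<inter> {x - R..x + R}) / ennreal (2 * R))"

text \<open>
  Summability is stated separately because \<^const>\<open>infsum\<close> of a divergent series is \<open>0\<close>.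
\<close>

definition sampling_set :: "real set \<Rightarrow> (real \<Rightarrow> complex) set \<Rightarrow> bool" where
  "sampling_set \<Lambda> V \<longleftrightarrow>
     (\<exists>A B::real. A > 0 \<and> B > 0 \<and>
        (\<forall>f\<in>V. (\<lambda>l. (cmod (f l))\<^sup>2) summable_on \<Lambda> \<and>
                A * l2_norm_sq f \<le> (\<Sum>\<^sub>\<infinity>l\<in>\<Lambda>. (cmod (f l))\<^sup>2) \<and>
                (\<Sum>\<^sub>\<infinity>l\<in>\<Lambda>. (cmod (f l))\<^sup>2) \<le> B * l2_norm_sq f))"

end

theory Submission
  imports Defs "HOL-Complex_Analysis.Complex_Analysis" "HOL-Probability.Probability"
begin

text \<open>
  The proof is by compactness and a uniqueness theorem. Suppose that the lower sampling inequality
  fails for sequences with gaps at least \<open>s\<close> and bounded distance to \<open>i/q\<close>, \<open>q > 1\<close>. Averaging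
  against a translated polynomial weight centres the failure at one coefficient, and a limit along
  a subsequence yields a nonzero \<open>f = \<Sum>\<^sub>k d\<^sub>k G(\<cdot> - k)\<close> whose coefficients grow at most linearly
  and which vanishes on a sequence of the same kind. Since \<open>G\<close> is an iterated
  convolution of a Gaussian with exponential densities, Rolle's theorem replaces \<open>f\<close> by such a series
  for the Gaussian, with zeros interlacing those of \<open>f\<close>. For the Gaussian the substitution
  \<open>w = exp (2ax)\<close> turns the series into a Laurent series, and a maximum-principle estimate in
  the spirit of Jensen's formula shows that it has too many zeros for its growth. The equivalence
  of the \<open>L\<^sup>2\<close> norm with the \<open>\<ell>\<^sup>2\<close> norm of the coefficients follows from the same sampling
  inequality by averaging over translates of \<open>\<int>/2\<close>.
\<close>

section \<open>Laurent series with many zeros\<close>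

text \<open>Coefficient sequences for which the inequality almost fails may spread their mass ever
  more thinly, so a plain weak limit could vanish. Centring normalises the coefficient at 0 to 1,
  which survives the limit. The price is that the limit need not be square-summable: the weight 1/(1
  + x^2), chosen because it is summable over integer translates, controls it only linearly. This is
  why the uniqueness theorem has to treat linearly growing coefficients. The class of zero sequences
  is described by a bounded deviation from i/q, since this form survives translation, pointwise
  limits and Rolle's theorem, at worst with a larger bound. Rolle's theorem leaves the coefficients
  alone and changes only the generator, so the convolutions can be undone one by one. Density 1 is
  the threshold because the final estimate has leading exponent a n^2 (1/q^2 - 1/q), which is
  negative exactly when q > 1.\<close>

lemma holomorphic_divide_finite_zeros:
  assumes "finite Z" "open S" "f holomorphic_on S" "Z \<subseteq> S" "\<And>z. z \<in> Z \<Longrightarrow> f z = 0"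
  shows "\<exists>H. H holomorphic_on S \<and> (\<forall>w\<in>S. f w = H w * (\<Prod>z\<in>Z. w - z))"
  using assms
proof (induction Z rule: finite_induct)
  case empty
  then show ?case by (intro exI[of _ f]) auto
next
  case (insert a Z)
  obtain H where H: "H holomorphic_on S" "\<And>w. w \<in> S \<Longrightarrow> f w = H w * (\<Prod>z\<in>Z. w - z)"
    using insert by auto
  \<comment> \<open>The points are distinct, so the factors already divided out do not vanish at
    \<open>a\<close>; the zero of \<open>f\<close> there must be a zero of the quotient
    \<open>H\<close>, and one more removable singularity can be filled.\<close>
  have "(\<Prod>z\<in>Z. a - z) \<noteq> 0"
    using insert by (auto simp: prod_zero_iff)
  moreover have "f a = 0" "a \<in> S" using insert.prems by auto
  ultimately have Ha: "H a = 0" using H(2)[of a] by auto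
  define H' where "H' = (\<lambda>z. if z = a then deriv H a else (H z - H a) / (z - a))"
  have "H' holomorphic_on S"
    unfolding H'_def by (rule pole_lemma_open) fact+
  moreover have "H w = H' w * (w - a)" for w
    by (simp add: H'_def Ha)
  ultimately show ?case
    using H(2) insert.hyps by (intro exI[of _ H']) (auto simp: mult_ac)
qed

lemma annulus_maximum_modulus:
  assumes "f holomorphic_on -{0}" "0 < r" "r < R"
    and bd: "\<And>w. norm w = r \<or> norm w = R \<Longrightarrow> norm (f w) \<le> B"
    and w: "r \<le> norm w" "norm w \<le> R"
  shows "norm (f w) \<le> B"
proof (rule maximum_modulus_frontier[where S = "cball 0 R - ball 0 r" and f = f and \<xi> = w])
  have cl: "closed (cball (0::complex) R - ball 0 r)"
    by (intro closed_Diff) auto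
  have sub: "cball (0::complex) R - ball 0 r \<subseteq> -{0}" using \<open>0 < r\<close> by auto
  show "f holomorphic_on interior (cball 0 R - ball 0 r)"
    using assms(1) by (rule holomorphic_on_subset) (use sub interior_subset in blast)
  show "continuous_on (closure (cball 0 R - ball 0 r)) f"
    unfolding closure_closed[OF cl]
    by (intro holomorphic_on_imp_continuous_on holomorphic_on_subset[OF assms(1)] sub)
  show "bounded (cball (0::complex) R - ball 0 r)" by (intro bounded_diff) auto
  show "w \<in> cball 0 R - ball 0 r" using w by auto
  fix z :: complex assume "z \<in> frontier (cball 0 R - ball 0 r)"
  then have z: "z \<in> cball 0 R - ball 0 r" "z \<notin> interior (cball 0 R - ball 0 r)"
    unfolding frontier_def closure_closed[OF cl] by auto
  have "ball 0 R - cball (0::complex) r \<subseteq> interior (cball 0 R - ball 0 r)"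
    by (rule interior_maximal) (auto intro: open_Diff)
  with z have "norm z = r \<or> norm z = R" by force
  then show "norm (f z) \<le> B" by (rule bd)
qed

lemma entire_power_series:
  fixes b :: "nat \<Rightarrow> complex"
  assumes "\<And>w. summable (\<lambda>n. b n * w ^ n)"
  shows "(\<lambda>w. \<Sum>n. b n * w ^ n) holomorphic_on UNIV"
proof -
  have "(\<lambda>w. \<Sum>n. b n * w ^ n) holomorphic_on ball 0 r" for r
    by (rule power_series_holomorphic[where a = b]) (use assms in \<open>auto intro: summable_sums\<close>)
  then have "(\<lambda>w. \<Sum>n. b n * w ^ n) field_differentiable (at z)" for z
    by (rule holomorphic_on_imp_differentiable_at[where s = "ball 0 (norm z + 1)"]) auto
  then show ?thesis by (auto simp: holomorphic_on_def)
qed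

lemma exp_quadratic_tendsto_0:
  fixes \<alpha> \<beta> \<gamma> :: real
  assumes "\<alpha> > 0"
  shows "(\<lambda>n. exp (- \<alpha> * (real n)\<^sup>2 + \<beta> * real n + \<gamma>)) \<longlonglongrightarrow> 0"
  using assms by real_asymp

text \<open>Dividing out the zeros with \<open>1 \<le> \<bar>i\<bar> \<le> n\<close> and applying the maximum principle on the
  annulus with radii \<open>exp (2aT)\<close> and \<open>exp (-2aT)\<close>, where \<open>T\<close> is about \<open>n/q\<close>, gains a factor
  \<open>exp (a n\<^sup>2/q)\<close>, up to \<open>exp (O(n))\<close>, against the growth \<open>exp (a n\<^sup>2/q\<^sup>2)\<close> of \<open>h\<close>.\<close>

lemma punctured_plane_zero_density:
  fixes h :: "complex \<Rightarrow> complex" and \<mu> :: "int \<Rightarrow> real"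
  assumes hol: "h holomorphic_on -{0}"
    and a: "a > 0" and B: "B > 0" and e: "e \<ge> 0"
    and growth: "\<And>T w. norm w = exp (2 * a * T) \<Longrightarrow> norm (h w) \<le> B * exp (a * T\<^sup>2 + e * \<bar>T\<bar>)"
    and zero: "\<And>i. h (complex_of_real (exp (2 * a * \<mu> i))) = 0"
    and mono: "strict_mono \<mu>" and q: "q > 1" and D: "\<And>i. \<bar>\<mu> i - of_int i / q\<bar> \<le> D"
    and w0: "w0 \<noteq> 0"
  shows "h w0 = 0"
proof -
  have D0: "D \<ge> 0" using D[of 0] by linarith
  \<comment> \<open>\<open>T n\<close> exceeds every |\<mu>(i)| with |i| \<le> n by at least 1. On
    the multiplicative scale this is a factor exp(2a) between the removed zeros and the boundary
    circles, and \<open>\<kappa>\<close> is the resulting relative gap.\<close>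
  define \<kappa> where "\<kappa> = 1 - exp (- 2 * a)"
  have \<kappa>: "0 < \<kappa>" "\<kappa> < 1" using a by (auto simp: \<kappa>_def)
  define E where "E = exp (2 * a * D)"
  define K where "K = (1 + norm w0 * E) * (norm w0 + E) / norm w0 / \<kappa>\<^sup>2"
  have E: "E > 0" by (simp add: E_def)
  have K: "K > 0" unfolding K_def using E \<kappa> w0
    by (intro divide_pos_pos mult_pos_pos add_pos_nonneg) (auto intro: add_nonneg_pos)
  define T where "T n = real n / q + D + 1" for n
  have main: "norm (h w0) \<le> K ^ n * (2 * B * exp (a * (T n)\<^sup>2 + e * T n) * exp (- 2 * a * T n * n)
        * exp (2 * a * (real n * (real n + 1) / (2 * q) + n * D)))"
    if n: "exp (- 2 * a * T n) \<le> norm w0" "norm w0 \<le> exp (2 * a * T n)" for n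
  proof -
    define w where "w i = exp (2 * a * \<mu> i)" for i
    define \<rho> where "\<rho> = exp (2 * a * T n)"
    define I where "I = {1..int n}"
    have T1: "T n \<ge> 1" unfolding T_def using D0 q by simp
    have \<rho>: "\<rho> > 1" unfolding \<rho>_def using T1 a by simp
    have inv\<rho>: "inverse \<rho> = exp (- 2 * a * T n)" by (simp add: \<rho>_def exp_minus)
    have up: "\<mu> i \<le> of_int i / q + D" and lo: "\<mu> i \<ge> of_int i / q - D" for i
      using D[of i] by (auto simp: abs_le_iff)
    have nq: "of_int i / q \<le> real n / q" if "i \<le> int n" for i
      using that q by (intro divide_right_mono) auto
    have nq': "of_int i / q \<ge> - real n / q" if "i \<ge> - int n" for i
      using that q by (intro divide_right_mono) auto
    have TI: "\<mu> i \<le> T n - 1" "- T n + 1 \<le> \<mu> i" if "i \<in> {- int n..int n}" for i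
      using up[of i] lo[of i] nq[of i] nq'[of i] that unfolding T_def by auto
    have wpos: "w i > 0" for i by (simp add: w_def)
    have inj: "w i = w j \<longleftrightarrow> i = j" for i j
      using a strict_mono_eq[OF mono] by (simp add: w_def)
    \<comment> \<open>Omitting the index 0 leaves n zeros with positive and n with negative index;
      the two halves are estimated differently.\<close>
    define Z where "Z = (\<lambda>i. complex_of_real (w i)) ` (I \<union> uminus ` I)"
    have prodZ: "(\<Prod>z\<in>Z. v - z) = (\<Prod>i\<in>I. v - w i) * (\<Prod>i\<in>I. v - w (- i))" for v
    proof -
      have "(\<Prod>z\<in>Z. v - z) = (\<Prod>i\<in>I \<union> uminus ` I. v - complex_of_real (w i))"
        unfolding Z_def by (subst prod.reindex) (auto simp: inj_on_def inj)
      also have "\<dots> = (\<Prod>i\<in>I. v - w i) * (\<Prod>i\<in>uminus ` I. v - complex_of_real (w i))"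
        by (rule prod.union_disjoint) (auto simp: I_def)
      also have "(\<Prod>i\<in>uminus ` I. v - complex_of_real (w i)) = (\<Prod>i\<in>I. v - w (- i))"
        by (subst prod.reindex) (auto simp: inj_on_def)
      finally show ?thesis .
    qed
    have "\<exists>H. H holomorphic_on -{0} \<and> (\<forall>v\<in>-{0}. h v = H v * (\<Prod>z\<in>Z. v - z))"
    proof (rule holomorphic_divide_finite_zeros)
      show "finite Z" by (simp add: Z_def I_def)
      show "Z \<subseteq> - {0}" using wpos by (auto simp: Z_def) (metis less_irrefl)+
      show "h z = 0" if "z \<in> Z" for z using that zero by (auto simp: Z_def w_def)
    qed (use hol in auto)
    then obtain H where H: "H holomorphic_on -{0}" 
      "\<And>v. v \<noteq> 0 \<Longrightarrow> h v = H v * ((\<Prod>i\<in>I. v - w i) * (\<Prod>i\<in>I. v - w (- i)))"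
      unfolding prodZ by auto
    have cardI: "card I = n" by (simp add: I_def)
    define M where "M = B * exp (a * (T n)\<^sup>2 + e * T n)"
    have M: "M > 0" using B by (simp add: M_def)
    define P1 P2 where "P1 = (\<Prod>i\<in>I. w i)" and "P2 = (\<Prod>i\<in>I. w (- i))"
    have P: "P1 > 0" "P2 > 0" unfolding P1_def P2_def by (auto intro: prod_pos wpos)
    have gap_out: "norm (v - complex_of_real (w i)) \<ge> \<rho> * \<kappa>" if "norm v = \<rho>" "i \<in> {- int n..int n}" for v i
    proof -
      have "w i \<le> exp (2 * a * T n + - 2 * a)"
        unfolding w_def using mult_left_mono[OF TI(1)[OF that(2)], of "2 * a"] a by (simp add: algebra_simps)
      also have "\<dots> = \<rho> * exp (- 2 * a)" unfolding \<rho>_def by (rule exp_add)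
      finally have "\<rho> * \<kappa> \<le> \<rho> - w i" by (simp add: \<kappa>_def algebra_simps)
      also have "\<dots> \<le> norm (v - complex_of_real (w i))"
        using norm_triangle_ineq2[of v "complex_of_real (w i)"] that wpos[of i] by simp
      finally show ?thesis .
    qed
    have gap_in: "norm (v - complex_of_real (w i)) \<ge> w i * \<kappa>" if "norm v = inverse \<rho>" "i \<in> {- int n..int n}" for v i
    proof -
      have "inverse \<rho> = exp (- 2 * a * T n)" by (rule inv\<rho>)
      also have "\<dots> \<le> exp (2 * a * \<mu> i + - 2 * a)"
        using mult_left_mono[OF TI(2)[OF that(2)], of "2 * a"] a by (simp add: algebra_simps)
      also have "\<dots> = w i * exp (- 2 * a)" unfolding w_def by (rule exp_add)
      finally have "w i * \<kappa> \<le> w i - inverse \<rho>" by (simp add: \<kappa>_def algebra_simps)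
      also have "\<dots> \<le> norm (v - complex_of_real (w i))"
        using norm_triangle_ineq2[of "complex_of_real (w i)" v] that wpos[of i]
        by (simp add: norm_minus_commute)
      finally show ?thesis .
    qed
    have Imem: "i \<in> {- int n..int n}" "- i \<in> {- int n..int n}" if "i \<in> I" for i
      using that by (auto simp: I_def)
    \<comment> \<open>The power v^n balances the two circles. Outside, each of the 2n factors is at
      least \<rho>\<kappa>, and \<rho>^n M / (\<rho>\<kappa>)^(2n) leaves M \<rho>^(-n) /
      \<kappa>^(2n) = \<open>C\<close>. Inside, each factor is at least \<kappa> times its zero, and
      |v|^n supplies the same \<rho>^(-n), giving \<open>C / (P1 * P2)\<close>.\<close>
    define G where "G v = v ^ n * H v" for v
    define C where "C = M * inverse \<rho> ^ n / \<kappa> ^ (2 * n)"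
    have C: "C > 0" using M \<rho> \<kappa> by (simp add: C_def)
    have "norm (G w0) \<le> C * (1 + 1 / (P1 * P2))"
    proof (rule annulus_maximum_modulus[where r = "inverse \<rho>" and R = \<rho> and f = G and w = w0])
      show "G holomorphic_on - {0}" unfolding G_def by (intro holomorphic_intros H)
      show "0 < inverse \<rho>" using \<rho> by simp
      show "inverse \<rho> < \<rho>" using \<rho> one_less_inverse_iff[of \<rho>] by (smt (verit) inverse_less_1_iff)
      show "inverse \<rho> \<le> norm w0" "norm w0 \<le> \<rho>" using n unfolding inv\<rho> by (auto simp: \<rho>_def)
      fix v :: complex assume v: "norm v = inverse \<rho> \<or> norm v = \<rho>"
      then have v0: "v \<noteq> 0" using \<rho> by auto
      have hv: "norm (h v) \<le> M"
        using v growth[of v "T n"] growth[of v "- T n"] T1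
        unfolding M_def inv\<rho> by (auto simp: \<rho>_def)
      define X where "X = norm (\<Prod>i\<in>I. v - w i) * norm (\<Prod>i\<in>I. v - w (- i))"
      have hX: "norm (h v) = norm (H v) * X"
        using H(2)[OF v0] by (simp add: X_def norm_mult)
      show "norm (G v) \<le> C * (1 + 1 / (P1 * P2))"
        using v
      proof
        assume vn: "norm v = \<rho>"
        have "(\<rho> * \<kappa>) ^ n \<le> norm (\<Prod>i\<in>I. v - w i)"
          unfolding prod_norm[symmetric] cardI[symmetric]
          by (subst prod_constant[symmetric], intro prod_mono) (use gap_out vn Imem \<rho> \<kappa> in auto)
        moreover have "(\<rho> * \<kappa>) ^ n \<le> norm (\<Prod>i\<in>I. v - w (- i))"
          unfolding prod_norm[symmetric] cardI[symmetric]
          by (subst prod_constant[symmetric], intro prod_mono) (use gap_out vn Imem \<rho> \<kappa> in auto)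
        ultimately have "(\<rho> * \<kappa>) ^ n * (\<rho> * \<kappa>) ^ n \<le> X"
          unfolding X_def using \<rho> \<kappa> by (intro mult_mono) auto
        then have "norm (H v) * ((\<rho> * \<kappa>) ^ n * (\<rho> * \<kappa>) ^ n) \<le> M"
          using hv hX by (smt (verit) mult_left_mono norm_ge_zero)
        then have "norm (G v) \<le> C"
          using \<rho> \<kappa> by (simp add: C_def G_def norm_mult norm_power vn field_simps power_mult_distrib power_mult power2_eq_square)
        also have "\<dots> \<le> C * (1 + 1 / (P1 * P2))" using C P by simp
        finally show ?thesis .
      next
        assume vn: "norm v = inverse \<rho>"
        have "\<kappa> ^ n * P1 \<le> norm (\<Prod>i\<in>I. v - w i)"
          unfolding prod_norm[symmetric] cardI[symmetric] P1_def
          by (subst prod_constant[symmetric], subst prod.distrib[symmetric], intro prod_mono)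
             (use gap_in vn Imem wpos \<kappa> in \<open>auto simp: mult.commute less_imp_le\<close>)
        moreover have "\<kappa> ^ n * P2 \<le> norm (\<Prod>i\<in>I. v - w (- i))"
          unfolding prod_norm[symmetric] cardI[symmetric] P2_def
          by (subst prod_constant[symmetric], subst prod.distrib[symmetric], intro prod_mono)
             (use gap_in vn Imem wpos \<kappa> in \<open>auto simp: mult.commute less_imp_le\<close>)
        ultimately have "(\<kappa> ^ n * P1) * (\<kappa> ^ n * P2) \<le> X"
          unfolding X_def using \<rho> \<kappa> P by (intro mult_mono) auto
        then have "norm (H v) * ((\<kappa> ^ n * P1) * (\<kappa> ^ n * P2)) \<le> M"
          using hv hX by (smt (verit) mult_left_mono norm_ge_zero)
        then have "norm (G v) \<le> C * (1 / (P1 * P2))"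
          using \<rho> \<kappa> P by (simp add: C_def G_def norm_mult norm_power vn field_simps power_mult power2_eq_square)
        also have "\<dots> \<le> C * (1 + 1 / (P1 * P2))" using C P by (simp add: distrib_left)
        finally show ?thesis .
      qed
    qed
    then have "norm (H w0) \<le> C * (1 + 1 / (P1 * P2)) / norm w0 ^ n"
      using w0 by (simp add: G_def norm_mult norm_power field_simps)
    \<comment> \<open>Zeros of positive index are at least 1/\<open>E\<close>, so each can be pulled
      out of its factor. The product \<open>P1\<close> thus gained turns 1 + 1/(\<open>P1\<close>
      \<open>P2\<close>) into \<open>P1\<close> + 1/\<open>P2\<close>. Zeros of negative index are
      at most \<open>E\<close> and cost only a constant per factor.\<close>
    moreover have "norm (\<Prod>i\<in>I. w0 - w i) \<le> (1 + norm w0 * E) ^ n * P1"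
      unfolding prod_norm[symmetric] cardI[symmetric] P1_def
    proof (subst prod_constant[symmetric], subst prod.distrib[symmetric], intro prod_mono conjI)
      fix i assume i: "i \<in> I"
      have "\<mu> i \<ge> - D" using lo[of i] i q by (auto simp: I_def) (smt (verit) divide_nonneg_nonneg of_int_0_le_iff)
      then have "0 \<le> 2 * a * (D + \<mu> i)" using a by simp
      then have "1 \<le> E * w i" unfolding E_def w_def exp_add[symmetric] by (simp add: distrib_left)
      then have "norm w0 * 1 \<le> norm w0 * (E * w i)" by (intro mult_left_mono) auto
      then show "cmod (w0 - w i) \<le> (1 + cmod w0 * E) * w i"
        using norm_triangle_ineq4[of w0 "complex_of_real (w i)"] wpos[of i] by (simp add: algebra_simps)
    qed auto
    moreover have "norm (\<Prod>i\<in>I. w0 - w (- i)) \<le> (norm w0 + E) ^ n"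
      unfolding prod_norm[symmetric] cardI[symmetric]
    proof (subst prod_constant[symmetric], intro prod_mono conjI)
      fix i assume i: "i \<in> I"
      have "0 \<le> of_int i / q" using i q by (auto simp: I_def)
      then have "\<mu> (- i) \<le> D" using up[of "- i"] by simp
      then have "w (- i) \<le> E" unfolding E_def w_def using a by simp
      then show "cmod (w0 - w (- i)) \<le> cmod w0 + E"
        using norm_triangle_ineq4[of w0 "complex_of_real (w (- i))"] wpos[of "- i"] by simp
    qed auto
    ultimately have "norm (h w0) \<le> (C * (1 + 1 / (P1 * P2)) / norm w0 ^ n) * (((1 + norm w0 * E) ^ n * P1) * (norm w0 + E) ^ n)"
      unfolding H(2)[OF w0] norm_mult using C P E
      by (intro mult_mono) (auto intro!: mult_nonneg_nonneg divide_nonneg_nonneg)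
    also have "\<dots> = K ^ n * (M * inverse \<rho> ^ n * (P1 + 1 / P2))"
    proof -
      have "K ^ n = (1 + norm w0 * E) ^ n * (norm w0 + E) ^ n / norm w0 ^ n / \<kappa> ^ (2 * n)"
        by (simp add: K_def power_mult_distrib power_divide power_mult)
      moreover have "P1 + 1 / P2 = (1 + 1 / (P1 * P2)) * P1"
        using P by (simp add: field_simps)
      ultimately show ?thesis
        unfolding C_def by (simp only: divide_inverse mult_ac)
    qed
    also have "\<dots> \<le> K ^ n * (M * inverse \<rho> ^ n * (2 * exp (2 * a * (real n * (real n + 1) / (2 * q) + n * D))))"
    proof -
      have S: "(\<Sum>i\<in>I. of_int i / q + D) = real n * (real n + 1) / (2 * q) + n * D"
      proof -
        have "(\<Sum>i\<in>I. real_of_int i) = (\<Sum>i=1..n. real i)"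
          unfolding I_def by (rule sum.reindex_bij_witness[of _ int nat]) auto
        also have "\<dots> = real n * (real n + 1) / 2"
          by (induction n) (auto simp: field_simps)
        finally have X: "(\<Sum>i\<in>I. real_of_int i) = real n * (real n + 1) / 2" .
        show ?thesis
          unfolding sum.distrib sum_divide_distrib[symmetric] X by (simp add: cardI)
      qed
      have "P1 = exp (2 * a * (\<Sum>i\<in>I. \<mu> i))"
        unfolding P1_def w_def by (simp add: exp_sum sum_distrib_left I_def)
      also have "\<dots> \<le> exp (2 * a * (\<Sum>i\<in>I. of_int i / q + D))"
        using a by (auto intro!: sum_mono up)
      finally have 1: "P1 \<le> exp (2 * a * (real n * (real n + 1) / (2 * q) + n * D))" unfolding S .
      have "1 / P2 = exp (2 * a * (\<Sum>i\<in>I. - \<mu> (- i)))"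
        unfolding P2_def w_def by (simp add: exp_sum sum_distrib_left I_def sum_negf exp_minus inverse_eq_divide)
      also have "\<dots> \<le> exp (2 * a * (\<Sum>i\<in>I. of_int i / q + D))"
      proof -
        have "- \<mu> (- i) \<le> of_int i / q + D" for i using lo[of "- i"] by simp
        then show ?thesis using a by (auto intro!: sum_mono)
      qed
      finally have 2: "1 / P2 \<le> exp (2 * a * (real n * (real n + 1) / (2 * q) + n * D))" unfolding S .
      show ?thesis using 1 2 M \<rho> K by (intro mult_left_mono) auto
    qed
    also have "inverse \<rho> ^ n = exp (- 2 * a * T n * n)"
      unfolding inv\<rho> by (simp add: exp_of_nat_mult[symmetric] mult_ac)
    finally show ?thesis by (simp only: M_def mult_ac)
  qed
  \<comment> \<open>The coefficient of n^2 collects a/q^2 from the growth of \<open>h\<close>, -2a/q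
    from \<rho>^(-n) and a/q from the product of zeros: in total a/q^2 - a/q = -\<alpha>. Everything
    else is linear in n.\<close>
  define \<alpha> \<beta> \<gamma> where "\<alpha> = a * (q - 1) / q\<^sup>2"
    and "\<beta> = ln K + 2 * a * (D + 1) / q + e / q - 2 * a * (D + 1) + a / q + 2 * a * D"
    and "\<gamma> = a * (D + 1)\<^sup>2 + e * (D + 1)"
  have eq: "K ^ n * (2 * B * exp (a * (T n)\<^sup>2 + e * T n) * exp (- 2 * a * T n * n)
        * exp (2 * a * (real n * (real n + 1) / (2 * q) + n * D))) = 2 * B * exp (- \<alpha> * (real n)\<^sup>2 + \<beta> * real n + \<gamma>)" for n
  proof -
    have "K ^ n = exp (real n * ln K)" using K by (simp add: exp_of_nat_mult)
    moreover have E: "real n * ln K + (a * (T n)\<^sup>2 + e * T n) + (- 2 * a * T n * n) + (2 * a * (real n * (real n + 1) / (2 * q) + n * D))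
       = - \<alpha> * (real n)\<^sup>2 + \<beta> * real n + \<gamma>"
      using q unfolding T_def \<alpha>_def \<beta>_def \<gamma>_def by (simp add: field_simps power2_eq_square)
    ultimately show ?thesis
      unfolding E[symmetric] by (simp only: exp_add mult_ac)
  qed
  have ev: "\<forall>\<^sub>F n in sequentially. exp (- 2 * a * T n) \<le> norm w0 \<and> norm w0 \<le> exp (2 * a * T n)"
  proof (rule eventually_conj)
    have "(\<lambda>n. exp (- 2 * a * T n)) \<longlonglongrightarrow> 0" unfolding T_def using a q by real_asymp
    then have "\<forall>\<^sub>F n in sequentially. exp (- 2 * a * T n) < norm w0"
      using w0 by (intro order_tendstoD) auto
    then show "\<forall>\<^sub>F n in sequentially. exp (- 2 * a * T n) \<le> norm w0" by eventually_elim simp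
    have "filterlim (\<lambda>n. exp (2 * a * T n)) at_top sequentially" unfolding T_def using a q by real_asymp
    then show "\<forall>\<^sub>F n in sequentially. norm w0 \<le> exp (2 * a * T n)" by (auto simp: filterlim_at_top)
  qed
  have "\<alpha> > 0" using a q by (simp add: \<alpha>_def)
  then have "(\<lambda>n. 2 * B * exp (- \<alpha> * (real n)\<^sup>2 + \<beta> * real n + \<gamma>)) \<longlonglongrightarrow> 2 * B * 0"
    by (intro tendsto_mult tendsto_const exp_quadratic_tendsto_0)
  moreover have "\<forall>\<^sub>F n in sequentially. norm (h w0) \<le> 2 * B * exp (- \<alpha> * (real n)\<^sup>2 + \<beta> * real n + \<gamma>)"
    using ev by eventually_elim (use main eq in metis)
  ultimately have "norm (h w0) \<le> 2 * B * 0" by (rule tendsto_lowerbound) simp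
  then show ?thesis by simp
qed

section \<open>Series of integer shifts\<close>

lemma summable_on_int_abs:
  fixes f :: "nat \<Rightarrow> real"
  assumes "f summable_on UNIV"
  shows "(\<lambda>k::int. f (nat \<bar>k\<bar>)) summable_on UNIV"
proof -
  have "(\<lambda>k::int. f (nat \<bar>k\<bar>)) summable_on {0..}"
    using assms by (subst summable_on_reindex_bij_witness[of _ int nat UNIV f]) auto
  moreover have "(\<lambda>k::int. f (nat \<bar>k\<bar>)) summable_on {..0}"
    using assms by (subst summable_on_reindex_bij_witness[of _ "\<lambda>n. - int n" "\<lambda>k. nat (- k)" UNIV f]) auto
  ultimately have "(\<lambda>k::int. f (nat \<bar>k\<bar>)) summable_on ({0..} \<union> {..0})"
    by (rule summable_on_union)
  moreover have "{0..} \<union> {..0} = (UNIV :: int set)" by auto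
  ultimately show ?thesis by simp
qed

lemma summable_on_int_exp:
  fixes e :: real
  assumes "e > 0"
  shows "(\<lambda>k::int. exp (- e * \<bar>of_int k\<bar>)) summable_on UNIV"
proof -
  have "summable (\<lambda>n::nat. exp (- e) ^ n)" using assms by (intro summable_geometric) auto
  then have "(\<lambda>n::nat. exp (- e) ^ n) summable_on UNIV"
    by (intro summable_nonneg_imp_summable_on) auto
  then have "(\<lambda>n::nat. exp (- e * real n)) summable_on UNIV"
    by (simp add: exp_of_nat_mult[symmetric] mult.commute)
  from summable_on_int_abs[OF this] show ?thesis by simp
qed

text \<open>The rate is left existential because each convolution with an exponential density may
  lower it.\<close>

definition exp_decay :: "(real \<Rightarrow> real) \<Rightarrow> bool" where
  "exp_decay F \<longleftrightarrow> (\<exists>C e. e > 0 \<and> (\<forall>x. \<bar>F x\<bar> \<le> C * exp (- e * \<bar>x\<bar>)))"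

lemma exp_decayE:
  assumes "exp_decay F"
  obtains C e where "C > 0" "e > 0" "\<And>x. \<bar>F x\<bar> \<le> C * exp (- e * \<bar>x\<bar>)"
proof -
  obtain C e where 1: "e > 0" "\<And>x. \<bar>F x\<bar> \<le> C * exp (- e * \<bar>x\<bar>)"
    using assms by (auto simp: exp_decay_def)
  have "\<bar>F x\<bar> \<le> (\<bar>C\<bar> + 1) * exp (- e * \<bar>x\<bar>)" for x
    using 1(2)[of x] by (rule order_trans) (intro mult_right_mono, auto)
  with 1(1) show ?thesis by (intro that[of "\<bar>C\<bar> + 1" e]) auto
qed

text \<open>Half of the decay rate absorbs the linear factor, by t \<le> exp t at t = (e/2)|k|;
  moving the centre from k to k - x costs exp(e|x|).\<close>

lemma linear_times_exp_decay_bound: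
  fixes C K e :: real
  assumes "C > 0" "K \<ge> 0" "e > 0" and F: "\<And>x. \<bar>F x\<bar> \<le> C * exp (- e * \<bar>x\<bar>)"
    and d: "\<bar>d\<bar> \<le> K * (1 + \<bar>of_int k\<bar>)"
  shows "\<bar>d * F (x - of_int k)\<bar> \<le> (K * C * (1 + 2 / e)) * exp (e * \<bar>x\<bar>) * exp (- (e / 2) * \<bar>of_int k\<bar>)"
proof -
  let ?k = "\<bar>of_int k\<bar> :: real"
  have 1: "1 + ?k \<le> (1 + 2 / e) * exp ((e / 2) * ?k)"
  proof -
    have "1 \<le> exp ((e / 2) * ?k)" using assms by simp
    moreover have "(e / 2) * ?k \<le> exp ((e / 2) * ?k)"
      using exp_ge_add_one_self[of "(e / 2) * ?k"] by linarith
    then have "?k \<le> (2 / e) * exp ((e / 2) * ?k)" using assms by (simp add: field_simps)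
    ultimately show ?thesis unfolding distrib_right by linarith
  qed
  have "exp (- e * \<bar>x - of_int k\<bar>) \<le> exp (e * \<bar>x\<bar> + - e * ?k)"
  proof -
    have "e * (?k - \<bar>x\<bar>) \<le> e * \<bar>x - of_int k\<bar>" using assms by (intro mult_left_mono) auto
    then show ?thesis by (simp add: right_diff_distrib)
  qed
  then have 2: "exp (- e * \<bar>x - of_int k\<bar>) \<le> exp (e * \<bar>x\<bar>) * exp (- e * ?k)" by (simp only: exp_add)
  have "\<bar>d * F (x - of_int k)\<bar> \<le> (K * (1 + ?k)) * (C * exp (- e * \<bar>x - of_int k\<bar>))"
    unfolding abs_mult using d F by (intro mult_mono) (use assms in auto)
  also have "\<dots> \<le> (K * ((1 + 2 / e) * exp ((e / 2) * ?k))) * (C * (exp (e * \<bar>x\<bar>) * exp (- e * ?k)))"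
    using 1 2 assms by (intro mult_mono) auto
  also have "\<dots> = (K * C * (1 + 2 / e)) * exp (e * \<bar>x\<bar>) * (exp ((e / 2) * ?k) * exp (- e * ?k))"
    by (simp only: mult_ac)
  also have "exp ((e / 2) * ?k) * exp (- e * ?k) = exp (- (e / 2) * ?k)"
    unfolding exp_add[symmetric] by (simp add: field_simps)
  finally show ?thesis .
qed

definition lin_growth :: "real \<Rightarrow> (int \<Rightarrow> real) \<Rightarrow> bool" where
  "lin_growth K d \<longleftrightarrow> (\<forall>k. \<bar>d k\<bar> \<le> K * (1 + \<bar>of_int k\<bar>))"

lemma lin_growth_nonneg: "lin_growth K d \<Longrightarrow> K \<ge> 0"
  unfolding lin_growth_def by (drule spec[of _ 0]) auto

text \<open>The order of quantifiers matters: \<open>B\<close> and \<open>e\<close> depend on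
  \<open>F\<close> and \<open>K\<close> only, so one majorant serves a whole sequence of coefficient
  families at varying points. Here \<open>e\<close> is half the decay rate of \<open>F\<close>,
  whence the factor 2 in the growth in x.\<close>

lemma series_dominated:
  assumes "exp_decay F" "K \<ge> 0"
  obtains B e where "B > 0" "e > 0"
    "\<And>d k x. lin_growth K d \<Longrightarrow> \<bar>d k * F (x - of_int k)\<bar> \<le> B * exp (2 * e * \<bar>x\<bar>) * exp (- e * \<bar>of_int k\<bar>)"
proof -
  obtain C e where C: "C > 0" "e > 0" "\<And>x. \<bar>F x\<bar> \<le> C * exp (- e * \<bar>x\<bar>)"
    using exp_decayE[OF assms(1)] by metis
  have *: "\<bar>d k * F (x - of_int k)\<bar> \<le> (K * C * (1 + 2 / e) + 1) * exp (2 * (e / 2) * \<bar>x\<bar>) * exp (- (e / 2) * \<bar>of_int k\<bar>)"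
    if "lin_growth K d" for d x and k :: int
  proof -
    have "\<bar>d k * F (x - of_int k)\<bar> \<le> (K * C * (1 + 2 / e)) * exp (e * \<bar>x\<bar>) * exp (- (e / 2) * \<bar>of_int k\<bar>)"
      using that unfolding lin_growth_def by (intro linear_times_exp_decay_bound C assms) auto
    also have "\<dots> \<le> (K * C * (1 + 2 / e) + 1) * exp (e * \<bar>x\<bar>) * exp (- (e / 2) * \<bar>of_int k\<bar>)"
      by (intro mult_right_mono) auto
    finally show ?thesis by simp
  qed
  show ?thesis
  proof (rule that)
    show "K * C * (1 + 2 / e) + 1 > 0" using C assms by (intro add_nonneg_pos mult_nonneg_nonneg) auto
    show "e / 2 > 0" using C by simp
  qed (use * in auto)
qed

lemma series_summable:
  assumes "exp_decay F" "lin_growth K d"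
  shows "(\<lambda>k. \<bar>d k * F (x - of_int k)\<bar>) summable_on UNIV" "(\<lambda>k. d k * F (x - of_int k)) summable_on UNIV"
proof -
  obtain B e where B: "B > 0" "e > 0"
    "\<And>d k x. lin_growth K d \<Longrightarrow> \<bar>d k * F (x - of_int k)\<bar> \<le> B * exp (2 * e * \<bar>x\<bar>) * exp (- e * \<bar>of_int k\<bar>)"
    using series_dominated[OF assms(1) lin_growth_nonneg[OF assms(2)]] by metis
  have "(\<lambda>k::int. B * exp (2 * e * \<bar>x\<bar>) * exp (- e * \<bar>of_int k\<bar>)) summable_on UNIV"
    by (intro summable_on_cmult_right summable_on_int_exp B)
  then show 1: "(\<lambda>k. \<bar>d k * F (x - of_int k)\<bar>) summable_on UNIV"
    by (rule summable_on_comparison_test) (use B assms in auto)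
  then have "(\<lambda>k. norm (d k * F (x - of_int k))) summable_on UNIV" by (simp only: real_norm_def)
  then show "(\<lambda>k. d k * F (x - of_int k)) summable_on UNIV" by (rule abs_summable_summable)
qed

definition shift_series :: "(real \<Rightarrow> real) \<Rightarrow> (int \<Rightarrow> real) \<Rightarrow> real \<Rightarrow> real" where
  "shift_series F d x = (\<Sum>\<^sub>\<infinity>k. d k * F (x - of_int k))"

text \<open>A single coefficient suffices as conclusion, because the limiting series it is applied
  to is normalised by \<open>d 0 = 1\<close>. All \<open>K\<close>, \<open>q > 1\<close> and
  \<open>D\<close> are quantified inside, which lets the induction over convolutions enlarge
  \<open>D\<close>.\<close>

definition determined_by_dense_zeros :: "(real \<Rightarrow> real) \<Rightarrow> bool" where
  "determined_by_dense_zeros F \<longleftrightarrow>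
     (\<forall>d K \<mu> q D. lin_growth K d \<longrightarrow> strict_mono (\<mu> :: int \<Rightarrow> real) \<longrightarrow> q > 1 \<longrightarrow>
        (\<forall>i. \<bar>\<mu> i - of_int i / q\<bar> \<le> D) \<longrightarrow> (\<forall>i. shift_series F d (\<mu> i) = 0) \<longrightarrow> d 0 = 0)"

section \<open>The Gaussian generator and its Laurent series\<close>

lemma exp_decay_gaussian:
  assumes "a > 0"
  shows "exp_decay (\<lambda>x. A * exp (- a * x\<^sup>2))"
  unfolding exp_decay_def
proof (intro exI conjI allI)
  show "a > 0" by fact
  fix x :: real
  have "2 * \<bar>x\<bar> \<le> 1 + x\<^sup>2" using sum_squares_bound[of "\<bar>x\<bar>" 1] by simp
  then have "\<bar>x\<bar> - 1 \<le> x\<^sup>2" by linarith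
  then have "a * (\<bar>x\<bar> - 1) \<le> a * x\<^sup>2" using assms by (intro mult_left_mono) auto
  then have "exp (- a * x\<^sup>2) \<le> exp (a + - a * \<bar>x\<bar>)" by (simp add: algebra_simps)
  then have "exp (- a * x\<^sup>2) \<le> exp a * exp (- a * \<bar>x\<bar>)" by (simp only: exp_add)
  then show "\<bar>A * exp (- a * x\<^sup>2)\<bar> \<le> (\<bar>A\<bar> * exp a) * exp (- a * \<bar>x\<bar>)"
    by (simp add: abs_mult mult_left_mono mult.assoc)
qed

text \<open>Regular and principal part become ordinary series over the naturals, to which power
  series theory applies.\<close>

lemma has_sum_int_split:
  fixes f :: "int \<Rightarrow> 'a :: banach"
  assumes "(\<lambda>k. norm (f k)) summable_on UNIV"
  shows "(f has_sum ((\<Sum>n. f (int n)) + (\<Sum>n. f (- int (Suc n))))) UNIV"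
    and "summable (\<lambda>n. norm (f (int n)))" "summable (\<lambda>n. norm (f (- int (Suc n))))"
proof -
  have bij1: "bij_betw int UNIV {0..}"
    by (rule bij_betwI[of _ _ _ nat]) auto
  have bij2: "bij_betw (\<lambda>n. - int (Suc n)) UNIV {..<0}"
    by (rule bij_betwI[of _ _ _ "\<lambda>k. nat (- k - 1)"]) auto
  have s1: "(\<lambda>n. norm (f (int n))) summable_on UNIV"
    using summable_on_reindex_bij_betw[OF bij1, of "\<lambda>k. norm (f k)"] summable_on_subset[OF assms, of "{0..}"] by auto
  have s2: "(\<lambda>n. norm (f (- int (Suc n)))) summable_on UNIV"
    using summable_on_reindex_bij_betw[OF bij2, of "\<lambda>k. norm (f k)"] summable_on_subset[OF assms, of "{..<0}"] by auto
  show 1: "summable (\<lambda>n. norm (f (int n)))" and 2: "summable (\<lambda>n. norm (f (- int (Suc n))))"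
    using s1 s2 by (auto intro: summable_on_imp_summable)
  have "((\<lambda>n. f (int n)) has_sum (\<Sum>n. f (int n))) UNIV"
    by (intro norm_summable_imp_has_sum 1 summable_sums summable_norm_cancel)
  then have a: "(f has_sum (\<Sum>n. f (int n))) {0..}"
    using has_sum_reindex_bij_betw[OF bij1, of f] by auto
  have "((\<lambda>n. f (- int (Suc n))) has_sum (\<Sum>n. f (- int (Suc n)))) UNIV"
    by (intro norm_summable_imp_has_sum 2 summable_sums summable_norm_cancel)
  then have b: "(f has_sum (\<Sum>n. f (- int (Suc n)))) {..<0}"
    using has_sum_reindex_bij_betw[OF bij2, of f] by auto
  have "UNIV = {0..} \<union> {..<0::int}" "{0..} \<inter> {..<0::int} = {}" by auto
  then show "(f has_sum ((\<Sum>n. f (int n)) + (\<Sum>n. f (- int (Suc n))))) UNIV"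
    using has_sum_Un_disjoint[OF a b] by metis
qed

text \<open>With \<open>w = exp (2az)\<close>, the series \<open>\<Sum>\<^sub>k d\<^sub>k exp (-a(z-k)\<^sup>2)\<close> is \<open>exp (-az\<^sup>2)\<close> times the Laurent
  series with coefficients \<open>d\<^sub>k exp (-ak\<^sup>2)\<close>. Once this vanishes identically, its regular part is
  entire and tends to \<open>0\<close> at infinity, hence is \<open>0\<close>.\<close>

lemma determined_by_dense_zeros_gaussian:
  assumes a: "a > 0" and A: "A \<noteq> 0"
  shows "determined_by_dense_zeros (\<lambda>x. A * exp (- a * x\<^sup>2))"
  unfolding determined_by_dense_zeros_def
proof (intro allI impI)
  fix d :: "int \<Rightarrow> real" and K \<mu> q D
  let ?\<gamma> = "\<lambda>x. A * exp (- a * x\<^sup>2)"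
  assume d: "lin_growth K d" and mono: "strict_mono (\<mu> :: int \<Rightarrow> real)" and q: "q > 1"
    and D: "\<forall>i. \<bar>\<mu> i - of_int i / q\<bar> \<le> D" and zero: "\<forall>i. shift_series ?\<gamma> d (\<mu> i) = 0"
  obtain B e where B: "B > 0" "e > 0"
    "\<And>k x. \<bar>d k * ?\<gamma> (x - of_int k)\<bar> \<le> B * exp (2 * e * \<bar>x\<bar>) * exp (- e * \<bar>of_int k\<bar>)"
    using series_dominated[OF exp_decay_gaussian[OF a] lin_growth_nonneg[OF d], of A] d by metis
  define S where "S = (\<Sum>\<^sub>\<infinity>k::int. exp (- e * \<bar>of_int k\<bar>))"
  have S: "((\<lambda>k::int. exp (- e * \<bar>of_int k\<bar>)) has_sum S) UNIV"
    unfolding S_def by (intro has_sum_infsum summable_on_int_exp B)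
  define b :: "int \<Rightarrow> complex" where "b k = of_real (A * d k * exp (- a * (of_int k)\<^sup>2))" for k
  have expand: "A * d k * exp (- a * (of_int k)\<^sup>2) * exp (2 * a * x * of_int k) = exp (a * x\<^sup>2) * (d k * ?\<gamma> (x - of_int k))"
    for k :: int and x
  proof -
    have X: "exp (- a * (of_int k)\<^sup>2) * exp (2 * a * x * of_int k) = exp (a * x\<^sup>2) * exp (- a * (x - of_int k)\<^sup>2)"
      unfolding exp_add[symmetric] by (simp add: power2_eq_square algebra_simps)
    have "A * d k * exp (- a * (of_int k)\<^sup>2) * exp (2 * a * x * of_int k)
      = (A * d k) * (exp (- a * (of_int k)\<^sup>2) * exp (2 * a * x * of_int k))" by (rule mult.assoc)
    also have "\<dots> = exp (a * x\<^sup>2) * (d k * ?\<gamma> (x - of_int k))" unfolding X by (simp only: mult_ac)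
    finally show ?thesis .
  qed
  \<comment> \<open>The terms depend on w only through |w| in norm, so the majorant of the series at
    the real point x controls \<open>h\<close> on the entire circle of radius exp(2ax).\<close>
  have normw: "norm (b k * w powi k) = exp (a * x\<^sup>2) * \<bar>d k * ?\<gamma> (x - of_int k)\<bar>" if "norm w = exp (2 * a * x)" for k w x
  proof -
    have "norm (w powi k) = exp (2 * a * x * of_int k)"
      by (simp add: norm_power_int that exp_power_int[symmetric] mult.commute)
    then have "norm (b k * w powi k) = \<bar>A * d k * exp (- a * (of_int k)\<^sup>2) * exp (2 * a * x * of_int k)\<bar>"
      by (simp add: b_def norm_mult abs_mult)
    then show ?thesis unfolding expand by (simp add: abs_mult)
  qed
  have ex: "\<exists>x. norm w = exp (2 * a * x)" if "w \<noteq> 0" for w :: complex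
    using that a by (intro exI[of _ "ln (norm w) / (2 * a)"]) auto
  have summ: "(\<lambda>k. norm (b k * w powi k)) summable_on UNIV" if w: "w \<noteq> 0" for w
  proof -
    obtain x where x: "norm w = exp (2 * a * x)" using ex[OF w] by auto
    show ?thesis unfolding normw[OF x]
      by (intro summable_on_cmult_right series_summable(1)[OF exp_decay_gaussian[OF a] d])
  qed
  \<comment> \<open>The principal part is \<open>Q (inverse w)\<close> with \<open>Q\<close> entire
    and Q(0) = 0. Hence P(w) = -Q(1/w) tends to 0 at infinity as soon as \<open>h\<close>
    vanishes.\<close>
  define P Q where "P w = (\<Sum>n. b (int n) * w ^ n)" and "Q w = (\<Sum>n. b (- int (Suc n)) * w ^ Suc n)" for w
  define h where "h w = P w + Q (inverse w)" for w
  have hs: "((\<lambda>k. b k * w powi k) has_sum h w) UNIV" if w: "w \<noteq> 0" for w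
    using has_sum_int_split(1)[OF summ[OF w]] w
    by (simp add: h_def P_def Q_def power_int_minus power_inverse del: of_nat_Suc power_Suc)
  have sumP: "summable (\<lambda>n. b (int n) * w ^ n)" for w
  proof (cases "w = 0")
    case False
    then show ?thesis using summable_norm_cancel[OF has_sum_int_split(2)[OF summ[OF False]]] by simp
  qed (auto intro!: summable_finite[of "{0}"])
  have sumQ: "summable (\<lambda>n. b (- int (Suc n)) * w ^ Suc n)" for w
  proof (cases "w = 0")
    case False
    then have "inverse w \<noteq> 0" by simp
    from summable_norm_cancel[OF has_sum_int_split(3)[OF summ[OF this]]] show ?thesis 
      by (simp add: power_int_minus power_inverse del: of_nat_Suc power_Suc)
  qed auto
  have holP: "P holomorphic_on UNIV"
    unfolding P_def by (intro entire_power_series sumP)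
  define Q1 where "Q1 w = (\<Sum>n. b (- int (Suc n)) * w ^ n)" for w
  have sumQ1: "summable (\<lambda>n. b (- int (Suc n)) * w ^ n)" for w
  proof (cases "w = 0")
    case False
    then show ?thesis using summable_mult[OF sumQ[of w], of "inverse w"] by (simp add: field_simps)
  qed (auto intro!: summable_finite[of "{0}"])
  have holQ1: "Q1 holomorphic_on UNIV"
    unfolding Q1_def by (intro entire_power_series sumQ1)
  have QQ1: "Q w = w * Q1 w" for w
    unfolding Q_def Q1_def using suminf_mult[OF sumQ1[of w], of w] by (simp add: mult_ac)
  have holQ: "Q holomorphic_on UNIV"
    unfolding QQ1 [abs_def] by (intro holomorphic_intros holQ1)
  have holh: "h holomorphic_on -{0}"
    unfolding h_def
    by (intro holomorphic_intros holomorphic_on_subset[OF holP] 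
          holomorphic_on_compose_gen[OF _ holQ, unfolded o_def]) auto
  have growth: "norm (h w) \<le> (B * S) * exp (a * T\<^sup>2 + (2 * e) * \<bar>T\<bar>)" if w: "norm w = exp (2 * a * T)" for w T
  proof -
    have w0: "w \<noteq> 0" using w by auto
    have "norm (h w) \<le> exp (a * T\<^sup>2) * (B * exp (2 * e * \<bar>T\<bar>) * S)"
    proof -
      have "norm (h w) \<le> (\<Sum>\<^sub>\<infinity>k. norm (b k * w powi k))"
        by (rule norm_has_sum_bound[OF has_sum_infsum[OF summ[OF w0]] hs[OF w0]])
      also have "\<dots> \<le> exp (a * T\<^sup>2) * (B * exp (2 * e * \<bar>T\<bar>) * S)"
      proof (rule has_sum_mono)
        show "((\<lambda>k. norm (b k * w powi k)) has_sum (\<Sum>\<^sub>\<infinity>k. norm (b k * w powi k))) UNIV"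
          by (rule has_sum_infsum[OF summ[OF w0]])
        show "((\<lambda>k. exp (a * T\<^sup>2) * (B * exp (2 * e * \<bar>T\<bar>) * exp (- e * \<bar>of_int k\<bar>))) has_sum
            exp (a * T\<^sup>2) * (B * exp (2 * e * \<bar>T\<bar>) * S)) UNIV"
          by (intro has_sum_cmult_right S)
        show "norm (b k * w powi k) \<le> exp (a * T\<^sup>2) * (B * exp (2 * e * \<bar>T\<bar>) * exp (- e * \<bar>of_int k\<bar>))" for k
          unfolding normw[OF w] by (intro mult_left_mono B) auto
      qed
      finally show ?thesis .
    qed
    then show ?thesis by (simp add: exp_add mult_ac)
  qed
  have S0: "S > 0"
  proof -
    have "sum (\<lambda>k::int. exp (- e * \<bar>of_int k\<bar>)) {0} \<le> S"
      by (rule finite_sum_le_has_sum[OF S]) auto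
    then show ?thesis by simp
  qed
  have hz: "h (complex_of_real (exp (2 * a * \<mu> i))) = 0" for i
  proof -
    let ?w = "complex_of_real (exp (2 * a * \<mu> i))"
    have "b k * ?w powi k = of_real (exp (a * (\<mu> i)\<^sup>2) * (d k * ?\<gamma> (\<mu> i - of_int k)))" for k
    proof -
      have "?w powi k = of_real (exp (2 * a * \<mu> i * of_int k))"
        unfolding of_real_power_int[symmetric] exp_power_int by (simp only: mult.commute)
      then show ?thesis unfolding b_def expand[symmetric] by simp
    qed
    moreover have "((\<lambda>k. exp (a * (\<mu> i)\<^sup>2) * (d k * ?\<gamma> (\<mu> i - of_int k))) has_sum exp (a * (\<mu> i)\<^sup>2) * 0) UNIV"
      using zero series_summable(2)[OF exp_decay_gaussian[OF a] d]
      by (intro has_sum_cmult_right) (auto simp: has_sum_iff shift_series_def)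
    ultimately have "((\<lambda>k. b k * ?w powi k) has_sum of_real 0) UNIV"
      by (simp only: has_sum_of_real mult_zero_right)
    moreover have "?w \<noteq> 0" by simp
    ultimately show ?thesis using hs has_sum_unique by (metis of_real_0)
  qed
  have h0: "h w = 0" if "w \<noteq> 0" for w
    by (rule punctured_plane_zero_density[OF holh a _ _ growth hz mono q D[rule_format] that])
       (use B S0 in auto)
  have "(P \<longlongrightarrow> 0) at_infinity"
  proof -
    have "isCont Q 0" using holQ holomorphic_on_imp_continuous_on continuous_on_eq_continuous_at by blast
    then have "(Q \<longlongrightarrow> 0) (at 0)" unfolding isCont_def by (simp add: QQ1)
    then have "((\<lambda>w. - Q (inverse w)) \<longlongrightarrow> - 0) at_infinity"
      by (intro tendsto_minus) (simp add: lim_at_infinity_0 o_def)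
    moreover have "\<forall>\<^sub>F w in at_infinity. - Q (inverse w) = P w"
      unfolding eventually_at_infinity
    proof (intro exI[of _ 1] allI impI)
      fix w :: complex assume "1 \<le> norm w"
      then have "w \<noteq> 0" by auto
      from h0[OF this] show "- Q (inverse w) = P w"
        by (intro minus_unique) (simp add: h_def add.commute)
    qed
    ultimately show ?thesis by (simp add: tendsto_cong)
  qed
  then have "P 0 = 0" by (rule Liouville_weak_0[OF holP])
  then have "b 0 = 0" using suminf_finite[of "{0::nat}" "\<lambda>n. b (int n) * 0 ^ n"] by (simp add: P_def)
  then show "d 0 = 0" using A by (simp add: b_def)
qed

section \<open>Convolution with exponential densities\<close>

lemma integrable_exp_abs:
  fixes e :: real
  assumes "e > 0"
  shows "integrable lborel (\<lambda>x. exp (- e * \<bar>x\<bar>))"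
proof -
  interpret prob_space "density lborel (exponential_density e)"
    by (rule prob_space_exponential_density) fact
  have "integrable (density lborel (exponential_density e)) (\<lambda>_. 1 :: real)" by simp
  then have 1: "integrable lborel (exponential_density e)"
    using assms by (subst (asm) integrable_density) (auto simp: exponential_density_nonneg)
  have 2: "integrable lborel (\<lambda>x. exponential_density e (- x))"
    using lborel_integrable_real_affine[OF 1, of "-1" 0] by simp
  have "integrable lborel (\<lambda>x. (exponential_density e x + exponential_density e (- x)) / e)"
    using 1 2 by auto
  then show ?thesis
    by (rule Bochner_Integration.integrable_bound) (use assms in \<open>auto simp: exponential_density_def abs_if divide_simps mult.commute\<close>)
qed

lemma exp_decay_integrable:
  assumes "exp_decay F" "continuous_on UNIV F"
  shows "integrable lborel F"
proof -
  obtain C e where C: "C > 0" "e > 0" "\<And>x. \<bar>F x\<bar> \<le> C * exp (- e * \<bar>x\<bar>)"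
    using exp_decayE[OF assms(1)] by metis
  show ?thesis
  proof (rule Bochner_Integration.integrable_bound)
    show "integrable lborel (\<lambda>x. C * exp (- e * \<bar>x\<bar>))"
      using integrable_exp_abs[OF C(2)] by simp
    show "F \<in> borel_measurable lborel" using assms(2) borel_measurable_continuous_onI by auto
    show "AE x in lborel. norm (F x) \<le> norm (C * exp (- e * \<bar>x\<bar>))" using C by auto
  qed
qed

lemma exp_decay_bounded:
  assumes "exp_decay F"
  obtains C where "C > 0" "\<And>x. \<bar>F x\<bar> \<le> C"
proof -
  obtain C e where C: "C > 0" "e > 0" "\<And>x. \<bar>F x\<bar> \<le> C * exp (- e * \<bar>x\<bar>)"
    using exp_decayE[OF assms(1)] by metis
  have "\<bar>F x\<bar> \<le> C" for x
  proof -
    have "C * exp (- e * \<bar>x\<bar>) \<le> C * 1" using C by (intro mult_left_mono) auto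
    with C(3)[of x] show ?thesis by linarith
  qed
  then show ?thesis using that C by blast
qed

definition expo :: "real measure" where
  "expo = density lborel (exponential_density 1)"

lemma sets_expo [simp, measurable_cong]: "sets expo = sets borel" and space_expo [simp]: "space expo = UNIV"
  by (auto simp: expo_def)

interpretation expo: prob_space expo
  unfolding expo_def by (rule prob_space_exponential_density) simp

interpretation expo_lborel: pair_sigma_finite expo lborel ..

lemma AE_expo_nonneg: "AE s in expo. s \<ge> 0"
  unfolding expo_def by (subst AE_density) (auto simp: exponential_density_def)

lemma integrable_expo_iff:
  fixes f :: "real \<Rightarrow> 'a :: {banach, second_countable_topology}"
  assumes "f \<in> borel_measurable borel"
  shows "integrable expo f \<longleftrightarrow> integrable lborel (\<lambda>s. (indicator {0..} s * exp (- s)) *\<^sub>R f s)"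
    and "integral\<^sup>L expo f = (\<integral>s. (indicator {0..} s * exp (- s)) *\<^sub>R f s \<partial>lborel)"
proof -
  have eq: "indicator {0..} s * exp (- s) = exponential_density 1 s" for s
    by (auto simp: exponential_density_def indicator_def)
  show "integrable expo f \<longleftrightarrow> integrable lborel (\<lambda>s. (indicator {0..} s * exp (- s)) *\<^sub>R f s)"
    and "integral\<^sup>L expo f = (\<integral>s. (indicator {0..} s * exp (- s)) *\<^sub>R f s \<partial>lborel)"
    unfolding expo_def eq using assms
    by (subst integrable_density integral_density; auto simp: exponential_density_nonneg)+
qed

lemma integrable_expo_exp_half: "integrable expo (\<lambda>s. exp (s / 2))"
proof (subst integrable_expo_iff)
  have "integrable lborel (\<lambda>s::real. exp (- (1/2) * \<bar>s\<bar>))" by (rule integrable_exp_abs) simp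
  then show "integrable lborel (\<lambda>s::real. (indicator {0..} s * exp (- s)) *\<^sub>R exp (s / 2))"
    by (rule Bochner_Integration.integrable_bound) (auto simp: indicator_def exp_add[symmetric])
qed auto

text \<open>As an expectation over a standard exponential variable s, one formula covers positive,
  negative and zero \<delta>. The law of \<delta>s has Fourier transform 1/(1 + 2 pi i \<delta>
  \<xi>), one factor of the defining product.\<close>

definition expconv :: "real \<Rightarrow> (real \<Rightarrow> real) \<Rightarrow> real \<Rightarrow> real" where
  "expconv \<delta> F x = (\<integral>s. F (x - \<delta> * s) \<partial>expo)"

lemma expconv_0 [simp]: "expconv 0 F = F"
  by (auto simp: expconv_def fun_eq_iff expo.prob_space[simplified])

context
  fixes F :: "real \<Rightarrow> real"
  assumes dec: "exp_decay F" and cont: "continuous_on UNIV F"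
begin

lemma integrable_expo_shift: "integrable expo (\<lambda>s. F (x - \<delta> * s))"
proof -
  have [measurable]: "F \<in> borel_measurable borel" using cont by (rule borel_measurable_continuous_onI)
  obtain C where C: "C > 0" "\<And>x. \<bar>F x\<bar> \<le> C" using exp_decay_bounded[OF dec] by metis
  have "integrable expo (\<lambda>s::real. C)" by simp
  then show ?thesis by (rule Bochner_Integration.integrable_bound) (use C in auto)
qed

lemma continuous_on_expconv: "continuous_on UNIV (expconv \<delta> F)"
proof (rule continuous_on_sequentiallyI)
  have [measurable]: "F \<in> borel_measurable borel" using cont by (rule borel_measurable_continuous_onI)
  fix u and l :: real assume u: "u \<longlonglongrightarrow> l"
  obtain C where C: "C > 0" "\<And>x. \<bar>F x\<bar> \<le> C" using exp_decay_bounded[OF dec] by metis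
  show "(\<lambda>n. expconv \<delta> F (u n)) \<longlonglongrightarrow> expconv \<delta> F l"
    unfolding expconv_def
  proof (rule integral_dominated_convergence[where w = "\<lambda>_. C"])
    have "isCont F x" for x using cont by (simp add: continuous_on_eq_continuous_at)
    then show "AE s in expo. (\<lambda>n. F (u n - \<delta> * s)) \<longlonglongrightarrow> F (l - \<delta> * s)"
      using u by (intro AE_I2 isCont_tendsto_compose[of _ F] tendsto_intros)
  qed (use C in auto)
qed

text \<open>Replacing x - \<delta>s by x in the decay costs exp(\<eta>|\<delta>|s). The rate \<eta>
  is lowered until \<eta>|\<delta>| \<le> 1/2, so that the loss is at most exp(s/2), which is
  integrable against exp(-s).\<close>

lemma exp_decay_expconv: "exp_decay (expconv \<delta> F)"
proof -
  obtain C e where C: "C > 0" "e > 0" "\<And>x. \<bar>F x\<bar> \<le> C * exp (- e * \<bar>x\<bar>)"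
    using exp_decayE[OF dec] by metis
  define \<eta> where "\<eta> = min e (1 / (2 * \<bar>\<delta>\<bar> + 2))"
  have \<eta>: "\<eta> > 0" "\<eta> \<le> e" using C by (auto simp: \<eta>_def)
  have \<eta>\<delta>: "\<eta> * \<bar>\<delta>\<bar> \<le> 1 / 2"
  proof -
    have "\<eta> * \<bar>\<delta>\<bar> \<le> 1 / (2 * \<bar>\<delta>\<bar> + 2) * \<bar>\<delta>\<bar>" unfolding \<eta>_def by (intro mult_right_mono) auto
    also have "\<dots> \<le> 1 / 2" by (simp add: divide_simps)
    finally show ?thesis .
  qed
  define J where "J = (\<integral>s. exp (s / 2) \<partial>expo)"
  have "\<bar>expconv \<delta> F x\<bar> \<le> (C * J) * exp (- \<eta> * \<bar>x\<bar>)" for x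
  proof -
    have "norm (expconv \<delta> F x) \<le> (\<integral>s. norm (F (x - \<delta> * s)) \<partial>expo)"
      unfolding expconv_def by (rule integral_norm_bound)
    also have "\<dots> \<le> (\<integral>s. C * exp (- \<eta> * \<bar>x\<bar>) * exp (s / 2) \<partial>expo)"
    proof (rule integral_mono_AE)
      show "integrable expo (\<lambda>s. norm (F (x - \<delta> * s)))" using integrable_expo_shift by auto
      show "integrable expo (\<lambda>s. C * exp (- \<eta> * \<bar>x\<bar>) * exp (s / 2))" using integrable_expo_exp_half by auto
      show "AE s in expo. norm (F (x - \<delta> * s)) \<le> C * exp (- \<eta> * \<bar>x\<bar>) * exp (s / 2)"
        using AE_expo_nonneg
      proof eventually_elim
        case (elim s)
        have "\<bar>x\<bar> \<le> \<bar>x - \<delta> * s\<bar> + \<bar>\<delta> * s\<bar>" by linarith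
        then have "\<bar>x\<bar> \<le> \<bar>x - \<delta> * s\<bar> + \<bar>\<delta>\<bar> * s" using elim by (simp add: abs_mult)
        then have "\<eta> * \<bar>x\<bar> \<le> \<eta> * (\<bar>x - \<delta> * s\<bar> + \<bar>\<delta>\<bar> * s)"
          using \<eta> by (intro mult_left_mono) auto
        moreover have "\<eta> * \<bar>x - \<delta> * s\<bar> \<le> e * \<bar>x - \<delta> * s\<bar>" using \<eta> by (intro mult_right_mono) auto
        moreover have "(\<eta> * \<bar>\<delta>\<bar>) * s \<le> 1 / 2 * s" using \<eta>\<delta> elim by (intro mult_right_mono) auto
        ultimately have "- e * \<bar>x - \<delta> * s\<bar> \<le> - \<eta> * \<bar>x\<bar> + s / 2" by (simp add: algebra_simps)
        then have "C * exp (- e * \<bar>x - \<delta> * s\<bar>) \<le> C * exp (- \<eta> * \<bar>x\<bar> + s / 2)" using C by simp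
        then show ?case using C(3)[of "x - \<delta> * s"] by (simp only: exp_add mult.assoc real_norm_def)
      qed
    qed
    also have "\<dots> = (C * J) * exp (- \<eta> * \<bar>x\<bar>)" by (simp add: J_def)
    finally show ?thesis by simp
  qed
  then show ?thesis unfolding exp_decay_def using \<eta> by blast
qed

text \<open>Substitute u = x - \<delta>s. The domain s \<ge> 0 becomes the half-line u \<le> x for
  \<delta> > 0 and u \<ge> x for \<delta> < 0, both expressed by 0 \<le> (x - u)/\<delta>.\<close>

lemma exp_times_expconv:
  assumes \<delta>: "\<delta> \<noteq> 0"
  shows "integrable lborel (\<lambda>u. indicator {u. 0 \<le> (x - u) / \<delta>} u * (exp (u / \<delta>) * F u))" (is "integrable _ ?h")
    and "\<bar>\<delta>\<bar> * (exp (x / \<delta>) * expconv \<delta> F x) = (\<integral>u. indicator {u. 0 \<le> (x - u) / \<delta>} u * (exp (u / \<delta>) * F u) \<partial>lborel)"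
proof -
  have [measurable]: "F \<in> borel_measurable borel" using cont by (rule borel_measurable_continuous_onI)
  have eq: "?h (x + (- \<delta>) * s) = exp (x / \<delta>) * ((indicator {0..} s * exp (- s)) *\<^sub>R F (x - \<delta> * s))" for s
  proof -
    have "(x - (x + - \<delta> * s)) / \<delta> = s" "(x + - \<delta> * s) / \<delta> = x / \<delta> + - s"
      using \<delta> by (simp_all add: field_simps)
    then show ?thesis unfolding \<open>(x + - \<delta> * s) / \<delta> = x / \<delta> + - s\<close> exp_add by (simp add: indicator_def)
  qed
  have "integrable lborel (\<lambda>s. exp (x / \<delta>) * ((indicator {0..} s * exp (- s)) *\<^sub>R F (x - \<delta> * s)))"
    using integrable_expo_shift[of x \<delta>] by (subst (asm) integrable_expo_iff) auto
  then have "integrable lborel (\<lambda>s. ?h (x + (- \<delta>) * s))" unfolding eq .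
  then show "integrable lborel ?h"
    by (subst (asm) lborel_integrable_real_affine_iff) (use \<delta> in auto)
  have "(\<integral>u. ?h u \<partial>lborel) = \<bar>- \<delta>\<bar> *\<^sub>R (\<integral>s. ?h (x + (- \<delta>) * s) \<partial>lborel)"
    by (rule lborel_integral_real_affine) (use \<delta> in auto)
  also have "(\<integral>s. ?h (x + (- \<delta>) * s) \<partial>lborel) = exp (x / \<delta>) * expconv \<delta> F x"
    unfolding eq expconv_def by (subst integrable_expo_iff(2)) auto
  finally show "\<bar>\<delta>\<bar> * (exp (x / \<delta>) * expconv \<delta> F x) = (\<integral>u. ?h u \<partial>lborel)" by simp
qed

text \<open>Integrated form of the differential equation f + \<delta> f' = F for f =
  \<open>expconv \<delta> F\<close>, with integrating factor exp(u/\<delta>). The integral version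
  passes to uniform limits without differentiating a series term by term.\<close>

lemma expconv_increment:
  assumes \<delta>: "\<delta> \<noteq> 0" and xy: "x \<le> y"
  shows "((\<lambda>u. exp (u / \<delta>) * F u) has_integral \<delta> * (exp (y / \<delta>) * expconv \<delta> F y - exp (x / \<delta>) * expconv \<delta> F x)) {x..y}"
proof -
  have [measurable]: "F \<in> borel_measurable borel" using cont by (rule borel_measurable_continuous_onI)
  let ?H = "\<lambda>u. exp (u / \<delta>) * F u"
  let ?h = "\<lambda>x u. indicator {u. 0 \<le> (x - u) / \<delta>} u * ?H u"
  have cH: "continuous_on {x..y} ?H"
    using \<delta> by (intro continuous_intros continuous_on_subset[OF cont]) auto
  have si: "set_integrable lborel {x..y} ?H" by (rule borel_integrable_atLeastAtMost'[OF cH])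
  have "\<bar>\<delta>\<bar> * (exp (y / \<delta>) * expconv \<delta> F y - exp (x / \<delta>) * expconv \<delta> F x)
      = (\<integral>u. ?h y u \<partial>lborel) - (\<integral>u. ?h x u \<partial>lborel)"
    unfolding right_diff_distrib exp_times_expconv(2)[OF \<delta>] ..
  also have "\<dots> = (\<integral>u. ?h y u - ?h x u \<partial>lborel)"
    by (rule Bochner_Integration.integral_diff[symmetric]) (rule exp_times_expconv(1)[OF \<delta>])+
  \<comment> \<open>The half-lines for y and x differ by the interval between them; for \<delta> < 0
    both extend to the right and the difference carries a minus sign. The endpoints form a null
    set.\<close>
  also have "\<dots> = (\<integral>u. sgn \<delta> * (indicator {x..y} u *\<^sub>R ?H u) \<partial>lborel)"
  proof (rule integral_cong_AE)
    have "AE u in lborel. u \<noteq> x \<and> u \<noteq> y" using AE_lborel_singleton[of x] AE_lborel_singleton[of y] by auto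
    then show "AE u in lborel. ?h y u - ?h x u = sgn \<delta> * (indicator {x..y} u *\<^sub>R ?H u)"
    proof eventually_elim
      case (elim u)
      show ?case
      proof (cases "\<delta> > 0")
        case True then show ?thesis using elim xy by (auto simp: indicator_def zero_le_divide_iff)
      next
        case False then show ?thesis using elim xy \<delta> by (auto simp: indicator_def zero_le_divide_iff)
      qed
    qed
  qed measurable
  also have "\<dots> = sgn \<delta> * (LINT u:{x..y}|lborel. ?H u)" by (simp add: set_lebesgue_integral_def)
  also have "(LINT u:{x..y}|lborel. ?H u) = integral {x..y} ?H" by (rule set_borel_integral_eq_integral(2)[OF si])
  finally have "sgn \<delta> * (\<bar>\<delta>\<bar> * (exp (y / \<delta>) * expconv \<delta> F y - exp (x / \<delta>) * expconv \<delta> F x)) = sgn \<delta> * sgn \<delta> * integral {x..y} ?H"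
    by simp
  moreover have "sgn \<delta> * sgn \<delta> = 1" "sgn \<delta> * \<bar>\<delta>\<bar> = \<delta>" using \<delta> by (auto simp: sgn_if)
  ultimately have "integral {x..y} ?H = \<delta> * (exp (y / \<delta>) * expconv \<delta> F y - exp (x / \<delta>) * expconv \<delta> F x)"
    by (simp only: mult.assoc[symmetric])
  then show ?thesis using integrable_integral[OF integrable_continuous_interval[OF cH]] by simp
qed

text \<open>The previous identity is summed over integer shifts. The M-test gives uniform
  convergence on [x, y], hence both continuity and integration term by term.\<close>

lemma shift_series_increment:
  assumes \<delta>: "\<delta> \<noteq> 0" and xy: "x \<le> y" and d: "lin_growth K d"
  shows "continuous_on {x..y} (\<lambda>u. exp (u / \<delta>) * shift_series F d u)"
    and "((\<lambda>u. exp (u / \<delta>) * shift_series F d u) has_integral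
      \<delta> * (exp (y / \<delta>) * shift_series (expconv \<delta> F) d y - exp (x / \<delta>) * shift_series (expconv \<delta> F) d x)) {x..y}"
proof -
  let ?f = "\<lambda>k u. exp (u / \<delta>) * (d k * F (u - of_int k))"
  let ?J = "\<lambda>k. \<delta> * (exp (y / \<delta>) * (d k * expconv \<delta> F (y - of_int k)) - exp (x / \<delta>) * (d k * expconv \<delta> F (x - of_int k)))"
  obtain B e where B: "B > 0" "e > 0"
    "\<And>k x. \<bar>d k * F (x - of_int k)\<bar> \<le> B * exp (2 * e * \<bar>x\<bar>) * exp (- e * \<bar>of_int k\<bar>)"
    using series_dominated[OF dec lin_growth_nonneg[OF d]] d by metis
  define L where "L = \<bar>x\<bar> + \<bar>y\<bar>"
  have UL: "uniform_limit {x..y} (\<lambda>X u. \<Sum>k\<in>X. ?f k u) (\<lambda>u. \<Sum>\<^sub>\<infinity>k. ?f k u) (finite_subsets_at_top UNIV)"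
  proof (rule Weierstrass_m_test_general)
    show "(\<lambda>k::int. exp (L / \<bar>\<delta>\<bar>) * (B * exp (2 * e * L)) * exp (- e * \<bar>of_int k\<bar>)) summable_on UNIV"
      by (intro summable_on_cmult_right summable_on_int_exp B)
    fix k :: int and u assume "u \<in> {x..y}"
    then have uL: "\<bar>u\<bar> \<le> L" unfolding L_def by auto
    have "u / \<delta> \<le> \<bar>u\<bar> / \<bar>\<delta>\<bar>" by (metis abs_divide abs_ge_self)
    also have "\<dots> \<le> L / \<bar>\<delta>\<bar>" using uL by (intro divide_right_mono) auto
    finally have 1: "exp (u / \<delta>) \<le> exp (L / \<bar>\<delta>\<bar>)" by simp
    have "\<bar>d k * F (u - of_int k)\<bar> \<le> B * exp (2 * e * L) * exp (- e * \<bar>of_int k\<bar>)"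
      using B(3)[of k u] by (rule order_trans) (intro mult_right_mono mult_left_mono, use B uL in auto)
    then have "exp (u / \<delta>) * \<bar>d k * F (u - of_int k)\<bar> \<le> exp (L / \<bar>\<delta>\<bar>) * (B * exp (2 * e * L) * exp (- e * \<bar>of_int k\<bar>))"
      using 1 by (intro mult_mono) auto
    then show "norm (?f k u) \<le> exp (L / \<bar>\<delta>\<bar>) * (B * exp (2 * e * L)) * exp (- e * \<bar>of_int k\<bar>)"
      by (simp add: abs_mult mult.assoc)
  qed
  have eq: "(\<Sum>\<^sub>\<infinity>k. ?f k u) = exp (u / \<delta>) * shift_series F d u" for u
    unfolding shift_series_def by (rule infsum_cmult_right) (use series_summable[OF dec d] in auto)
  have cf: "continuous_on {x..y} (\<lambda>u. \<Sum>k\<in>X. ?f k u)" for X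
    using \<delta> by (intro continuous_intros continuous_on_compose2[OF cont]) auto
  have nb: "finite_subsets_at_top (UNIV :: int set) \<noteq> bot" by simp
  show "continuous_on {x..y} (\<lambda>u. exp (u / \<delta>) * shift_series F d u)"
    unfolding eq[symmetric] by (rule uniform_limit_theorem[OF _ UL nb]) (use cf in auto)
  obtain I J where IJ: "\<And>X. ((\<lambda>u. \<Sum>k\<in>X. ?f k u) has_integral I X) {x..y}"
    "((\<lambda>u. \<Sum>\<^sub>\<infinity>k. ?f k u) has_integral J) {x..y}" "(I \<longlongrightarrow> J) (finite_subsets_at_top UNIV)"
    by (rule uniform_limit_integral[OF UL cf nb]) (assumption | rule that)+
  \<comment> \<open>The increment identity is used on [x - k, y - k]; writing exp(u/\<delta>) =
    exp(k/\<delta>) exp((u - k)/\<delta>) brings all shifts to the common weight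
    exp(u/\<delta>).\<close>
  have single: "(?f k has_integral ?J k) {x..y}" for k
  proof -
    have "((\<lambda>u. exp (u / \<delta>) * F u) has_integral \<delta> * (exp ((y - k) / \<delta>) * expconv \<delta> F (y - k) - exp ((x - k) / \<delta>) * expconv \<delta> F (x - k))) {x - k..y - k}"
      by (rule expconv_increment) (use \<delta> xy in auto)
    then have "((\<lambda>u. exp ((u - k) / \<delta>) * F (u - k)) has_integral \<delta> * (exp ((y - k) / \<delta>) * expconv \<delta> F (y - k) - exp ((x - k) / \<delta>) * expconv \<delta> F (x - k))) {x..y}"
      using has_integral_affinity'[of "\<lambda>u. exp (u / \<delta>) * F u" _ "x - k" "y - k" 1 "- real_of_int k"] by simp
    note A = has_integral_mult_right[OF this, of "exp (k / \<delta>) * d k"]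
    have E: "exp (u / \<delta>) = exp (k / \<delta>) * exp ((u - k) / \<delta>)" for u :: real
      unfolding exp_add[symmetric] by (simp add: diff_divide_distrib)
    have F1: "exp (k / \<delta>) * d k * (exp ((u - k) / \<delta>) * F (u - k)) = ?f k u" for u :: real
      unfolding E[of u] by (simp only: mult_ac)
    have F2: "exp (k / \<delta>) * d k * (\<delta> * (exp ((y - k) / \<delta>) * expconv \<delta> F (y - k) - exp ((x - k) / \<delta>) * expconv \<delta> F (x - k))) = ?J k"
      unfolding E[of x] E[of y] by (simp only: right_diff_distrib mult_ac)
    show ?thesis using A unfolding F1 F2 .
  qed
  have "I X = (\<Sum>k\<in>X. ?J k)" if "finite X" for X
    using IJ(1)[of X] has_integral_sum[OF that single] by (rule has_integral_unique)
  then have hJ: "(?J has_sum J) UNIV"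
    unfolding has_sum_def using IJ(3)
    by (subst tendsto_cong[of _ I]) (auto intro!: eventually_finite_subsets_at_top_weakI)
  have hs: "((\<lambda>k. d k * expconv \<delta> F (z - of_int k)) has_sum shift_series (expconv \<delta> F) d z) UNIV" for z
    unfolding shift_series_def by (intro has_sum_infsum series_summable(2)[OF exp_decay_expconv d])
  have "(?J has_sum \<delta> * (exp (y / \<delta>) * shift_series (expconv \<delta> F) d y - exp (x / \<delta>) * shift_series (expconv \<delta> F) d x)) UNIV"
    using has_sum_cmult_right[OF has_sum_add[OF has_sum_cmult_right[OF hs[of y], of "exp (y / \<delta>)"]
        has_sum_uminusI[OF has_sum_cmult_right[OF hs[of x], of "exp (x / \<delta>)"]]], of \<delta>] by simp
  from has_sum_unique[OF hJ this] IJ(2) show "((\<lambda>u. exp (u / \<delta>) * shift_series F d u) has_integral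
      \<delta> * (exp (y / \<delta>) * shift_series (expconv \<delta> F) d y - exp (x / \<delta>) * shift_series (expconv \<delta> F) d x)) {x..y}"
    unfolding eq by (simp only:)
qed

end

section \<open>Rolle's theorem and the transfer of zeros\<close>

lemma has_integral_0_imp_zero:
  fixes g :: "real \<Rightarrow> real"
  assumes "x < y" "continuous_on {x..y} g" "(g has_integral 0) {x..y}"
  shows "\<exists>u. x < u \<and> u < y \<and> g u = 0"
proof -
  have "\<exists>u>x. u < y \<and> (\<lambda>v. g u * v) = (\<lambda>v. 0)"
  proof (rule Rolle_deriv[OF \<open>x < y\<close>])
    show "integral {x..x} g = integral {x..y} g" using assms(3) by (simp add: integral_unique)
    show "continuous_on {x..y} (\<lambda>t. integral {x..t} g)"
      by (intro indefinite_integral_continuous_1 integrable_continuous_interval assms)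
    fix t assume t: "x < t" "t < y"
    have "((\<lambda>t. integral {x..t} g) has_real_derivative g t) (at t within {x..y})"
      by (rule integral_has_real_derivative[OF assms(2)]) (use t in auto)
    then show "((\<lambda>t. integral {x..t} g) has_derivative (\<lambda>v. g t * v)) (at t)"
      using t by (simp add: has_field_derivative_def at_within_Icc_at)
  qed
  then show ?thesis by (metis mult.right_neutral)
qed

text \<open>Between consecutive zeros of the convolved series the increment, hence the integral of
  exp(u/\<delta>) times the original series, is 0; so the original series vanishes somewhere
  strictly in between. The new zeros interlace the old ones, and since 1/q < 1 their deviation from
  i/q is at most D + 1.\<close>

lemma determined_by_dense_zeros_expconv:
  assumes dec: "exp_decay F" and cont: "continuous_on UNIV F" and det: "determined_by_dense_zeros F"
  shows "determined_by_dense_zeros (expconv \<delta> F)"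
proof (cases "\<delta> = 0")
  case True
  then show ?thesis using det by simp
next
  case False
  show ?thesis
    unfolding determined_by_dense_zeros_def
  proof (intro allI impI)
    fix d :: "int \<Rightarrow> real" and K \<mu> q D
    assume d: "lin_growth K d" and mono: "strict_mono (\<mu> :: int \<Rightarrow> real)" and q: "q > 1"
      and D: "\<forall>i. \<bar>\<mu> i - of_int i / q\<bar> \<le> D" and zero: "\<forall>i. shift_series (expconv \<delta> F) d (\<mu> i) = 0"
    have "\<exists>u. \<mu> i < u \<and> u < \<mu> (i + 1) \<and> shift_series F d u = 0" for i
    proof -
      have lt: "\<mu> i < \<mu> (i + 1)" using mono by (simp add: strict_mono_less)
      note * = shift_series_increment[OF dec cont False less_imp_le[OF lt] d]
      from has_integral_0_imp_zero[OF lt *(1)] *(2) zero show ?thesis by auto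
    qed
    then obtain \<nu> where \<nu>: "\<And>i. \<mu> i < \<nu> i" "\<And>i. \<nu> i < \<mu> (i + 1)" "\<And>i. shift_series F d (\<nu> i) = 0" by metis
    have "strict_mono \<nu>"
    proof (rule strict_monoI)
      fix i j :: int assume "i < j"
      then have "\<mu> (i + 1) \<le> \<mu> j" using strict_mono_less_eq[OF mono] by simp
      with \<nu>(2)[of i] \<nu>(1)[of j] show "\<nu> i < \<nu> j" by linarith
    qed
    moreover have "\<bar>\<nu> i - of_int i / q\<bar> \<le> D + 1" for i
    proof -
      have "of_int (i + 1) / q \<le> of_int i / q + 1" using q by (simp add: field_simps)
      moreover have "\<bar>\<mu> i - of_int i / q\<bar> \<le> D" "\<bar>\<mu> (i + 1) - of_int (i + 1) / q\<bar> \<le> D"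
        using D by blast+
      ultimately show ?thesis using \<nu>(1)[of i] \<nu>(2)[of i] by linarith
    qed
    ultimately show "d 0 = 0"
      using det d q \<nu>(3) unfolding determined_by_dense_zeros_def by blast
  qed
qed

section \<open>Fourier transforms of functions of Gaussian type\<close>

lemma fourier_transform_kernel_integrable:
  fixes f :: "real \<Rightarrow> complex"
  assumes "integrable lborel f"
  shows "integrable lborel (\<lambda>x. f x * exp (- (2 * complex_of_real pi * \<i> * complex_of_real (x * \<xi>))))"
  by (rule Bochner_Integration.integrable_bound[OF assms]) (use assms in \<open>auto simp: norm_mult norm_exp_eq_Re\<close>)

lemma fourier_transform_eq_iexp:
  "fourier_transform f \<xi> = (LINT x|lborel. f x * iexp ((- 2 * pi * \<xi>) * x))"
  unfolding fourier_transform_def by (simp add: mult_ac)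

lemma fourier_transform_gaussian:
  fixes c :: real
  assumes c: "c > 0"
  obtains a A where "a > 0" "A \<noteq> 0"
    "\<And>\<xi>. fourier_transform (\<lambda>x. complex_of_real (A * exp (- a * x\<^sup>2))) \<xi> = exp (- complex_of_real (c * \<xi>\<^sup>2))"
proof
  \<comment> \<open>The normal density with standard deviation \<sigma> has transform exp(-2 pi^2
    \<sigma>^2 \<xi>^2); this choice makes 2 pi^2 \<sigma>^2 equal to c.\<close>
  define \<sigma> where "\<sigma> = sqrt c / (sqrt 2 * pi)"
  have \<sigma>: "\<sigma> > 0" using c by (simp add: \<sigma>_def)
  have \<sigma>2: "2 * pi\<^sup>2 * \<sigma>\<^sup>2 = c" using c by (simp add: \<sigma>_def power_divide power_mult_distrib)
  show "1 / (2 * \<sigma>\<^sup>2) > 0" "1 / (\<sigma> * sqrt (2 * pi)) \<noteq> 0" using \<sigma> by auto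
  let ?G = "\<lambda>x. complex_of_real (1 / (\<sigma> * sqrt (2 * pi)) * exp (- (1 / (2 * \<sigma>\<^sup>2)) * x\<^sup>2))"
  fix \<xi> :: real
  have G: "?G (\<sigma> * y) = complex_of_real (1 / \<sigma>) * complex_of_real (std_normal_density y)" for y
    using \<sigma> by (simp add: std_normal_density_def power_mult_distrib field_simps)
  have char: "(LINT y|lborel. complex_of_real (std_normal_density y) * iexp (t * y)) = exp (- (t\<^sup>2) / 2)" for t
  proof -
    have "char std_normal_distribution t = (LINT y|lborel. std_normal_density y *\<^sub>R iexp (t * y))"
      unfolding char_def by (subst integral_density) (auto simp: normal_density_nonneg)
    then show ?thesis unfolding char_std_normal_distribution by (simp add: scaleR_conv_of_real)
  qed
  have "fourier_transform ?G \<xi> = (LINT x|lborel. ?G x * iexp ((- 2 * pi * \<xi>) * x))"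
    by (rule fourier_transform_eq_iexp)
  also have "\<dots> = \<bar>\<sigma>\<bar> *\<^sub>R (LINT y|lborel. ?G (0 + \<sigma> * y) * iexp ((- 2 * pi * \<xi>) * (0 + \<sigma> * y)))"
    by (rule lborel_integral_real_affine) (use \<sigma> in auto)
  also have "(LINT y|lborel. ?G (0 + \<sigma> * y) * iexp ((- 2 * pi * \<xi>) * (0 + \<sigma> * y))) =
     (LINT y|lborel. complex_of_real (1 / \<sigma>) * (complex_of_real (std_normal_density y) * iexp ((- 2 * pi * \<xi> * \<sigma>) * y)))"
    unfolding add_0 G by (simp only: mult.assoc)
  also have "\<dots> = complex_of_real (1 / \<sigma>) * exp (- ((- 2 * pi * \<xi> * \<sigma>)\<^sup>2) / 2)"
    unfolding integral_mult_right_zero char ..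
  also have "(- 2 * pi * \<xi> * \<sigma>)\<^sup>2 = 2 * (c * \<xi>\<^sup>2)" unfolding \<sigma>2[symmetric] by (simp add: power2_eq_square)
  finally have "fourier_transform ?G \<xi> = complex_of_real (exp (- (c * \<xi>\<^sup>2)))"
    using \<sigma> by (simp add: scaleR_conv_of_real)
  then show "fourier_transform ?G \<xi> = exp (- complex_of_real (c * \<xi>\<^sup>2))"
    unfolding of_real_minus[symmetric] exp_of_real .
qed

text \<open>The integrand is exp(-zs) with z = 1 - ib. Since Re z = 1, its antiderivative
  -exp(-zs)/z vanishes at infinity.\<close>

lemma expo_char: "(\<integral>s. iexp (b * s) \<partial>expo) = 1 / (1 - \<i> * b)"
proof -
  let ?z = "1 - \<i> * complex_of_real b"
  have z: "?z \<noteq> 0" by (simp add: complex_eq_iff)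
  have D: "((\<lambda>s. - (exp (- w * s) / w)) has_field_derivative exp (- w * s)) (at s)" if "w \<noteq> 0" for w s :: complex
    using that by (auto intro!: derivative_eq_intros)
  have i: "integrable expo (\<lambda>s. iexp (b * s))"
    by (rule expo.integrable_const_bound[of _ 1]) (simp, measurable)
  have eq: "(exp (- s)) *\<^sub>R iexp (b * s) = exp (- ?z * complex_of_real s)" for s
    by (simp add: scaleR_conv_of_real exp_of_real[symmetric] exp_add[symmetric] algebra_simps)
  have "(\<integral>s. iexp (b * s) \<partial>expo) = (LINT s:{0..}|lborel. exp (- ?z * complex_of_real s))"
    unfolding set_lebesgue_integral_def eq[symmetric] scaleR_scaleR by (rule integrable_expo_iff(2)) simp
  also have "\<dots> = (LINT s:{0<..}|lborel. exp (- ?z * complex_of_real s))"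
    unfolding set_lebesgue_integral_def
  proof (rule integral_cong_AE)
    show "AE s in lborel. indicat_real {0..} s *\<^sub>R exp (- ?z * complex_of_real s) = indicat_real {0<..} s *\<^sub>R exp (- ?z * complex_of_real s)"
      using AE_lborel_singleton[of "0::real"] by eventually_elim (auto simp: indicator_def)
  qed measurable
  also have "\<dots> = (LBINT s=0..\<infinity>. exp (- ?z * complex_of_real s))"
    by (simp add: interval_lebesgue_integral_def einterval_eq zero_ereal_def)
  also have "\<dots> = 0 - (- (1 / ?z))"
  proof (rule interval_integral_FTC_integrable[where F = "\<lambda>s. - (exp (- ?z * complex_of_real s) / ?z)"])
    show "((\<lambda>s. - (exp (- ?z * complex_of_real s) / ?z)) has_vector_derivative exp (- ?z * complex_of_real s)) (at s)" for s
      by (rule has_vector_derivative_real_field[where f = "\<lambda>s. - (exp (- ?z * s) / ?z)"])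
         (rule D[OF z])
    show "isCont (\<lambda>s. exp (- ?z * complex_of_real s)) s" for s by (intro continuous_intros)
    have "integrable lborel (\<lambda>s. (indicator {0..} s * exp (- s)) *\<^sub>R iexp (b * s))"
      using i by (subst (asm) integrable_expo_iff) auto
    then have "set_integrable lborel {0..} (\<lambda>s. exp (- ?z * complex_of_real s))"
      unfolding set_integrable_def eq[symmetric] scaleR_scaleR .
    then show "set_integrable lborel (einterval 0 \<infinity>) (\<lambda>s. exp (- ?z * complex_of_real s))"
      by (rule set_integrable_subset) (auto simp: einterval_def)
    have "((\<lambda>s. - (exp (- ?z * complex_of_real s) / ?z)) \<longlongrightarrow> - (exp (- ?z * complex_of_real 0) / ?z)) (at_right 0)"
      using z by (intro tendsto_intros) auto
    then show "(((\<lambda>s. - (exp (- ?z * complex_of_real s) / ?z)) \<circ> real_of_ereal) \<longlongrightarrow> - (1 / ?z)) (at_right 0)"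
      by (simp add: zero_ereal_def ereal_tendsto_simps)
    have "((\<lambda>s. - (exp (- ?z * complex_of_real s) / ?z)) \<longlongrightarrow> 0) at_top"
    proof (rule tendsto_norm_zero_cancel)
      have "((\<lambda>s::real. exp (- s) / norm ?z) \<longlongrightarrow> 0 / norm ?z) at_top"
        using z by (intro tendsto_intros filterlim_compose[OF exp_at_bot] filterlim_uminus_at_bot_at_top) auto
      then show "((\<lambda>s. norm (- (exp (- ?z * complex_of_real s) / ?z))) \<longlongrightarrow> 0) at_top"
        by (simp add: norm_divide norm_exp_eq_Re)
    qed
    then show "(((\<lambda>s. - (exp (- ?z * complex_of_real s) / ?z)) \<circ> real_of_ereal) \<longlongrightarrow> 0) (at_left \<infinity>)"
      by (simp add: ereal_tendsto_simps)
  qed auto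
  finally show ?thesis by simp
qed

text \<open>After exchanging the integrals, translating F by \<delta>s multiplies its transform by
  exp(-2 pi i \<delta> s \<xi>), whose mean is the required factor. Fubini applies because the
  absolute inner integral does not depend on s.\<close>

lemma fourier_transform_expconv:
  assumes dec: "exp_decay F" and cont: "continuous_on UNIV F"
  shows "fourier_transform (\<lambda>x. complex_of_real (expconv \<delta> F x)) \<xi> =
    inverse (1 + 2 * complex_of_real pi * \<i> * complex_of_real (\<delta> * \<xi>)) * fourier_transform (\<lambda>x. complex_of_real (F x)) \<xi>"
proof -
  let ?t = "- 2 * pi * \<xi>"
  have [measurable]: "F \<in> borel_measurable borel" using cont by (rule borel_measurable_continuous_onI)
  have iF: "integrable lborel F" by (rule exp_decay_integrable[OF dec cont])
  let ?f = "\<lambda>s x. complex_of_real (F (x - \<delta> * s)) * iexp (?t * x)"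
  have shift_int: "integrable lborel (\<lambda>x. F (x - a))" for a
    using lborel_integrable_real_affine[OF iF, of 1 "- a"] by (simp add: add.commute)
  have fint: "integrable lborel (?f s)" for s
    by (rule Bochner_Integration.integrable_bound[OF shift_int[of "\<delta> * s"]]) (auto simp: norm_mult)
  have joint: "integrable (expo \<Otimes>\<^sub>M lborel) (case_prod ?f)"
  proof (rule expo_lborel.Fubini_integrable)
    show "case_prod ?f \<in> borel_measurable (expo \<Otimes>\<^sub>M lborel)" by measurable
    have "(\<integral>x. norm (case_prod ?f (s, x)) \<partial>lborel) = (\<integral>x. \<bar>F x\<bar> \<partial>lborel)" for s
      using lborel_integral_real_affine[of 1 "\<lambda>x. \<bar>F x\<bar>" "- \<delta> * s"] by (simp add: norm_mult add.commute)
    then show "integrable expo (\<lambda>s. \<integral>x. norm (case_prod ?f (s, x)) \<partial>lborel)" by simp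
    show "AE s in expo. integrable lborel (\<lambda>x. case_prod ?f (s, x))" using fint by simp
  qed
  have "fourier_transform (\<lambda>x. complex_of_real (expconv \<delta> F x)) \<xi> = (\<integral>x. (\<integral>s. ?f s x \<partial>expo) \<partial>lborel)"
    unfolding fourier_transform_eq_iexp expconv_def by (simp add: integral_complex_of_real)
  also have "\<dots> = (\<integral>s. (\<integral>x. ?f s x \<partial>lborel) \<partial>expo)"
    by (rule expo_lborel.Fubini_integral[OF joint])
  also have "\<dots> = (\<integral>s. iexp ((?t * \<delta>) * s) * fourier_transform (\<lambda>x. complex_of_real (F x)) \<xi> \<partial>expo)"
  proof (rule Bochner_Integration.integral_cong[OF refl])
    fix s
    have "(\<integral>x. ?f s x \<partial>lborel) = (\<integral>x. ?f s (\<delta> * s + 1 * x) \<partial>lborel)"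
      using lborel_integral_real_affine[of 1 "?f s" "\<delta> * s"] by simp
    also have "\<dots> = (\<integral>x. iexp ((?t * \<delta>) * s) * (complex_of_real (F x) * iexp (?t * x)) \<partial>lborel)"
      by (intro Bochner_Integration.integral_cong refl) (simp add: algebra_simps exp_add exp_diff exp_minus divide_inverse)
    finally show "(\<integral>x. ?f s x \<partial>lborel) = iexp ((?t * \<delta>) * s) * fourier_transform (\<lambda>x. complex_of_real (F x)) \<xi>"
      unfolding fourier_transform_eq_iexp by simp
  qed
  also have "\<dots> = (\<integral>s. iexp ((?t * \<delta>) * s) \<partial>expo) * fourier_transform (\<lambda>x. complex_of_real (F x)) \<xi>"
    by simp
  also have "(\<integral>s. iexp ((?t * \<delta>) * s) \<partial>expo) = inverse (1 + 2 * complex_of_real pi * \<i> * complex_of_real (\<delta> * \<xi>))"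
    unfolding expo_char by (simp add: inverse_eq_divide mult_ac)
  finally show ?thesis .
qed

section \<open>Uniqueness of Fourier transforms\<close>

lemma continuous_AE_zero:
  fixes u :: "real \<Rightarrow> 'a :: real_normed_vector"
  assumes "continuous_on UNIV u" "AE x in lborel. u x = 0"
  shows "u x = 0"
proof -
  have "closed {x. u x = 0}"
    using continuous_closed_preimage_constant[OF assms(1) closed_UNIV, of 0] by simp
  moreover have "AE x in lborel. x \<in> {x. u x = 0}" using assms(2) by simp
  then have "AE x in lebesgue. x \<in> {x. u x = 0}" by (rule AE_completion)
  ultimately show ?thesis using mem_closed_if_AE_lebesgue[of "{x. u x = 0}" x] by simp
qed

text \<open>The summand \<open>exp (- \<bar>x\<bar>)\<close> makes \<open>p\<close> and \<open>m\<close> below strictly positive, so that both normalize to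
  probability densities.\<close>

lemma fourier_transform_real_unique:
  fixes u :: "real \<Rightarrow> real"
  assumes cont: "continuous_on UNIV u" and int: "integrable lborel u"
    and zero: "\<And>\<xi>. fourier_transform (\<lambda>x. complex_of_real (u x)) \<xi> = 0"
  shows "u x = 0"
proof -
  have [measurable]: "u \<in> borel_measurable borel" using cont by (rule borel_measurable_continuous_onI)
  define p m where "p x = max (u x) 0 + exp (- \<bar>x\<bar>)" and "m x = max (- u x) 0 + exp (- \<bar>x\<bar>)" for x
  have [measurable]: "p \<in> borel_measurable borel" "m \<in> borel_measurable borel" unfolding p_def m_def by measurable
  have pos: "p x > 0" "m x > 0" for x by (auto simp: p_def m_def intro: add_nonneg_pos)
  have ie: "integrable lborel (\<lambda>x::real. exp (- \<bar>x\<bar>))" using integrable_exp_abs[of 1] by simp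
  have ip: "integrable lborel p" "integrable lborel m"
    unfolding p_def m_def using int ie by (auto intro!: integrable_max)
  have diff: "u x = p x - m x" for x by (simp add: p_def m_def)
  have ft: "(LINT x|lborel. p x *\<^sub>R iexp (t * x)) = (LINT x|lborel. m x *\<^sub>R iexp (t * x))" for t
  proof -
    have i: "integrable lborel (\<lambda>x. p x *\<^sub>R iexp (t * x))" "integrable lborel (\<lambda>x. m x *\<^sub>R iexp (t * x))"
      by (rule Bochner_Integration.integrable_bound[OF ip(1)], auto)
         (rule Bochner_Integration.integrable_bound[OF ip(2)], auto)
    have "0 = fourier_transform (\<lambda>x. complex_of_real (u x)) (- t / (2 * pi))" by (simp add: zero)
    also have "\<dots> = (LINT x|lborel. p x *\<^sub>R iexp (t * x) - m x *\<^sub>R iexp (t * x))"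
      unfolding fourier_transform_eq_iexp diff by (simp add: scaleR_conv_of_real left_diff_distrib)
    also have "\<dots> = (LINT x|lborel. p x *\<^sub>R iexp (t * x)) - (LINT x|lborel. m x *\<^sub>R iexp (t * x))"
      by (rule Bochner_Integration.integral_diff[OF i])
    finally show ?thesis by simp
  qed
  define c where "c = (LINT x|lborel. p x)"
  \<comment> \<open>Frequency 0 shows that both functions have the same mass, so one constant
    normalises both and Levy's uniqueness theorem can compare them.\<close>
  have "complex_of_real (LINT x|lborel. m x) = complex_of_real c"
    using ft[of 0] unfolding c_def by (simp add: scaleR_conv_of_real integral_complex_of_real)
  then have cm: "(LINT x|lborel. m x) = c" by (simp only: of_real_eq_iff)
  have c: "c > 0"
  proof -
    have "c \<ge> 0" unfolding c_def using pos by (intro integral_nonneg_AE) (auto intro: less_imp_le)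
    moreover have "c \<noteq> 0"
    proof
      assume "c = 0"
      then have "AE x in lborel. p x = 0"
        using integral_nonneg_eq_0_iff_AE[OF ip(1)] pos unfolding c_def by (auto intro: less_imp_le)
      moreover have "continuous_on UNIV p" unfolding p_def by (intro continuous_intros cont)
      ultimately have "p 0 = 0" by (intro continuous_AE_zero)
      then show False using pos(1)[of 0] by simp
    qed
    ultimately show ?thesis by simp
  qed
  have dist: "real_distribution (density lborel (\<lambda>x. ennreal (h x / c)))"
    if "h \<in> borel_measurable borel" "\<And>x. h x > 0" "integrable lborel h" "(LINT x|lborel. h x) = c" for h
  proof -
    have "(\<integral>\<^sup>+x. ennreal (h x / c) \<partial>lborel) = ennreal (LINT x|lborel. h x / c)"
      by (rule nn_integral_eq_integral) (use that(3) c less_imp_le[OF that(2)] in auto)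
    also have "(LINT x|lborel. h x / c) = 1" using that c by simp
    finally have "prob_space (density lborel (\<lambda>x. ennreal (h x / c)))"
      using that by (intro prob_spaceI) (simp add: emeasure_density)
    then show ?thesis unfolding real_distribution_def real_distribution_axioms_def by simp
  qed
  have char: "char (density lborel (\<lambda>x. ennreal (h x / c))) t = (LINT x|lborel. h x *\<^sub>R iexp (t * x)) /\<^sub>R c"
    if "h \<in> borel_measurable borel" "\<And>x. h x > 0" for h t
  proof -
    have "char (density lborel (\<lambda>x. ennreal (h x / c))) t = (LINT x|lborel. (h x / c) *\<^sub>R iexp (t * x))"
      unfolding char_def using that(1) c less_imp_le[OF that(2)] by (intro integral_density) auto
    also have "\<dots> = (LINT x|lborel. (1 / c) *\<^sub>R (h x *\<^sub>R iexp (t * x)))" by simp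
    also have "\<dots> = (1 / c) *\<^sub>R (LINT x|lborel. h x *\<^sub>R iexp (t * x))" by (rule integral_scaleR_right)
    finally show ?thesis by (simp add: inverse_eq_divide)
  qed
  have "density lborel (\<lambda>x. ennreal (p x / c)) = density lborel (\<lambda>x. ennreal (m x / c))"
  proof (rule Levy_uniqueness)
    show "char (density lborel (\<lambda>x. ennreal (p x / c))) = char (density lborel (\<lambda>x. ennreal (m x / c)))"
      using char[of p] char[of m] ft pos by (simp add: fun_eq_iff)
  qed (intro dist; use pos ip cm c_def in auto)+
  then have "AE x in lborel. ennreal (p x / c) = ennreal (m x / c)"
    by (intro sigma_finite_measure.density_unique[OF lborel.sigma_finite_measure_axioms]) auto
  then have "AE x in lborel. u x = 0"
  proof eventually_elim
    case (elim x)
    then have "p x / c = m x / c" using pos[of x] c by (subst (asm) ennreal_inj) (auto intro: less_imp_le)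
    then show ?case using c by (simp add: diff)
  qed
  then show ?thesis by (rule continuous_AE_zero[OF cont])
qed

text \<open>The transform of the conjugate of u at a frequency is the conjugate of the transform of
  u at the opposite frequency, so it vanishes too. Real and imaginary part are combinations of u and
  its conjugate, which reduces the claim to real functions.\<close>

lemma fourier_transform_unique:
  fixes f h :: "real \<Rightarrow> complex"
  assumes cont: "continuous_on UNIV f" "continuous_on UNIV h" and int: "integrable lborel f" "integrable lborel h"
    and eq: "\<And>\<xi>. fourier_transform f \<xi> = fourier_transform h \<xi>"
  shows "f = h"
proof -
  define u where "u x = f x - h x" for x
  have u: "continuous_on UNIV u" "integrable lborel u"
    unfolding u_def using cont int by (auto intro: continuous_intros)
  have iu: "integrable lborel (\<lambda>x. u x * iexp (t * x))" for t
    by (rule Bochner_Integration.integrable_bound[OF u(2)]) (use u in \<open>auto simp: norm_mult\<close>)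
  have u0: "(LINT x|lborel. u x * iexp (t * x)) = 0" for t
  proof -
    have "(LINT x|lborel. u x * iexp (t * x)) = fourier_transform u (- t / (2 * pi))"
      unfolding fourier_transform_eq_iexp by simp
    also have "\<dots> = fourier_transform f (- t / (2 * pi)) - fourier_transform h (- t / (2 * pi))"
      unfolding fourier_transform_def u_def left_diff_distrib
      by (rule Bochner_Integration.integral_diff) (intro fourier_transform_kernel_integrable int)+
    finally show ?thesis by (simp add: eq)
  qed
  have cu0: "(LINT x|lborel. cnj (u x) * iexp (t * x)) = 0" for t
  proof -
    have "(LINT x|lborel. cnj (u x) * iexp (t * x)) = (LINT x|lborel. cnj (u x * iexp (- t * x)))"
      by (simp add: exp_cnj)
    also have "\<dots> = cnj (LINT x|lborel. u x * iexp (- t * x))" by (rule integral_bounded_linear[OF bounded_linear_cnj iu])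
    finally show ?thesis by (simp only: u0 complex_cnj_zero)
  qed
  have icu: "integrable lborel (\<lambda>x. cnj (u x) * iexp (t * x))" for t
  proof (rule Bochner_Integration.integrable_bound[OF u(2)])
    have "(\<lambda>x. cnj (u x) * iexp (t * x)) \<in> borel_measurable borel"
      by (intro borel_measurable_continuous_onI continuous_intros u)
    then show "(\<lambda>x. cnj (u x) * iexp (t * x)) \<in> borel_measurable lborel" by simp
  qed (auto simp: norm_mult)
  have "Re (u x) = 0" for x
  proof (rule fourier_transform_real_unique[of "\<lambda>x. Re (u x)"])
    fix \<xi>
    have "fourier_transform (\<lambda>x. complex_of_real (Re (u x))) \<xi> =
      (LINT x|lborel. (1 / 2) * (u x * iexp ((- 2 * pi * \<xi>) * x) + cnj (u x) * iexp ((- 2 * pi * \<xi>) * x)))"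
      unfolding fourier_transform_eq_iexp
      by (intro Bochner_Integration.integral_cong refl) (simp add: distrib_right[symmetric] complex_add_cnj)
    also have "\<dots> = 0"
      unfolding integral_mult_right_zero Bochner_Integration.integral_add[OF iu icu] u0 cu0 by simp
    finally show "fourier_transform (\<lambda>x. complex_of_real (Re (u x))) \<xi> = 0" .
  qed (use u in \<open>auto intro: continuous_intros\<close>)
  moreover have "Im (u x) = 0" for x
  proof (rule fourier_transform_real_unique[of "\<lambda>x. Im (u x)"])
    fix \<xi>
    have "fourier_transform (\<lambda>x. complex_of_real (Im (u x))) \<xi> =
      (LINT x|lborel. (1 / (2 * \<i>)) * (u x * iexp ((- 2 * pi * \<xi>) * x) - cnj (u x) * iexp ((- 2 * pi * \<xi>) * x)))"
      unfolding fourier_transform_eq_iexp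
    proof (intro Bochner_Integration.integral_cong refl)
      fix x
      have "complex_of_real (Im (u x)) = (1 / (2 * \<i>)) * (u x - cnj (u x))"
        by (simp add: complex_eq_iff Re_divide Im_divide)
      then show "complex_of_real (Im (u x)) * iexp ((- 2 * pi * \<xi>) * x) =
          (1 / (2 * \<i>)) * (u x * iexp ((- 2 * pi * \<xi>) * x) - cnj (u x) * iexp ((- 2 * pi * \<xi>) * x))"
        by (simp only: left_diff_distrib[symmetric] mult.assoc)
    qed
    also have "\<dots> = 0"
      unfolding integral_mult_right_zero Bochner_Integration.integral_diff[OF iu icu] u0 cu0 by simp
    finally show "fourier_transform (\<lambda>x. complex_of_real (Im (u x))) \<xi> = 0" .
  qed (use u in \<open>auto intro: continuous_intros\<close>)
  ultimately show ?thesis by (auto simp: u_def fun_eq_iff complex_eq_iff)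
qed

text \<open>The hypothesis gives only the transform of \<open>g\<close>. An explicit iterated
  convolution with the same transform is built by induction on the number of factors, along with the
  properties wanted of it; continuity makes the two functions agree at every point. In particular
  \<open>g\<close> is real-valued.\<close>

lemma tp_gaussian_type_representation:
  assumes "tp_gaussian_type g"
  obtains G where "continuous_on UNIV G" "exp_decay G" "determined_by_dense_zeros G" "g = (\<lambda>x. complex_of_real (G x))"
proof -
  obtain n :: nat and \<delta> :: "nat \<Rightarrow> real" and c :: real where g: "continuous_on UNIV g" "integrable lborel g" and c: "c > 0"
    and ft: "\<And>\<xi>. fourier_transform g \<xi> =
           (\<Prod>j=1..n. inverse (1 + 2 * complex_of_real pi * \<i> * complex_of_real (\<delta> j * \<xi>))) * exp (- complex_of_real (c * \<xi>\<^sup>2))"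
    using assms unfolding tp_gaussian_type_def by blast
  have "\<exists>G. continuous_on UNIV G \<and> exp_decay G \<and> determined_by_dense_zeros G \<and>
     (\<forall>\<xi>. fourier_transform (\<lambda>x. complex_of_real (G x)) \<xi> =
        (\<Prod>j=1..m. inverse (1 + 2 * complex_of_real pi * \<i> * complex_of_real (\<delta> j * \<xi>))) * exp (- complex_of_real (c * \<xi>\<^sup>2)))" for m
  proof (induction m)
    case 0
    obtain a A where A: "a > 0" "A \<noteq> 0"
    "\<And>\<xi>. fourier_transform (\<lambda>x. complex_of_real (A * exp (- a * x\<^sup>2))) \<xi> = exp (- complex_of_real (c * \<xi>\<^sup>2))"
      using fourier_transform_gaussian[OF c] by blast
    show ?case
      by (intro exI[of _ "\<lambda>x. A * exp (- a * x\<^sup>2)"] conjI allI)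
         (use A exp_decay_gaussian determined_by_dense_zeros_gaussian in \<open>auto intro!: continuous_intros\<close>)
  next
    case (Suc m)
    then obtain G where G: "continuous_on UNIV G" "exp_decay G" "determined_by_dense_zeros G"
      "\<And>\<xi>. fourier_transform (\<lambda>x. complex_of_real (G x)) \<xi> =
        (\<Prod>j=1..m. inverse (1 + 2 * complex_of_real pi * \<i> * complex_of_real (\<delta> j * \<xi>))) * exp (- complex_of_real (c * \<xi>\<^sup>2))"
      by blast
    show ?case
    proof (intro exI[of _ "expconv (\<delta> (Suc m)) G"] conjI allI)
      show "continuous_on UNIV (expconv (\<delta> (Suc m)) G)" by (rule continuous_on_expconv[OF G(2,1)])
      show "exp_decay (expconv (\<delta> (Suc m)) G)" by (rule exp_decay_expconv[OF G(2,1)])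
      show "determined_by_dense_zeros (expconv (\<delta> (Suc m)) G)" by (rule determined_by_dense_zeros_expconv[OF G(2,1,3)])
    qed (simp add: fourier_transform_expconv[OF G(2,1)] G(4) mult_ac)
  qed
  from this[of n] obtain G where G: "continuous_on UNIV G" "exp_decay G" "determined_by_dense_zeros G"
    "\<And>\<xi>. fourier_transform (\<lambda>x. complex_of_real (G x)) \<xi> = fourier_transform g \<xi>"
    unfolding ft by blast
  have "g = (\<lambda>x. complex_of_real (G x))"
  proof (rule fourier_transform_unique)
    show "integrable lborel (\<lambda>x. complex_of_real (G x))" using exp_decay_integrable[OF G(2,1)] by auto
  qed (use g G in \<open>auto intro: continuous_intros\<close>)
  with G that show ?thesis by blast
qed

section \<open>Square-summable coefficients\<close>

text \<open>Tonelli's theorem for a nonnegative double series whose row sums are at most W.\<close>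

lemma double_sum_bound:
  fixes a :: "'k \<Rightarrow> real" and P :: "'k \<Rightarrow> 'i \<Rightarrow> real"
  assumes a: "\<And>k. a k \<ge> 0" "a summable_on A" and P: "\<And>k i. P k i \<ge> 0"
    and PW: "\<And>k. P k summable_on I" "\<And>k. (\<Sum>\<^sub>\<infinity>i\<in>I. P k i) \<le> W"
  shows "i \<in> I \<Longrightarrow> (\<lambda>k. a k * P k i) summable_on A"
    and "(\<lambda>i. \<Sum>\<^sub>\<infinity>k\<in>A. a k * P k i) summable_on I"
    and "(\<Sum>\<^sub>\<infinity>i\<in>I. \<Sum>\<^sub>\<infinity>k\<in>A. a k * P k i) \<le> W * (\<Sum>\<^sub>\<infinity>k\<in>A. a k)"
proof -
  define g where "g k = a k * (\<Sum>\<^sub>\<infinity>i\<in>I. P k i)" for k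
  have g0: "g k \<ge> 0" for k unfolding g_def using a P by (intro mult_nonneg_nonneg infsum_nonneg) auto
  have gW: "g k \<le> W * a k" for k
    unfolding g_def using mult_left_mono[OF PW(2)[of k] a(1)[of k]] by (simp add: mult.commute)
  have Wa: "(\<lambda>k. W * a k) summable_on A" using a(2) by (rule summable_on_cmult_right)
  have gs: "g summable_on A" by (rule summable_on_comparison_test[OF Wa]) (use g0 gW in auto)
  have row: "((\<lambda>i. a k * P k i) has_sum g k) I" for k
    unfolding g_def by (intro has_sum_cmult_right has_sum_infsum PW)
  have s: "(\<lambda>(k, i). a k * P k i) summable_on A \<times> I"
    by (rule summable_on_SigmaI[where g = g]) (use row gs a P in \<open>auto intro: mult_nonneg_nonneg\<close>)
  then have tot: "((\<lambda>(k, i). a k * P k i) has_sum (\<Sum>\<^sub>\<infinity>x\<in>A \<times> I. case x of (k, i) \<Rightarrow> a k * P k i)) (A \<times> I)"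
    by (rule has_sum_infsum)
  have s': "(\<lambda>(i, k). a k * P k i) summable_on I \<times> A"
    by (subst summable_on_swap) (use s in simp)
  show col: "(\<lambda>k. a k * P k i) summable_on A" if "i \<in> I" for i
    using summable_on_SigmaD1[OF s' that] by simp
  have tot': "((\<lambda>(i, k). a k * P k i) has_sum (\<Sum>\<^sub>\<infinity>x\<in>A \<times> I. case x of (k, i) \<Rightarrow> a k * P k i)) (I \<times> A)"
    by (subst has_sum_swap) (use tot in simp)
  have hs: "((\<lambda>i. \<Sum>\<^sub>\<infinity>k\<in>A. a k * P k i) has_sum (\<Sum>\<^sub>\<infinity>x\<in>A \<times> I. case x of (k, i) \<Rightarrow> a k * P k i)) I"
    by (rule has_sum_SigmaD[OF tot']) (use col in auto)
  then show "(\<lambda>i. \<Sum>\<^sub>\<infinity>k\<in>A. a k * P k i) summable_on I" by (rule has_sum_imp_summable)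
  have hg: "(g has_sum (\<Sum>\<^sub>\<infinity>x\<in>A \<times> I. case x of (k, i) \<Rightarrow> a k * P k i)) A"
    by (rule has_sum_SigmaD[OF tot]) (use row in auto)
  have "(\<Sum>\<^sub>\<infinity>i\<in>I. \<Sum>\<^sub>\<infinity>k\<in>A. a k * P k i) = infsum g A"
    unfolding infsumI[OF hs] infsumI[OF hg] ..
  also have "\<dots> \<le> (\<Sum>\<^sub>\<infinity>k\<in>A. W * a k)" by (rule infsum_mono[OF gs Wa]) (use gW in auto)
  also have "\<dots> = W * (\<Sum>\<^sub>\<infinity>k\<in>A. a k)" by (rule infsum_cmult_right) (use a in auto)
  finally show "(\<Sum>\<^sub>\<infinity>i\<in>I. \<Sum>\<^sub>\<infinity>k\<in>A. a k * P k i) \<le> W * (\<Sum>\<^sub>\<infinity>k\<in>A. a k)" .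
qed

text \<open>Cells of length s contain at most one point each, so i \<mapsto>
  \<open>\<lfloor>(f i - x) / s\<rfloor>\<close> is injective and the sum over points is at most the
  sum of the majorant \<psi> over all cells. The bound is independent of the points and of
  x.\<close>

lemma separated_sum_bound:
  fixes f :: "'i \<Rightarrow> real" and \<psi> :: "int \<Rightarrow> real"
  assumes s: "s > 0" and sep: "\<And>i j. i \<in> I \<Longrightarrow> j \<in> I \<Longrightarrow> i \<noteq> j \<Longrightarrow> s \<le> \<bar>f i - f j\<bar>"
    and \<phi>: "\<And>y. 0 \<le> \<phi> y" "\<And>y. \<phi> y \<le> \<psi> \<lfloor>y / s\<rfloor>" and \<psi>: "\<psi> summable_on UNIV"
  shows "(\<lambda>i. \<phi> (f i - x)) summable_on I" "(\<Sum>\<^sub>\<infinity>i\<in>I. \<phi> (f i - x)) \<le> (\<Sum>\<^sub>\<infinity>j. \<psi> j)"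
proof -
  define J where "J i = \<lfloor>(f i - x) / s\<rfloor>" for i
  have \<psi>0: "\<psi> j \<ge> 0" for j
  proof -
    have "\<lfloor>(of_int j * s) / s\<rfloor> = j" using s by simp
    then show ?thesis using \<phi>(1)[of "of_int j * s"] \<phi>(2)[of "of_int j * s"] by simp
  qed
  have inj: "inj_on J I"
  proof (rule inj_onI, rule ccontr)
    fix i j assume ij: "i \<in> I" "j \<in> I" "J i = J j" "i \<noteq> j"
    have "\<bar>(f i - x) / s - (f j - x) / s\<bar> < 1"
      using ij(3) unfolding J_def by linarith
    then have "\<bar>(f i - f j) / s\<bar> < 1" by (simp add: diff_divide_distrib)
    then have "\<bar>f i - f j\<bar> < s" using s by (simp add: divide_simps)
    with sep[OF ij(1,2,4)] show False by linarith
  qed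
  have s1: "\<psi> summable_on J ` I" using \<psi> by (rule summable_on_subset) auto
  then have s2: "(\<lambda>i. \<psi> (J i)) summable_on I" using summable_on_reindex[OF inj, of \<psi>] by (simp add: o_def)
  show s3: "(\<lambda>i. \<phi> (f i - x)) summable_on I"
    by (rule summable_on_comparison_test[OF s2]) (use \<phi> in \<open>auto simp: J_def\<close>)
  have "(\<Sum>\<^sub>\<infinity>i\<in>I. \<phi> (f i - x)) \<le> (\<Sum>\<^sub>\<infinity>i\<in>I. \<psi> (J i))"
    by (rule infsum_mono[OF s3 s2]) (use \<phi> in \<open>auto simp: J_def\<close>)
  also have "\<dots> = infsum \<psi> (J ` I)" using infsum_reindex[OF inj, of \<psi>] by (simp add: o_def)
  also have "\<dots> \<le> (\<Sum>\<^sub>\<infinity>j. \<psi> j)" by (rule infsum_mono2[OF s1 \<psi>]) (use \<psi>0 in auto)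
  finally show "(\<Sum>\<^sub>\<infinity>i\<in>I. \<phi> (f i - x)) \<le> (\<Sum>\<^sub>\<infinity>j. \<psi> j)" .
qed

lemma exp_decay_separated_sum:
  assumes "exp_decay F" "s > 0"
  obtains W where "W > 0"
    "\<And>I (f :: 'i \<Rightarrow> real) x. (\<And>i j. i \<in> I \<Longrightarrow> j \<in> I \<Longrightarrow> i \<noteq> j \<Longrightarrow> s \<le> \<bar>f i - f j\<bar>) \<Longrightarrow>
      (\<lambda>i. \<bar>F (f i - x)\<bar>) summable_on I \<and> (\<Sum>\<^sub>\<infinity>i\<in>I. \<bar>F (f i - x)\<bar>) \<le> W"
proof -
  obtain C e where C: "C > 0" "e > 0" "\<And>x. \<bar>F x\<bar> \<le> C * exp (- e * \<bar>x\<bar>)"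
    using exp_decayE[OF assms(1)] by metis
  \<comment> \<open>The factor exp(es) pays for rounding y/s down to an integer.\<close>
  define \<psi> where "\<psi> j = C * exp (e * s) * exp (- (e * s) * \<bar>of_int j\<bar>)" for j :: int
  have \<psi>: "\<psi> summable_on UNIV" unfolding \<psi>_def
    using C assms by (intro summable_on_cmult_right summable_on_int_exp) auto
  have le: "\<bar>F y\<bar> \<le> \<psi> \<lfloor>y / s\<rfloor>" for y
  proof -
    have "\<bar>of_int \<lfloor>y / s\<rfloor>\<bar> \<le> \<bar>y / s\<bar> + 1" by linarith
    then have "(e * s) * \<bar>of_int \<lfloor>y / s\<rfloor>\<bar> \<le> (e * s) * (\<bar>y\<bar> / s + 1)"
      using C assms by (intro mult_left_mono) auto
    also have "\<dots> = e * \<bar>y\<bar> + e * s" using assms by (simp add: field_simps)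
    finally have "exp (- e * \<bar>y\<bar>) \<le> exp (e * s + - (e * s) * \<bar>of_int \<lfloor>y / s\<rfloor>\<bar>)" by simp
    then have "C * exp (- e * \<bar>y\<bar>) \<le> C * exp (e * s + - (e * s) * \<bar>of_int \<lfloor>y / s\<rfloor>\<bar>)" using C by simp
    then show ?thesis unfolding \<psi>_def using C(3)[of y] by (simp only: exp_add mult.assoc)
  qed
  show ?thesis
  proof (rule that[of "\<bar>infsum \<psi> UNIV\<bar> + 1"])
    fix I and f :: "'i \<Rightarrow> real" and x assume sep: "\<And>i j. i \<in> I \<Longrightarrow> j \<in> I \<Longrightarrow> i \<noteq> j \<Longrightarrow> s \<le> \<bar>f i - f j\<bar>"
    show "(\<lambda>i. \<bar>F (f i - x)\<bar>) summable_on I \<and> (\<Sum>\<^sub>\<infinity>i\<in>I. \<bar>F (f i - x)\<bar>) \<le> \<bar>infsum \<psi> UNIV\<bar> + 1"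
      using separated_sum_bound[where I = I and f = f and \<phi> = "\<lambda>y. \<bar>F y\<bar>" and \<psi> = \<psi> and x = x, OF assms(2) sep] le \<psi> by force
  qed auto
qed

lemma summable_on_int_inverse_square: "(\<lambda>j::int. 1 / (1 + (real_of_int j)\<^sup>2)) summable_on UNIV"
proof -
  have "(\<lambda>n::nat. 1 / (1 + (real n)\<^sup>2)) summable_on UNIV"
  proof (rule summable_nonneg_imp_summable_on)
    have "summable (\<lambda>n. 1 / (real n)\<^sup>2)" using inverse_power_summable[of 2, where 'a = real] by (simp add: inverse_eq_divide)
    then show "summable (\<lambda>n. 1 / (1 + (real n)\<^sup>2))"
      by (rule summable_comparison_test'[of _ 1]) (auto simp: divide_simps add_pos_nonneg)
  qed auto
  from summable_on_int_abs[OF this] show ?thesis by simp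
qed

lemma cauchy_weight_separated_sum:
  obtains W :: real where "W > 0"
    "\<And>x::real. (\<lambda>m::int. 1 / (1 + (x - of_int m)\<^sup>2)) summable_on UNIV" "\<And>x::real. (\<Sum>\<^sub>\<infinity>m::int. 1 / (1 + (x - of_int m)\<^sup>2)) \<le> W"
proof -
  \<comment> \<open>For z the integer part of y, z^2 \<le> 2y^2 + 2, so 1 + z^2 \<le> 3(1 +
    y^2).\<close>
  define \<psi> where "\<psi> j = 3 * (1 / (1 + (real_of_int j)\<^sup>2))" for j :: int
  have \<psi>: "\<psi> summable_on UNIV" unfolding \<psi>_def by (intro summable_on_cmult_right summable_on_int_inverse_square)
  have le: "1 / (1 + y\<^sup>2) \<le> \<psi> \<lfloor>y / 1\<rfloor>" for y :: real
  proof -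
    define z where "z = real_of_int \<lfloor>y\<rfloor>"
    define t where "t = y - z"
    have t: "0 \<le> t" "t \<le> 1" unfolding t_def z_def by linarith+
    have "z\<^sup>2 = (y - t)\<^sup>2" by (simp add: t_def)
    also have "\<dots> \<le> 2 * y\<^sup>2 + 2 * t\<^sup>2" using zero_le_power2[of "y + t"] by (simp add: power2_eq_square algebra_simps)
    also have "\<dots> \<le> 2 * y\<^sup>2 + 2" using t by (simp add: power_le_one)
    finally have "1 + z\<^sup>2 \<le> 3 * (1 + y\<^sup>2)" using zero_le_power2[of y] unfolding distrib_left by linarith
    then show ?thesis unfolding \<psi>_def div_by_1 z_def[symmetric] by (simp add: divide_simps add_pos_nonneg)
  qed
  have *: "(\<lambda>m::int. 1 / (1 + (of_int m - x)\<^sup>2)) summable_on UNIV \<and> (\<Sum>\<^sub>\<infinity>m::int. 1 / (1 + (of_int m - x)\<^sup>2)) \<le> infsum \<psi> UNIV" for x :: real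
  proof -
    have sep: "1 \<le> \<bar>real_of_int i - of_int j\<bar>" if "i \<in> UNIV" "j \<in> UNIV" "i \<noteq> j" for i j
      using that by linarith
    show ?thesis
      using separated_sum_bound[where I = UNIV and f = real_of_int and \<phi> = "\<lambda>y. 1 / (1 + y\<^sup>2)" and \<psi> = \<psi> and x = x, OF zero_less_one sep] le \<psi>
      by (auto simp: add_nonneg_nonneg)
  qed
  show ?thesis
  proof (rule that[of "\<bar>infsum \<psi> UNIV\<bar> + 1"])
    fix x :: real
    show "(\<lambda>m::int. 1 / (1 + (x - of_int m)\<^sup>2)) summable_on UNIV" using * by (simp add: power2_commute)
    have "(\<Sum>\<^sub>\<infinity>m::int. 1 / (1 + (x - of_int m)\<^sup>2)) \<le> infsum \<psi> UNIV" using * by (simp add: power2_commute)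
    then show "(\<Sum>\<^sub>\<infinity>m::int. 1 / (1 + (x - of_int m)\<^sup>2)) \<le> \<bar>infsum \<psi> UNIV\<bar> + 1" by linarith
  qed auto
qed

text \<open>Puts square-summable coefficients into the class for which convergence of the shift
  series is known.\<close>

lemma square_summable_lin_growth:
  assumes "(\<lambda>k::int. (c k)\<^sup>2) summable_on UNIV"
  shows "lin_growth (sqrt (\<Sum>\<^sub>\<infinity>k. (c k)\<^sup>2)) c"
  unfolding lin_growth_def
proof
  fix k
  have "(c k)\<^sup>2 \<le> (\<Sum>\<^sub>\<infinity>k. (c k)\<^sup>2)" using finite_sum_le_infsum[OF assms, of "{k}"] by simp
  then have "\<bar>c k\<bar> \<le> sqrt (\<Sum>\<^sub>\<infinity>k. (c k)\<^sup>2)" by (metis real_le_rsqrt power2_abs)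
  also have "sqrt (\<Sum>\<^sub>\<infinity>k. (c k)\<^sup>2) = sqrt (\<Sum>\<^sub>\<infinity>k. (c k)\<^sup>2) * 1" by simp
  also have "\<dots> \<le> sqrt (\<Sum>\<^sub>\<infinity>k. (c k)\<^sup>2) * (1 + \<bar>of_int k\<bar>)" by (intro mult_left_mono) (auto intro: infsum_nonneg)
  finally show "\<bar>c k\<bar> \<le> sqrt (\<Sum>\<^sub>\<infinity>k. (c k)\<^sup>2) * (1 + \<bar>of_int k\<bar>)" .
qed

lemma cauchy_schwarz_infsum:
  fixes a P :: "'k \<Rightarrow> real"
  assumes "\<And>k. P k \<ge> 0" "P summable_on A" "(\<lambda>k. (a k)\<^sup>2 * P k) summable_on A" "(\<lambda>k. a k * P k) summable_on A"
  shows "(\<Sum>\<^sub>\<infinity>k\<in>A. a k * P k)\<^sup>2 \<le> (\<Sum>\<^sub>\<infinity>k\<in>A. P k) * (\<Sum>\<^sub>\<infinity>k\<in>A. (a k)\<^sup>2 * P k)"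
proof -
  have fin: "(\<Sum>k\<in>X. a k * P k)\<^sup>2 \<le> (\<Sum>k\<in>X. P k) * (\<Sum>k\<in>X. (a k)\<^sup>2 * P k)" for X
  proof -
    have "(\<Sum>k\<in>X. sqrt (P k) * (a k * sqrt (P k)))\<^sup>2 \<le> (\<Sum>k\<in>X. (sqrt (P k))\<^sup>2) * (\<Sum>k\<in>X. (a k * sqrt (P k))\<^sup>2)"
      by (rule Cauchy_Schwarz_ineq_sum)
    moreover have "sqrt (P k) * (a k * sqrt (P k)) = a k * P k" for k
      using assms(1)[of k] by (metis mult.left_commute real_sqrt_mult_self abs_of_nonneg)
    ultimately show ?thesis using assms(1) by (simp add: power_mult_distrib)
  qed
  show ?thesis
  proof (rule tendsto_le[OF finite_subsets_at_top_neq_bot])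
    show "((\<lambda>X. (\<Sum>k\<in>X. P k) * (\<Sum>k\<in>X. (a k)\<^sup>2 * P k)) \<longlongrightarrow> (\<Sum>\<^sub>\<infinity>k\<in>A. P k) * (\<Sum>\<^sub>\<infinity>k\<in>A. (a k)\<^sup>2 * P k)) (finite_subsets_at_top A)"
      by (intro tendsto_mult infsum_tendsto assms)
    show "((\<lambda>X. (\<Sum>k\<in>X. a k * P k)\<^sup>2) \<longlongrightarrow> (\<Sum>\<^sub>\<infinity>k\<in>A. a k * P k)\<^sup>2) (finite_subsets_at_top A)"
      by (intro tendsto_power infsum_tendsto assms)
  qed (use fin in auto)
qed

text \<open>Schur's test for the matrix G(f(i) - k): Cauchy-Schwarz with weights |G(f(i) - k)| uses
  the sums over integers k, bounded by \<open>W'\<close>, and the remaining double sum uses the sums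
  over the separated points, bounded by \<open>W\<close>. The index set is kept general so that
  integer-indexed sequences and \<Lambda> itself are both covered.\<close>

lemma bessel_bound:
  assumes dec: "exp_decay G" and s: "s > 0"
  obtains B where "B > 0"
    "\<And>I (f :: 'i \<Rightarrow> real) c. (\<And>i j. i \<in> I \<Longrightarrow> j \<in> I \<Longrightarrow> i \<noteq> j \<Longrightarrow> s \<le> \<bar>f i - f j\<bar>) \<Longrightarrow>
      (\<lambda>k. (c k)\<^sup>2) summable_on UNIV \<Longrightarrow>
      (\<lambda>i. (shift_series G c (f i))\<^sup>2) summable_on I \<and>
      (\<Sum>\<^sub>\<infinity>i\<in>I. (shift_series G c (f i))\<^sup>2) \<le> B * (\<Sum>\<^sub>\<infinity>k. (c k)\<^sup>2)"
proof -
  obtain W where W: "W > 0"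
    "\<And>I (f :: 'i \<Rightarrow> real) x. (\<And>i j. i \<in> I \<Longrightarrow> j \<in> I \<Longrightarrow> i \<noteq> j \<Longrightarrow> s \<le> \<bar>f i - f j\<bar>) \<Longrightarrow>
      (\<lambda>i. \<bar>G (f i - x)\<bar>) summable_on I \<and> (\<Sum>\<^sub>\<infinity>i\<in>I. \<bar>G (f i - x)\<bar>) \<le> W"
    using exp_decay_separated_sum[OF dec s] by metis
  \<comment> \<open>In the sums over k the integers play the role of the separated points and enter
    G with the opposite sign.\<close>
  have dec': "exp_decay (\<lambda>x. G (- x))" 
  proof -
    obtain C e where C: "C > 0" "e > 0" "\<And>x. \<bar>G x\<bar> \<le> C * exp (- e * \<bar>x\<bar>)" using exp_decayE[OF dec] by metis
    have "\<bar>G (- x)\<bar> \<le> C * exp (- e * \<bar>x\<bar>)" for x using C(3)[of "- x"] by simp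
    then show ?thesis unfolding exp_decay_def using C(2) by blast
  qed
  obtain W' where W': "W' > 0"
    "\<And>I (f :: int \<Rightarrow> real) x. (\<And>i j. i \<in> I \<Longrightarrow> j \<in> I \<Longrightarrow> i \<noteq> j \<Longrightarrow> 1 \<le> \<bar>f i - f j\<bar>) \<Longrightarrow>
      (\<lambda>i. \<bar>G (- (f i - x))\<bar>) summable_on I \<and> (\<Sum>\<^sub>\<infinity>i\<in>I. \<bar>G (- (f i - x))\<bar>) \<le> W'"
    using exp_decay_separated_sum[OF dec' zero_less_one] by metis
  have Z: "(\<lambda>k::int. \<bar>G (x - of_int k)\<bar>) summable_on UNIV" "(\<Sum>\<^sub>\<infinity>k::int. \<bar>G (x - of_int k)\<bar>) \<le> W'" for x
  proof -
    have sep: "1 \<le> \<bar>real_of_int i - of_int j\<bar>" if "i \<in> UNIV" "j \<in> UNIV" "i \<noteq> j" for i j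
      using that by linarith
    show "(\<lambda>k::int. \<bar>G (x - of_int k)\<bar>) summable_on UNIV" "(\<Sum>\<^sub>\<infinity>k::int. \<bar>G (x - of_int k)\<bar>) \<le> W'"
      using W'(2)[of UNIV of_int x, OF sep] by simp_all
  qed
  show ?thesis
  proof (rule that[of "W' * W"])
    show "W' * W > 0" using W W' by simp
    fix I and f :: "'i \<Rightarrow> real" and c :: "int \<Rightarrow> real"
    assume sep: "\<And>i j. i \<in> I \<Longrightarrow> j \<in> I \<Longrightarrow> i \<noteq> j \<Longrightarrow> s \<le> \<bar>f i - f j\<bar>"
      and c: "(\<lambda>k. (c k)\<^sup>2) summable_on UNIV"
    note D = double_sum_bound[of "\<lambda>k. (c k)\<^sup>2" UNIV "\<lambda>k i. \<bar>G (f i - of_int k)\<bar>" I W, OF _ c _ conjunct1[OF W(2)[OF sep]] conjunct2[OF W(2)[OF sep]]]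
    have le: "(shift_series G c (f i))\<^sup>2 \<le> W' * (\<Sum>\<^sub>\<infinity>k. (c k)\<^sup>2 * \<bar>G (f i - of_int k)\<bar>)" if i: "i \<in> I" for i
    proof -
      have lg: "lin_growth (sqrt (\<Sum>\<^sub>\<infinity>k. (c k)\<^sup>2)) c" by (rule square_summable_lin_growth[OF c])
      have s1: "(\<lambda>k. \<bar>c k\<bar> * \<bar>G (f i - of_int k)\<bar>) summable_on UNIV"
        using series_summable(1)[OF dec lg] by (simp add: abs_mult)
      have "\<bar>shift_series G c (f i)\<bar> \<le> (\<Sum>\<^sub>\<infinity>k. \<bar>c k\<bar> * \<bar>G (f i - of_int k)\<bar>)"
        unfolding shift_series_def using norm_infsum_bound[of "\<lambda>k. c k * G (f i - of_int k)" UNIV] s1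
        by (simp add: abs_mult)
      then have "(shift_series G c (f i))\<^sup>2 \<le> (\<Sum>\<^sub>\<infinity>k. \<bar>c k\<bar> * \<bar>G (f i - of_int k)\<bar>)\<^sup>2"
        by (metis abs_ge_zero power2_abs power_mono)
      also have "\<dots> \<le> (\<Sum>\<^sub>\<infinity>k::int. \<bar>G (f i - of_int k)\<bar>) * (\<Sum>\<^sub>\<infinity>k. \<bar>c k\<bar>\<^sup>2 * \<bar>G (f i - of_int k)\<bar>)"
        by (rule cauchy_schwarz_infsum) (use Z s1 D(1) i in auto)
      also have "\<dots> \<le> W' * (\<Sum>\<^sub>\<infinity>k. (c k)\<^sup>2 * \<bar>G (f i - of_int k)\<bar>)"
        by (simp, intro mult_right_mono Z infsum_nonneg) auto
      finally show ?thesis .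
    qed
    have D2: "(\<lambda>i. W' * (\<Sum>\<^sub>\<infinity>k. (c k)\<^sup>2 * \<bar>G (f i - of_int k)\<bar>)) summable_on I"
      by (intro summable_on_cmult_right D(2)) auto
    have s: "(\<lambda>i. (shift_series G c (f i))\<^sup>2) summable_on I"
      by (rule summable_on_comparison_test[OF D2]) (use le in auto)
    have "(\<Sum>\<^sub>\<infinity>i\<in>I. (shift_series G c (f i))\<^sup>2) \<le> (\<Sum>\<^sub>\<infinity>i\<in>I. W' * (\<Sum>\<^sub>\<infinity>k. (c k)\<^sup>2 * \<bar>G (f i - of_int k)\<bar>))"
      by (rule infsum_mono[OF s D2 le])
    also have "\<dots> = W' * (\<Sum>\<^sub>\<infinity>i\<in>I. (\<Sum>\<^sub>\<infinity>k. (c k)\<^sup>2 * \<bar>G (f i - of_int k)\<bar>))"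
      by (rule infsum_cmult_right) (use D(2) in auto)
    also have "\<dots> \<le> W' * (W * (\<Sum>\<^sub>\<infinity>k. (c k)\<^sup>2))" using W' D(3) by (intro mult_left_mono) auto
    finally show "(\<lambda>i. (shift_series G c (f i))\<^sup>2) summable_on I \<and>
      (\<Sum>\<^sub>\<infinity>i\<in>I. (shift_series G c (f i))\<^sup>2) \<le> W' * W * (\<Sum>\<^sub>\<infinity>k. (c k)\<^sup>2)" using s by (simp add: mult.assoc)
  qed
qed

section \<open>The lower sampling inequality\<close>

text \<open>Both conditions are non-strict inequalities and so pass to pointwise limits. With s > 0
  the gap condition keeps the limiting points distinct, which strict monotonicity alone would
  not.\<close>

definition sampling_sequence :: "real \<Rightarrow> real \<Rightarrow> real \<Rightarrow> (int \<Rightarrow> real) \<Rightarrow> bool" where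
  "sampling_sequence s q D \<mu> \<longleftrightarrow> (\<forall>i. \<mu> i + s \<le> \<mu> (i + 1)) \<and> (\<forall>i. \<bar>\<mu> i - of_int i / q\<bar> \<le> D)"

lemma sampling_sequence_gap:
  assumes "sampling_sequence s q D \<mu>" "s > 0" "i < j"
  shows "\<mu> i + s \<le> \<mu> j"
proof -
  have "\<mu> i + s \<le> \<mu> (i + 1 + int n)" for n
  proof (induction n)
    case 0
    then show ?case using assms by (simp add: sampling_sequence_def)
  next
    case (Suc n)
    have "\<mu> (i + 1 + int n) + s \<le> \<mu> (i + 1 + int n + 1)"
      using assms(1) unfolding sampling_sequence_def by blast
    then show ?case using Suc assms(2) by (simp add: algebra_simps)
  qed
  from this[of "nat (j - i - 1)"] show ?thesis using assms(3) by simp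
qed

lemma sampling_sequence_separated:
  assumes "sampling_sequence s q D \<mu>" "s > 0" "i \<noteq> j"
  shows "s \<le> \<bar>\<mu> i - \<mu> j\<bar>"
  using sampling_sequence_gap[OF assms(1,2), of i j] sampling_sequence_gap[OF assms(1,2), of j i] assms(3)
  by linarith

text \<open>Moving the origin to m requires renumbering by qm, the position of m in the grid of
  points i/q. Rounding qm to an integer moves the grid by at most 1/q < 1, hence D + 1.\<close>

lemma sampling_sequence_shift:
  assumes "sampling_sequence s q D \<mu>" "q > 1"
  shows "sampling_sequence s q (D + 1) (\<lambda>i. \<mu> (i + \<lfloor>q * of_int m\<rfloor>) - of_int m)"
  unfolding sampling_sequence_def
proof (intro conjI allI)
  fix i
  let ?p = "\<lfloor>q * of_int m\<rfloor>"
  show "\<mu> (i + ?p) - of_int m + s \<le> \<mu> (i + 1 + ?p) - of_int m"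
  proof -
    have "\<mu> (i + ?p) + s \<le> \<mu> (i + ?p + 1)" using assms unfolding sampling_sequence_def by blast
    moreover have "i + ?p + 1 = i + 1 + ?p" by simp
    ultimately show ?thesis by simp
  qed
  have "\<bar>\<mu> (i + ?p) - of_int (i + ?p) / q\<bar> \<le> D" using assms unfolding sampling_sequence_def by blast
  moreover have "of_int (i + ?p) / q = of_int i / q + of_int ?p / q" by (simp add: add_divide_distrib)
  moreover have "\<bar>of_int ?p / q - of_int m\<bar> \<le> 1"
  proof -
    have "of_int ?p / q - of_int m = (of_int ?p - q * of_int m) / q" using assms by (simp add: field_simps)
    moreover have "\<bar>of_int ?p - q * of_int m\<bar> \<le> q" using assms by linarith
    then have "\<bar>(of_int ?p - q * of_int m) / q\<bar> \<le> 1" unfolding abs_divide using assms by (simp add: divide_le_eq)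
    ultimately show ?thesis by (simp only:)
  qed
  ultimately show "\<bar>\<mu> (i + ?p) - of_int m - of_int i / q\<bar> \<le> D + 1" by linarith
qed

lemma shift_series_translate:
  "shift_series G (\<lambda>k. c (k + m) / a) x = shift_series G c (x + of_int m) / a"
proof -
  have "(\<Sum>\<^sub>\<infinity>k. c k * G (x + of_int m - of_int k)) = (\<Sum>\<^sub>\<infinity>k. c (k + m) * G (x - of_int k))"
    by (rule infsum_reindex_bij_witness[of _ "\<lambda>k. k + m" "\<lambda>k. k - m"]) (auto simp: algebra_simps)
  moreover have "(\<Sum>\<^sub>\<infinity>k. c (k + m) / a * G (x - of_int k)) = (\<Sum>\<^sub>\<infinity>k. (c (k + m) * G (x - of_int k)) * inverse a)"
    by (simp add: field_simps)
  ultimately show ?thesis unfolding shift_series_def infsum_cmult_left' by (simp add: divide_inverse)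
qed

lemma single_le_infsum:
  fixes f :: "'a \<Rightarrow> real"
  assumes "f summable_on A" "\<And>x. x \<in> A \<Longrightarrow> f x \<ge> 0" "a \<in> A"
  shows "f a \<le> infsum f A"
  using finite_sum_le_infsum[OF assms(1), of "{a}"] assms by auto

text \<open>If the samples of \<open>f\<close> are small compared with its coefficients, then averaging against the
  weights \<open>1/(1 + (x - m)\<^sup>2)\<close> finds an \<open>m\<close> such that, seen from \<open>m\<close>, the coefficients grow at
  most linearly relative to \<open>c\<^sub>m\<close> and the samples are still small.\<close>

lemma localize:
  assumes dec: "exp_decay G" and s: "s > 0" and q: "q > 1"
    and W: "W > 0" "\<And>x::real. (\<lambda>m::int. 1 / (1 + (x - of_int m)\<^sup>2)) summable_on UNIV"
      "\<And>x::real. (\<Sum>\<^sub>\<infinity>m::int. 1 / (1 + (x - of_int m)\<^sup>2)) \<le> W"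
    and \<mu>: "sampling_sequence s q D \<mu>" and c: "(\<lambda>k. (c k)\<^sup>2) summable_on UNIV"
    and \<eta>: "\<eta> > 0" and small: "(\<Sum>\<^sub>\<infinity>i. (shift_series G c (\<mu> i))\<^sup>2) < \<eta> * (\<Sum>\<^sub>\<infinity>k. (c k)\<^sup>2)"
  obtains d \<nu> where "lin_growth (sqrt (2 * W)) d" "d 0 = 1" "sampling_sequence s q (D + 1) \<nu>"
    "\<And>i. (shift_series G d (\<nu> i))\<^sup>2 \<le> 2 * W * \<eta> * (1 + (\<nu> i)\<^sup>2)"
proof -
  let ?f = "\<lambda>i. shift_series G c (\<mu> i)"
  let ?w = "\<lambda>x. 1 / (1 + x\<^sup>2) :: real"
  have w: "?w x \<ge> 0" for x by (simp add: add_nonneg_nonneg)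
  have wpos: "1 + x\<^sup>2 > 0" for x :: real by (simp add: add_pos_nonneg)
  define C where "C = (\<Sum>\<^sub>\<infinity>k. (c k)\<^sup>2)"
  define S where "S = (\<Sum>\<^sub>\<infinity>i. (?f i)\<^sup>2)"
  have f: "(\<lambda>i. (?f i)\<^sup>2) summable_on UNIV"
    using bessel_bound[OF dec s, where ?'i = int] sampling_sequence_separated[OF \<mu> s] c by metis
  define U V where "U m = (\<Sum>\<^sub>\<infinity>k. (c k)\<^sup>2 * ?w (of_int k - of_int m))"
    and "V m = (\<Sum>\<^sub>\<infinity>i. (?f i)\<^sup>2 * ?w (\<mu> i - of_int m))" for m :: int
  note DU = double_sum_bound[of "\<lambda>k. (c k)\<^sup>2" UNIV "\<lambda>k m. ?w (of_int k - of_int m)" UNIV W, OF _ c w W(2) W(3)]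
  note DV = double_sum_bound[of "\<lambda>i. (?f i)\<^sup>2" UNIV "\<lambda>i m. ?w (\<mu> i - of_int m)" UNIV W, OF _ f w W(2) W(3)]
  have U: "U summable_on UNIV" "infsum U UNIV \<le> W * C" unfolding U_def C_def using DU by auto
  have V: "V summable_on UNIV" "infsum V UNIV \<le> W * S" unfolding V_def S_def using DV by auto
  have UV0: "U m \<ge> 0" "V m \<ge> 0" for m unfolding U_def V_def using w by (auto intro!: infsum_nonneg mult_nonneg_nonneg)
  \<comment> \<open>The two weights are chosen so that, summed over m, each term on the left
    contributes at most half of \<open>C\<close>, the second strictly less by smallness of the
    samples. If no m worked, this would give C < C. Strictness also yields c(m) \<noteq> 0, so
    division by it is possible.\<close>
  have "\<exists>m. U m / (2 * W) + V m / (2 * W * \<eta>) < (c m)\<^sup>2"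
  proof (rule ccontr)
    assume "\<not> ?thesis"
    then have le: "(c m)\<^sup>2 \<le> U m * (1 / (2 * W)) + V m * (1 / (2 * W * \<eta>))" for m by (simp add: not_less)
    have s1: "(\<lambda>m. U m * (1 / (2 * W))) summable_on UNIV" "(\<lambda>m. V m * (1 / (2 * W * \<eta>))) summable_on UNIV"
      by (intro summable_on_cmult_left U V)+
    have "C \<le> (\<Sum>\<^sub>\<infinity>m. U m * (1 / (2 * W)) + V m * (1 / (2 * W * \<eta>)))"
      unfolding C_def by (rule infsum_mono[OF c summable_on_add[OF s1]]) (use le in auto)
    also have "\<dots> = infsum U UNIV * (1 / (2 * W)) + infsum V UNIV * (1 / (2 * W * \<eta>))"
      unfolding infsum_add[OF s1] infsum_cmult_left' ..
    also have "\<dots> \<le> (W * C) * (1 / (2 * W)) + (W * S) * (1 / (2 * W * \<eta>))"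
      by (intro add_mono mult_right_mono U V) (use W \<eta> in auto)
    also have "\<dots> = C / 2 + S / (2 * \<eta>)" using W \<eta> by (simp add: field_simps)
    also have "\<dots> < C / 2 + C / 2"
      using small \<eta> unfolding C_def[symmetric] S_def[symmetric] by (simp add: field_simps)
    finally show False by simp
  qed
  then obtain m where m: "U m / (2 * W) + V m / (2 * W * \<eta>) < (c m)\<^sup>2" by blast
  have "U m / (2 * W) \<ge> 0" "V m / (2 * W * \<eta>) \<ge> 0" using UV0 W \<eta> by auto
  with m have "U m / (2 * W) \<le> (c m)\<^sup>2" "V m / (2 * W * \<eta>) \<le> (c m)\<^sup>2" "(c m)\<^sup>2 > 0" by linarith+
  then have Um: "U m \<le> 2 * W * (c m)\<^sup>2" and Vm: "V m \<le> 2 * W * \<eta> * (c m)\<^sup>2" and cm: "c m \<noteq> 0"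
    using W \<eta> by (auto simp: field_simps)
  define d where "d k = c (k + m) / c m" for k
  define \<nu> where "\<nu> i = \<mu> (i + \<lfloor>q * of_int m\<rfloor>) - of_int m" for i
  show ?thesis
  proof (rule that)
    show "d 0 = 1" using cm by (simp add: d_def)
    show "sampling_sequence s q (D + 1) \<nu>" unfolding \<nu>_def by (rule sampling_sequence_shift[OF \<mu> q])
    show "lin_growth (sqrt (2 * W)) d"
      unfolding lin_growth_def
    proof
      fix k
      have "(c (k + m))\<^sup>2 * ?w (of_int (k + m) - of_int m) \<le> U m"
        unfolding U_def by (rule single_le_infsum[of "\<lambda>k. (c k)\<^sup>2 * ?w (of_int k - of_int m)"]) (use DU(1)[of m] w in auto)
      with Um have "(c (k + m))\<^sup>2 / (1 + (of_int k)\<^sup>2) \<le> 2 * W * (c m)\<^sup>2" by simp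
      then have "(c (k + m))\<^sup>2 \<le> 2 * W * (c m)\<^sup>2 * (1 + (of_int k)\<^sup>2)"
        by (simp only: pos_divide_le_eq[OF wpos])
      then have "(c (k + m))\<^sup>2 \<le> 2 * W * (1 + (of_int k)\<^sup>2) * (c m)\<^sup>2" by (simp only: mult_ac)
      then have "(d k)\<^sup>2 \<le> 2 * W * (1 + (of_int k)\<^sup>2)"
        unfolding d_def power_divide using cm by (subst pos_divide_le_eq) auto
      also have "\<dots> \<le> 2 * W * (1 + \<bar>of_int k\<bar>)\<^sup>2"
        using W by (intro mult_left_mono) (auto simp: power2_eq_square algebra_simps)
      also have "\<dots> = (sqrt (2 * W) * (1 + \<bar>of_int k\<bar>))\<^sup>2" using W by (simp add: power_mult_distrib)
      finally have "\<bar>d k\<bar> \<le> \<bar>sqrt (2 * W) * (1 + \<bar>of_int k\<bar>)\<bar>" by (simp only: abs_le_square_iff)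
      also have "\<dots> = sqrt (2 * W) * (1 + \<bar>of_int k\<bar>)" using W by (intro abs_of_nonneg mult_nonneg_nonneg) auto
      finally show "\<bar>d k\<bar> \<le> sqrt (2 * W) * (1 + \<bar>of_int k\<bar>)" .
    qed
    fix i
    let ?j = "i + \<lfloor>q * of_int m\<rfloor>"
    have "(?f ?j)\<^sup>2 * ?w (\<mu> ?j - of_int m) \<le> V m"
      unfolding V_def by (rule single_le_infsum[of "\<lambda>i. (?f i)\<^sup>2 * ?w (\<mu> i - of_int m)"]) (use DV(1)[of m] w in auto)
    with Vm have "(?f ?j)\<^sup>2 / (1 + (\<nu> i)\<^sup>2) \<le> 2 * W * \<eta> * (c m)\<^sup>2" by (simp add: \<nu>_def)
    then have "(?f ?j)\<^sup>2 \<le> 2 * W * \<eta> * (c m)\<^sup>2 * (1 + (\<nu> i)\<^sup>2)"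
      by (simp only: pos_divide_le_eq[OF wpos])
    then have *: "(?f ?j)\<^sup>2 \<le> 2 * W * \<eta> * (1 + (\<nu> i)\<^sup>2) * (c m)\<^sup>2" by (simp only: mult_ac)
    have eq: "shift_series G d (\<nu> i) = ?f ?j / c m"
      unfolding d_def shift_series_translate by (simp add: \<nu>_def)
    show "(shift_series G d (\<nu> i))\<^sup>2 \<le> 2 * W * \<eta> * (1 + (\<nu> i)\<^sup>2)"
      unfolding eq power_divide using cm * by (subst pos_divide_le_eq) auto
  qed
qed

section \<open>Compactness and the uniform lower bound\<close>

lemma tendsto_infsum_dominated:
  fixes f :: "nat \<Rightarrow> 'a :: countable \<Rightarrow> real"
  assumes lim: "\<And>k. (\<lambda>n. f n k) \<longlonglongrightarrow> g k" and dom: "\<And>n k. \<bar>f n k\<bar> \<le> M k" and M: "M summable_on UNIV"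
  shows "(\<lambda>n. infsum (f n) UNIV) \<longlonglongrightarrow> infsum g UNIV"
proof -
  have conv: "integrable (count_space UNIV) h \<and> infsum h UNIV = integral\<^sup>L (count_space UNIV) h"
    if "\<And>k. \<bar>h k\<bar> \<le> M k" for h :: "'a \<Rightarrow> real"
  proof -
    have "(\<lambda>k. norm (h k)) summable_on UNIV"
      by (rule summable_on_comparison_test[OF M]) (use that in auto)
    then have "Infinite_Set_Sum.abs_summable_on h UNIV" by (simp only: abs_summable_equivalent)
    then show ?thesis
      using infsetsum_infsum[of h UNIV] by (simp add: Infinite_Set_Sum.abs_summable_on_def infsetsum_def)
  qed
  have gM: "\<bar>g k\<bar> \<le> M k" for k
    by (rule LIMSEQ_le_const2[OF tendsto_rabs[OF lim]]) (use dom in auto)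
  have M0: "\<bar>M k\<bar> \<le> M k" for k using dom[of 0 k] by auto
  have "(\<lambda>n. integral\<^sup>L (count_space UNIV) (f n)) \<longlonglongrightarrow> integral\<^sup>L (count_space UNIV) g"
    by (rule integral_dominated_convergence[where w = M]) (use lim dom conv[of M] M0 in auto)
  then show ?thesis using conv[of "f _"] conv[of g] dom gM by simp
qed

text \<open>Tychonoff's theorem in a countable product, where compactness gives convergent
  subsequences, takes the place of a diagonal argument.\<close>

lemma bounded_functions_subsequence:
  fixes x :: "nat \<Rightarrow> 'a :: countable \<Rightarrow> real"
  assumes "\<And>n j. \<bar>x n j\<bar> \<le> b j"
  obtains l r where "strict_mono (r :: nat \<Rightarrow> nat)" "\<And>j. (\<lambda>n. x (r n) j) \<longlonglongrightarrow> l j"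
proof -
  have "compactin (product_topology (\<lambda>_. euclidean) UNIV) (PiE UNIV (\<lambda>j. {- b j..b j}))"
    unfolding compactin_PiE by auto
  then have "compact (PiE UNIV (\<lambda>j. {- b j..b j}))"
    by (simp add: euclidean_product_topology)
  then have "seq_compact (PiE UNIV (\<lambda>j. {- b j..b j}))" by (rule compact_imp_seq_compact)
  moreover have "\<forall>n. x n \<in> PiE UNIV (\<lambda>j. {- b j..b j})"
    using assms by (auto simp: abs_le_iff minus_le_iff)
  ultimately obtain l r where lr: "strict_mono (r :: nat \<Rightarrow> nat)" "(x \<circ> r) \<longlonglongrightarrow> l"
    unfolding seq_compact_def by blast
  have "(\<lambda>n. x (r n) j) \<longlonglongrightarrow> l j" for j
  proof -
    have "continuous_on UNIV (\<lambda>f :: 'a \<Rightarrow> real. f j)" by (rule continuous_on_product_coordinates)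
    then have "isCont (\<lambda>f :: 'a \<Rightarrow> real. f j) l"
      unfolding continuous_on_eq_continuous_at[OF open_UNIV] by blast
    from isCont_tendsto_compose[OF this lr(2)] show ?thesis by (simp add: o_def)
  qed
  with lr that show ?thesis by blast
qed

text \<open>The constant is uniform over all sequences with the same s, q and D. This uniformity
  comes from letting the sequences vary in the compactness argument, and it is what permits
  averaging over translates later.\<close>

lemma sampling_lower_bound:
  assumes cont: "continuous_on UNIV G" and dec: "exp_decay G" and det: "determined_by_dense_zeros G"
    and s: "s > 0" and q: "q > 1"
  obtains A where "A > 0" "\<And>\<mu> c. sampling_sequence s q D \<mu> \<Longrightarrow> (\<lambda>k. (c k)\<^sup>2) summable_on UNIV \<Longrightarrow>
    A * (\<Sum>\<^sub>\<infinity>k. (c k)\<^sup>2) \<le> (\<Sum>\<^sub>\<infinity>i. (shift_series G c (\<mu> i))\<^sup>2)"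
proof (rule ccontr)
  assume "\<not> thesis"
  note obt = that
  have no: "\<exists>\<mu> c. sampling_sequence s q D \<mu> \<and> (\<lambda>k. (c k)\<^sup>2) summable_on UNIV \<and>
    (\<Sum>\<^sub>\<infinity>i. (shift_series G c (\<mu> i))\<^sup>2) < A * (\<Sum>\<^sub>\<infinity>k. (c k)\<^sup>2)" if A: "A > 0" for A
  proof (rule ccontr)
    assume n: "\<not> ?thesis"
    have thesis by (rule obt[OF A]) (use n in \<open>meson not_le\<close>)
    with \<open>\<not> thesis\<close> show False ..
  qed
  obtain W :: real where W: "W > 0" "\<And>x::real. (\<lambda>m::int. 1 / (1 + (x - of_int m)\<^sup>2)) summable_on UNIV"
    "\<And>x::real. (\<Sum>\<^sub>\<infinity>m::int. 1 / (1 + (x - of_int m)\<^sup>2)) \<le> W"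
    by (rule cauchy_weight_separated_sum) blast
  have "\<exists>d \<nu>. lin_growth (sqrt (2 * W)) d \<and> d 0 = 1 \<and> sampling_sequence s q (D + 1) \<nu> \<and>
    (\<forall>i. (shift_series G d (\<nu> i))\<^sup>2 \<le> 2 * W * (1 / real (Suc n)) * (1 + (\<nu> i)\<^sup>2))" for n
  proof -
    have pos: "1 / real (Suc n) > 0" by simp
    obtain \<mu> c where h: "sampling_sequence s q D \<mu>" "(\<lambda>k. (c k)\<^sup>2) summable_on UNIV"
      "(\<Sum>\<^sub>\<infinity>i. (shift_series G c (\<mu> i))\<^sup>2) < 1 / real (Suc n) * (\<Sum>\<^sub>\<infinity>k. (c k)\<^sup>2)"
      using no[OF pos] by blast
    show ?thesis
      by (rule localize[OF dec s q W h(1,2) pos h(3)]) blast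
  qed
  then obtain d \<nu> where d: "\<And>n. lin_growth (sqrt (2 * W)) (d n)" "\<And>n. d n 0 = 1"
    and \<nu>: "\<And>n. sampling_sequence s q (D + 1) (\<nu> n)"
    and sm: "\<And>n i. (shift_series G (d n) (\<nu> n i))\<^sup>2 \<le> 2 * W * (1 / real (Suc n)) * (1 + (\<nu> n i)\<^sup>2)"
    by metis
  \<comment> \<open>Coefficients and sampling points are packed into one family over a sum type, so
    that a single subsequence serves both.\<close>
  define x where "x n j = (case j of Inl k \<Rightarrow> d n k | Inr i \<Rightarrow> \<nu> n i)" for n and j :: "int + int"
  define b where "b j = (case j of Inl k \<Rightarrow> sqrt (2 * W) * (1 + \<bar>of_int k\<bar>) | Inr i \<Rightarrow> \<bar>of_int i / q\<bar> + (D + 1))" for j :: "int + int"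
  have \<nu>b: "\<bar>\<nu> n i\<bar> \<le> \<bar>of_int i / q\<bar> + (D + 1)" for n i
  proof -
    have "\<bar>\<nu> n i - of_int i / q\<bar> \<le> D + 1" using \<nu> unfolding sampling_sequence_def by blast
    then show ?thesis by linarith
  qed
  have "\<bar>x n j\<bar> \<le> b j" for n j
    using d(1)[of n] \<nu>b unfolding x_def b_def lin_growth_def by (cases j) auto
  then obtain l r where r: "strict_mono (r :: nat \<Rightarrow> nat)" and l: "\<And>j. (\<lambda>n. x (r n) j) \<longlonglongrightarrow> l j"
    using bounded_functions_subsequence[of x b] by blast
  define d' \<nu>' where "d' k = l (Inl k)" and "\<nu>' i = l (Inr i)" for k i :: int
  have dl: "(\<lambda>n. d (r n) k) \<longlonglongrightarrow> d' k" and \<nu>l: "(\<lambda>n. \<nu> (r n) k) \<longlonglongrightarrow> \<nu>' k" for k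
    using l[of "Inl k"] l[of "Inr k"] by (simp_all add: x_def d'_def \<nu>'_def)
  have d': "lin_growth (sqrt (2 * W)) d'"
    unfolding lin_growth_def
    by (intro allI LIMSEQ_le_const2[OF tendsto_rabs[OF dl]]) (use d(1) in \<open>auto simp: lin_growth_def\<close>)
  have d'0: "d' 0 = 1" using LIMSEQ_unique[OF dl[of 0]] d(2) by simp
  have gap: "\<nu>' i + s \<le> \<nu>' (i + 1)" for i
    by (rule LIMSEQ_le[OF tendsto_add[OF \<nu>l tendsto_const] \<nu>l]) (use \<nu> in \<open>auto simp: sampling_sequence_def\<close>)
  have close: "\<bar>\<nu>' i - of_int i / q\<bar> \<le> D + 1" for i
    by (rule LIMSEQ_le_const2[OF tendsto_rabs[OF tendsto_diff[OF \<nu>l tendsto_const]]])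
       (use \<nu> in \<open>auto simp: sampling_sequence_def\<close>)
  have \<nu>': "sampling_sequence s q (D + 1) \<nu>'" using gap close by (simp add: sampling_sequence_def)
  have mono: "strict_mono \<nu>'"
    by (rule strict_monoI) (use sampling_sequence_gap[OF \<nu>' s] s in force)
  have zero: "shift_series G d' (\<nu>' i) = 0" for i
  proof -
    define R where "R = \<bar>of_int i / q\<bar> + (D + 1)"
    obtain B e where B: "B > 0" "e > 0"
      "\<And>d k x. lin_growth (sqrt (2 * W)) d \<Longrightarrow> \<bar>d k * G (x - of_int k)\<bar> \<le> B * exp (2 * e * \<bar>x\<bar>) * exp (- e * \<bar>of_int k\<bar>)"
      using series_dominated[OF dec lin_growth_nonneg[OF d']] by metis
    \<comment> \<open>Coefficients and evaluation point vary together. For fixed i the points stay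
      in [-R, R] and the growth constant is common, so one summable majorant works for all
      n.\<close>
    have lim: "(\<lambda>n. shift_series G (d (r n)) (\<nu> (r n) i)) \<longlonglongrightarrow> shift_series G d' (\<nu>' i)"
      unfolding shift_series_def
    proof (rule tendsto_infsum_dominated)
      show "(\<lambda>k::int. B * exp (2 * e * R) * exp (- e * \<bar>of_int k\<bar>)) summable_on UNIV"
        by (intro summable_on_cmult_right summable_on_int_exp B)
      fix n :: nat and k :: int
      have "\<bar>d (r n) k * G (\<nu> (r n) i - of_int k)\<bar> \<le> B * exp (2 * e * \<bar>\<nu> (r n) i\<bar>) * exp (- e * \<bar>of_int k\<bar>)"
        by (rule B(3)[OF d(1)])
      also have "\<dots> \<le> B * exp (2 * e * R) * exp (- e * \<bar>of_int k\<bar>)"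
        using \<nu>b[of "r n" i] B by (intro mult_right_mono mult_left_mono) (auto simp: R_def)
      finally show "\<bar>d (r n) k * G (\<nu> (r n) i - of_int k)\<bar> \<le> B * exp (2 * e * R) * exp (- e * \<bar>of_int k\<bar>)" .
    next
      fix k :: int
      have "isCont G x" for x using cont by (simp add: continuous_on_eq_continuous_at)
      then show "(\<lambda>n. d (r n) k * G (\<nu> (r n) i - of_int k)) \<longlonglongrightarrow> d' k * G (\<nu>' i - of_int k)"
        by (intro tendsto_mult dl isCont_tendsto_compose[of _ G] tendsto_diff \<nu>l tendsto_const)
    qed
    have R2: "(\<nu> n i)\<^sup>2 \<le> R\<^sup>2" for n using \<nu>b[of n i] unfolding R_def by (metis abs_ge_zero power2_abs power_mono)
    have "(shift_series G d' (\<nu>' i))\<^sup>2 \<le> 0"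
    proof (rule LIMSEQ_le[OF tendsto_power[OF lim]])
      have "(\<lambda>n. 2 * W * (1 / real (Suc n)) * (1 + R\<^sup>2)) \<longlonglongrightarrow> 0" by real_asymp
      then show "(\<lambda>n. 2 * W * (1 / real (Suc (r n))) * (1 + R\<^sup>2)) \<longlonglongrightarrow> 0"
        using LIMSEQ_subseq_LIMSEQ[OF _ r] by (simp add: o_def)
      have "(shift_series G (d (r n)) (\<nu> (r n) i))\<^sup>2 \<le> 2 * W * (1 / real (Suc (r n))) * (1 + R\<^sup>2)" for n
        using W by (intro order_trans[OF sm] mult_left_mono) (auto simp: R2)
      then show "\<exists>N. \<forall>n\<ge>N. (shift_series G (d (r n)) (\<nu> (r n) i))\<^sup>2 \<le> 2 * W * (1 / real (Suc (r n))) * (1 + R\<^sup>2)" by blast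
    qed
    then show ?thesis by simp
  qed
  have "d' 0 = 0"
    using det d' mono q close zero unfolding determined_by_dense_zeros_def by blast
  with d'0 show False by simp
qed

section \<open>Norm equivalence and lower density\<close>

lemma nn_integral_count_space_infsum:
  fixes h :: "'a :: countable \<Rightarrow> real"
  assumes "h summable_on UNIV" "\<And>k. h k \<ge> 0"
  shows "(\<integral>\<^sup>+k. ennreal (h k) \<partial>count_space UNIV) = ennreal (infsum h UNIV)"
proof -
  have "(\<lambda>k. norm (h k)) summable_on UNIV" using assms by simp
  then have "Infinite_Set_Sum.abs_summable_on h UNIV" by (simp only: abs_summable_equivalent)
  then have "integrable (count_space UNIV) h" "infsum h UNIV = integral\<^sup>L (count_space UNIV) h"
    using infsetsum_infsum[of h UNIV] by (simp_all add: Infinite_Set_Sum.abs_summable_on_def infsetsum_def)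
  then show ?thesis using assms by (simp add: nn_integral_eq_integral)
qed

text \<open>The half-open intervals [i/2, i/2 + 1/2) tile the line. Nonnegative integrals allow the
  exchange before integrability is known.\<close>

lemma nn_integral_periodize:
  fixes F :: "real \<Rightarrow> ennreal"
  assumes [measurable]: "F \<in> borel_measurable borel"
  shows "(\<integral>\<^sup>+x. F x \<partial>lborel) =
    (\<integral>\<^sup>+t. (\<integral>\<^sup>+i. F (t + of_int i / 2) \<partial>count_space (UNIV :: int set)) * indicator {0..<1/2} t \<partial>lborel)"
proof -
  let ?I = "\<lambda>i::int. {of_int i / 2..<of_int i / 2 + 1 / 2 :: real}"
  have "F x = (\<integral>\<^sup>+i. F x * indicator (?I i) x \<partial>count_space UNIV)" for x
  proof -
    have "x \<in> ?I i \<longleftrightarrow> i = \<lfloor>2 * x\<rfloor>" for i :: int by (auto simp: field_simps) linarith+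
    then have "indicator (?I i) x = (indicator {\<lfloor>2 * x\<rfloor>} i :: ennreal)" for i :: int
      by (simp add: indicator_def)
    then show ?thesis by (simp add: nn_integral_cmult_indicator)
  qed
  then have "(\<integral>\<^sup>+x. F x \<partial>lborel) = (\<integral>\<^sup>+x. \<integral>\<^sup>+i. F x * indicator (?I i) x \<partial>count_space UNIV \<partial>lborel)" by simp
  also have "\<dots> = (\<integral>\<^sup>+i. \<integral>\<^sup>+x. F x * indicator (?I i) x \<partial>lborel \<partial>count_space UNIV)"
    by (rule nn_integral_count_space_nn_integral) auto
  also have "\<dots> = (\<integral>\<^sup>+i. \<integral>\<^sup>+t. F (t + of_int i / 2) * indicator {0..<1/2} t \<partial>lborel \<partial>count_space UNIV)"
  proof (rule nn_integral_cong)
    fix i :: int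
    have ind: "indicator (?I i) (of_int i / 2 + 1 * t) = (indicator {0..<1/2} t :: ennreal)" for t
      by (auto simp: indicator_def)
    have "(\<integral>\<^sup>+x. F x * indicator (?I i) x \<partial>lborel) =
      ennreal \<bar>1\<bar> * (\<integral>\<^sup>+t. F (of_int i / 2 + 1 * t) * indicator (?I i) (of_int i / 2 + 1 * t) \<partial>lborel)"
      by (rule nn_integral_real_affine) auto
    then show "(\<integral>\<^sup>+x. F x * indicator (?I i) x \<partial>lborel) = (\<integral>\<^sup>+t. F (t + of_int i / 2) * indicator {0..<1/2} t \<partial>lborel)"
      unfolding ind by (simp add: add.commute)
  qed
  also have "\<dots> = (\<integral>\<^sup>+t. \<integral>\<^sup>+i. F (t + of_int i / 2) * indicator {0..<1/2} t \<partial>count_space UNIV \<partial>lborel)"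
    by (rule nn_integral_count_space_nn_integral[symmetric]) auto
  finally show ?thesis by (simp add: nn_integral_multc)
qed

text \<open>The increment lemma with \<delta> = 1 already contains continuity, up to the factor exp
  u.\<close>

lemma continuous_on_shift_series:
  assumes "exp_decay G" "continuous_on UNIV G" "lin_growth K d"
  shows "continuous_on UNIV (shift_series G d)"
proof -
  have "isCont (shift_series G d) x" for x
  proof -
    have "continuous_on {x - 1..x + 1} (\<lambda>u. exp (- u) * (exp (u / 1) * shift_series G d u))"
      by (intro continuous_intros shift_series_increment(1)[OF assms(1,2) _ _ assms(3)]) auto
    then have "continuous_on {x - 1..x + 1} (shift_series G d)"
      by (simp add: mult.assoc[symmetric] exp_add[symmetric])
    then show ?thesis by (rule continuous_on_interior) simp
  qed
  then show ?thesis by (simp add: continuous_at_imp_continuous_on)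
qed

text \<open>Both inequalities for the \<open>L\<^sup>2\<close> norm are averages over \<open>t \<in> [0,1/2)\<close> of sampling
  inequalities for the sequences \<open>t + i/2\<close>.\<close>

lemma riesz_bounds:
  assumes cont: "continuous_on UNIV G" and dec: "exp_decay G" and det: "determined_by_dense_zeros G"
  obtains A B where "A > 0" "B > 0" "\<And>c. (\<lambda>k. (c k)\<^sup>2) summable_on UNIV \<Longrightarrow>
    integrable lborel (\<lambda>x. (shift_series G c x)\<^sup>2) \<and>
    A * (\<Sum>\<^sub>\<infinity>k. (c k)\<^sup>2) \<le> (\<integral>x. (shift_series G c x)\<^sup>2 \<partial>lborel) \<and>
    (\<integral>x. (shift_series G c x)\<^sup>2 \<partial>lborel) \<le> B * (\<Sum>\<^sub>\<infinity>k. (c k)\<^sup>2)"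
proof -
  \<comment> \<open>Step 1/2 gives density q = 2 > 1; for t in [0, 1/2) the sequences t + i/2 all
    have gap 1/2 and deviate from i/2 by at most 1/2, so one pair of constants serves every
    t.\<close>
  have half: "(1 / 2 :: real) > 0" "(2 :: real) > 1" by auto
  obtain A where A: "A > 0" "\<And>\<mu> c. sampling_sequence (1/2) 2 (1/2) \<mu> \<Longrightarrow> (\<lambda>k. (c k)\<^sup>2) summable_on UNIV \<Longrightarrow>
    A * (\<Sum>\<^sub>\<infinity>k. (c k)\<^sup>2) \<le> (\<Sum>\<^sub>\<infinity>i. (shift_series G c (\<mu> i))\<^sup>2)"
    using sampling_lower_bound[OF cont dec det half, of "1/2"] by metis
  obtain B where B: "B > 0"
    "\<And>I (f :: int \<Rightarrow> real) c. (\<And>i j. i \<in> I \<Longrightarrow> j \<in> I \<Longrightarrow> i \<noteq> j \<Longrightarrow> 1 / 2 \<le> \<bar>f i - f j\<bar>) \<Longrightarrow>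
      (\<lambda>k. (c k)\<^sup>2) summable_on UNIV \<Longrightarrow>
      (\<lambda>i. (shift_series G c (f i))\<^sup>2) summable_on I \<and>
      (\<Sum>\<^sub>\<infinity>i\<in>I. (shift_series G c (f i))\<^sup>2) \<le> B * (\<Sum>\<^sub>\<infinity>k. (c k)\<^sup>2)"
    using bessel_bound[OF dec half(1), where ?'i = int] by metis
  show ?thesis
  proof (rule that[of "A / 2" "B / 2"])
    fix c :: "int \<Rightarrow> real" assume c: "(\<lambda>k. (c k)\<^sup>2) summable_on UNIV"
    define C where "C = (\<Sum>\<^sub>\<infinity>k. (c k)\<^sup>2)"
    have C0: "C \<ge> 0" unfolding C_def by (rule infsum_nonneg) auto
    let ?f = "shift_series G c"
    have "continuous_on UNIV ?f"
      by (rule continuous_on_shift_series[OF dec cont square_summable_lin_growth[OF c]])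
    then have [measurable]: "?f \<in> borel_measurable borel" by (rule borel_measurable_continuous_onI)
    define H where "H t = (\<integral>\<^sup>+i. ennreal ((?f (t + of_int i / 2))\<^sup>2) \<partial>count_space (UNIV :: int set))" for t
    have per: "(\<integral>\<^sup>+x. ennreal ((?f x)\<^sup>2) \<partial>lborel) = (\<integral>\<^sup>+t. H t * indicator {0..<1/2} t \<partial>lborel)"
      unfolding H_def by (rule nn_integral_periodize) measurable
    have H: "ennreal (A * C) \<le> H t" "H t \<le> ennreal (B * C)" if "t \<in> {0..<1/2}" for t
    proof -
      let ?\<mu> = "\<lambda>i::int. t + of_int i / 2"
      have \<mu>: "sampling_sequence (1/2) 2 (1/2) ?\<mu>"
        using that by (auto simp: sampling_sequence_def add_divide_distrib)
      note b = B(2)[of UNIV ?\<mu>, OF sampling_sequence_separated[OF \<mu> half(1)] c]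
      have "H t = ennreal (\<Sum>\<^sub>\<infinity>i. (?f (?\<mu> i))\<^sup>2)"
        unfolding H_def by (rule nn_integral_count_space_infsum) (use b in auto)
      then show "ennreal (A * C) \<le> H t" "H t \<le> ennreal (B * C)"
        using b A(2)[OF \<mu> c] by (auto simp: C_def intro: ennreal_leI)
    qed
    have half_int: "(\<integral>\<^sup>+t. ennreal (D * C) * indicator {0..<1/2::real} t \<partial>lborel) = ennreal (D / 2 * C)" if "D \<ge> 0" for D
    proof -
      have "(\<integral>\<^sup>+t. ennreal (D * C) * indicator {0..<1/2::real} t \<partial>lborel) = ennreal (D * C) * emeasure lborel {0..<1/2::real}"
        by (rule nn_integral_cmult_indicator) simp
      also have "emeasure lborel {0..<1/2::real} = ennreal (1/2 - 0)" by (rule emeasure_lborel_Ico) simp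
      also have "ennreal (D * C) * \<dots> = ennreal (D * C * (1/2 - 0))"
        using that C0 by (intro ennreal_mult[symmetric]) auto
      finally show ?thesis by simp
    qed
    have up: "(\<integral>\<^sup>+x. ennreal ((?f x)\<^sup>2) \<partial>lborel) \<le> ennreal (B / 2 * C)"
      unfolding per half_int[OF less_imp_le[OF B(1)], symmetric]
      by (rule nn_integral_mono) (use H in \<open>auto simp: indicator_def\<close>)
    have lo: "ennreal (A / 2 * C) \<le> (\<integral>\<^sup>+x. ennreal ((?f x)\<^sup>2) \<partial>lborel)"
      unfolding per half_int[OF less_imp_le[OF A(1)], symmetric]
      by (rule nn_integral_mono) (use H in \<open>auto simp: indicator_def\<close>)
    \<comment> \<open>The upper estimate makes the nonnegative integral finite, so both estimates
      may now be read as statements about the real integral.\<close>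
    have int: "integrable lborel (\<lambda>x. (?f x)\<^sup>2)"
      by (rule integrableI_bounded) (use up in \<open>auto simp: le_less_trans\<close>)
    have eq: "(\<integral>\<^sup>+x. ennreal ((?f x)\<^sup>2) \<partial>lborel) = ennreal (\<integral>x. (?f x)\<^sup>2 \<partial>lborel)"
      by (rule nn_integral_eq_integral[OF int]) auto
    have i0: "(\<integral>x. (?f x)\<^sup>2 \<partial>lborel) \<ge> 0" by simp
    show "integrable lborel (\<lambda>x. (?f x)\<^sup>2) \<and> A / 2 * (\<Sum>\<^sub>\<infinity>k. (c k)\<^sup>2) \<le> (\<integral>x. (?f x)\<^sup>2 \<partial>lborel) \<and>
      (\<integral>x. (?f x)\<^sup>2 \<partial>lborel) \<le> B / 2 * (\<Sum>\<^sub>\<infinity>k. (c k)\<^sup>2)"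
      using int lo up i0 C0 A(1) B(1) unfolding eq C_def[symmetric]
      by (auto simp: ennreal_le_iff)
  qed (use A B in auto)
qed

section \<open>From lower density to a sampling sequence\<close>

lemma finite_separated_Icc:
  fixes \<Lambda> :: "real set"
  assumes e: "e > 0" and sep: "\<And>l m. l \<in> \<Lambda> \<Longrightarrow> m \<in> \<Lambda> \<Longrightarrow> l \<noteq> m \<Longrightarrow> e \<le> \<bar>l - m\<bar>"
  shows "finite (\<Lambda> \<inter> {a..b})"
proof (rule inj_on_finite[where f = "\<lambda>x. \<lfloor>x / e\<rfloor>"])
  show "inj_on (\<lambda>x. \<lfloor>x / e\<rfloor>) (\<Lambda> \<inter> {a..b})"
  proof (rule inj_onI, rule ccontr)
    fix l m assume lm: "l \<in> \<Lambda> \<inter> {a..b}" "m \<in> \<Lambda> \<inter> {a..b}" "\<lfloor>l / e\<rfloor> = \<lfloor>m / e\<rfloor>" "l \<noteq> m"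
    have "\<bar>l / e - m / e\<bar> < 1" using lm(3) by linarith
    then have "\<bar>(l - m) / e\<bar> < 1" by (simp add: diff_divide_distrib)
    then have "\<bar>l - m\<bar> < e" using e by (simp add: divide_simps)
    with sep[of l m] lm show False by auto
  qed
  show "(\<lambda>x. \<lfloor>x / e\<rfloor>) ` (\<Lambda> \<inter> {a..b}) \<subseteq> {\<lfloor>a / e\<rfloor>..\<lfloor>b / e\<rfloor>}"
    using e by (auto intro!: floor_mono divide_right_mono)
qed simp

text \<open>For suitable \<open>2R < L < N\<close>, each interval \<open>[jL, jL + 2R]\<close> contributes \<open>N\<close> points, and \<open>q = N/L\<close>.\<close>

lemma lower_density_sampling_sequence:
  fixes \<Lambda> :: "real set"
  assumes e: "e > 0" and sep: "\<And>l m. l \<in> \<Lambda> \<Longrightarrow> m \<in> \<Lambda> \<Longrightarrow> l \<noteq> m \<Longrightarrow> e \<le> \<bar>l - m\<bar>"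
    and dens: "lower_beurling_density \<Lambda> > 1"
  obtains q D \<mu> where "q > 1" "sampling_sequence e q D \<mu>" "range \<mu> \<subseteq> \<Lambda>"
proof -
  obtain y where y: "1 < y" "y < lower_beurling_density \<Lambda>" using dens dense by blast
  then have "y < \<top>" by (auto simp: less_top[symmetric] dest: order.strict_trans2[OF _ top_greatest])
  then obtain q1 where q1: "y = ennreal q1" "q1 \<ge> 0" by (cases y) auto
  then have q1_1: "q1 > 1" using y(1) ennreal_less_iff[of 1 q1] by simp
  have "\<forall>\<^sub>F R in at_top. y < (INF x::real. emeasure (count_space UNIV) (\<Lambda> \<inter> {x - R..x + R}) / ennreal (2 * R))"
    using y(2) unfolding lower_beurling_density_def by (rule less_LiminfD)
  then have "\<forall>\<^sub>F R in at_top. R > 0 \<and> y < (INF x::real. emeasure (count_space UNIV) (\<Lambda> \<inter> {x - R..x + R}) / ennreal (2 * R))"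
    using eventually_gt_at_top[of 0] by eventually_elim simp
  then obtain R :: real where R: "R > 0" "y < (INF x::real. emeasure (count_space UNIV) (\<Lambda> \<inter> {x - R..x + R}) / ennreal (2 * R))"
    unfolding eventually_at_top_linorder by blast
  \<comment> \<open>Every closed interval of length 2R contains at least \<open>N\<close> points of
    \<Lambda>, and \<open>N\<close> exceeds 2R because q1 > 1.\<close>
  define N where "N = nat \<lceil>2 * R * q1\<rceil>"
  have card: "N \<le> card (\<Lambda> \<inter> {x - R..x + R})" for x
  proof -
    let ?S = "\<Lambda> \<inter> {x - R..x + R}"
    have fin: "finite ?S" by (rule finite_separated_Icc[OF e sep])
    have "y < emeasure (count_space UNIV) ?S / ennreal (2 * R)"
      using R(2) by (rule less_le_trans) (rule INF_lower, simp)
    also have "\<dots> = ennreal (real (card ?S) / (2 * R))"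
    proof -
      have "emeasure (count_space UNIV) ?S = ennreal (real (card ?S))"
        using fin by (simp add: ennreal_of_nat_eq_real_of_nat)
      then show ?thesis using R(1) by (simp add: divide_ennreal)
    qed
    finally have "q1 < real (card ?S) / (2 * R)" unfolding q1(1) using q1(2) by (simp add: ennreal_less_iff)
    then have "2 * R * q1 \<le> real (card ?S)" using R(1) by (simp add: field_simps)
    then show ?thesis unfolding N_def by linarith
  qed
  have N: "real N > 2 * R"
  proof -
    have "2 * R * 1 < 2 * R * q1" using R(1) q1_1 by (intro mult_strict_left_mono) auto
    also have "\<dots> \<le> real N" unfolding N_def by linarith
    finally show ?thesis by simp
  qed
  then have N0: "N > 0" using R(1) by (cases N) auto
  \<comment> \<open>The midpoint leaves room on both sides: L > 2R makes consecutive blocks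
    disjoint, so the selected points increase across blocks, and L < N makes N/L > 1.\<close>
  define L where "L = (2 * R + real N) / 2"
  have L: "2 * R < L" "L < real N" "L > 0" using N R(1) by (auto simp: L_def)
  define S where "S j = \<Lambda> \<inter> {of_int j * L..of_int j * L + 2 * R}" for j :: int
  have finS: "finite (S j)" for j unfolding S_def by (rule finite_separated_Icc[OF e sep])
  have cardS: "N \<le> card (S j)" for j
    using card[of "of_int j * L + R"] by (simp add: S_def add.assoc)
  \<comment> \<open>Division of i by \<open>N\<close> gives the block and the rank inside it,
    counted from 0; only the first \<open>N\<close> points of each block are used.\<close>
  define \<mu> where "\<mu> i = sorted_list_of_set (S (i div int N)) ! nat (i mod int N)" for i :: int
  have idx: "nat (i mod int N) < N" for i using N0 by (simp add: nat_less_iff)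
  have mem: "\<mu> i \<in> S (i div int N)" for i
  proof -
    have "nat (i mod int N) < length (sorted_list_of_set (S (i div int N)))"
      using idx[of i] cardS[of "i div int N"] by simp
    then have "\<mu> i \<in> set (sorted_list_of_set (S (i div int N)))" unfolding \<mu>_def by (rule nth_mem)
    then show ?thesis using finS by simp
  qed
  have less: "\<mu> i < \<mu> (i + 1)" for i
  proof (cases "i mod int N = int N - 1")
    case True
    have dm: "i = (i div int N) * int N + i mod int N" by simp
    then have "i + 1 = (i div int N + 1) * int N" using True by (simp add: algebra_simps)
    then have "(i + 1) div int N = i div int N + 1" using N0 by simp
    then have "\<mu> (i + 1) \<ge> of_int (i div int N + 1) * L" using mem[of "i + 1"] by (simp add: S_def)
    moreover have "\<mu> i \<le> of_int (i div int N) * L + 2 * R" using mem[of i] by (simp add: S_def)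
    ultimately show ?thesis using L(1) by (simp add: algebra_simps)
  next
    case False
    then have lt: "i mod int N + 1 < int N" using N0 pos_mod_bound[of "int N" i] by linarith
    have nn: "0 \<le> i mod int N" using N0 by simp
    have dm: "i + 1 = (i mod int N + 1) + (i div int N) * int N" by simp
    have d: "(i + 1) div int N = i div int N"
      by (subst dm, subst div_mult_self1) (use lt nn N0 in auto)
    have m: "(i + 1) mod int N = i mod int N + 1"
      by (subst dm, subst mod_mult_self1) (use lt nn in auto)
    have "sorted_list_of_set (S (i div int N)) ! nat (i mod int N) < sorted_list_of_set (S (i div int N)) ! nat (i mod int N + 1)"
    proof (rule sorted_wrt_nth_less[OF strict_sorted_list_of_set])
      show "nat (i mod int N) < nat (i mod int N + 1)" using nn by linarith
      show "nat (i mod int N + 1) < length (sorted_list_of_set (S (i div int N)))"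
      proof -
        have "nat (i mod int N + 1) < N" using lt nn by linarith
        then show ?thesis using cardS[of "i div int N"] by simp
      qed
    qed
    then show ?thesis unfolding \<mu>_def d m .
  qed
  have in\<Lambda>: "\<mu> i \<in> \<Lambda>" for i using mem by (auto simp: S_def)
  have "sampling_sequence e (real N / L) L \<mu>"
    unfolding sampling_sequence_def
  proof (intro conjI allI)
    fix i
    show "\<mu> i + e \<le> \<mu> (i + 1)" using sep[OF in\<Lambda> in\<Lambda>, of i "i + 1"] less[of i] by linarith
    \<comment> \<open>With q = N/L, i/q = jL + rL/N lies in [jL, jL + L], and the selected point
      lies in [jL, jL + 2R]. Since 2R < L, the deviation is at most L.\<close>
    define j r where "j = i div int N" and "r = i mod int N"
    have "i = j * int N + r" by (simp add: j_def r_def)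
    then have "of_int i / (real N / L) = of_int j * L + of_int r * L / real N"
      using N0 L by (simp add: field_simps)
    moreover have "0 \<le> of_int r * L / real N" using N0 L by (simp add: r_def)
    moreover have "of_int r * L / real N \<le> L"
    proof -
      have "r \<le> int N" unfolding r_def using N0 pos_mod_bound[of "int N" i] by linarith
      then have "real_of_int r \<le> real N" by (metis of_int_le_iff of_int_of_nat_eq)
      then have "of_int r * L \<le> real N * L" using L by (intro mult_right_mono) auto
      then show ?thesis using N0 by (simp add: divide_le_eq mult.commute)
    qed
    moreover have "of_int j * L \<le> \<mu> i" "\<mu> i \<le> of_int j * L + 2 * R"
      using mem[of i] by (auto simp: S_def j_def)
    ultimately show "\<bar>\<mu> i - of_int i / (real N / L)\<bar> \<le> L" using L(1) by linarith
  qed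
  moreover have "real N / L > 1" using L by simp
  ultimately show ?thesis using that in\<Lambda> by blast
qed

section \<open>Complex coefficients and the conclusion\<close>

text \<open>Since G is real, real and imaginary parts of the coefficients do not interact. All
  quantities to be compared are sums or integrals of squared moduli, so the estimates for real
  coefficients simply add.\<close>

lemma shift_invariant_space_real_decomposition:
  assumes f: "f \<in> shift_invariant_space (\<lambda>x. complex_of_real (G x))"
  obtains a b where "(\<lambda>k. (a k)\<^sup>2) summable_on UNIV" "(\<lambda>k. (b k)\<^sup>2) summable_on UNIV"
    "\<And>x. (cmod (f x))\<^sup>2 = (shift_series G a x)\<^sup>2 + (shift_series G b x)\<^sup>2"
proof -
  obtain c :: "int \<Rightarrow> complex" where c: "(\<lambda>k. (cmod (c k))\<^sup>2) summable_on UNIV"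
    and hs: "\<And>x. ((\<lambda>k. c k * complex_of_real (G (x - of_int k))) has_sum f x) UNIV"
    using f unfolding shift_invariant_space_def by blast
  show ?thesis
  proof (rule that)
    show "(\<lambda>k. (Re (c k))\<^sup>2) summable_on UNIV" "(\<lambda>k. (Im (c k))\<^sup>2) summable_on UNIV"
      by (rule summable_on_comparison_test[OF c]; simp add: cmod_power2)+
    fix x
    have "Re (f x) = shift_series G (\<lambda>k. Re (c k)) x" "Im (f x) = shift_series G (\<lambda>k. Im (c k)) x"
      using infsumI[OF has_sum_Re[OF hs[of x]]] infsumI[OF has_sum_Im[OF hs[of x]]]
      by (simp_all add: shift_series_def)
    then show "(cmod (f x))\<^sup>2 = (shift_series G (\<lambda>k. Re (c k)) x)\<^sup>2 + (shift_series G (\<lambda>k. Im (c k)) x)\<^sup>2"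
      by (simp add: cmod_power2)
  qed
qed

theorem theorem1p2:
  fixes g :: "real \<Rightarrow> complex" and \<Lambda> :: "real set"
  assumes "tp_gaussian_type g"
    and "separated \<Lambda>"
    and "lower_beurling_density \<Lambda> > 1"
  shows "sampling_set \<Lambda> (shift_invariant_space g)"
proof -
  obtain G where cont: "continuous_on UNIV G" and dec: "exp_decay G" and det: "determined_by_dense_zeros G"
    and g: "g = (\<lambda>x. complex_of_real (G x))"
    using tp_gaussian_type_representation[OF assms(1)] by blast
  obtain e where e: "e > 0" and "\<forall>l\<in>\<Lambda>. \<forall>m\<in>\<Lambda>. dist l m < e \<longrightarrow> l = m"
    using assms(2) unfolding separated_iff_uniform_discrete uniform_discrete_def by blast
  then have sep: "e \<le> \<bar>l - m\<bar>" if "l \<in> \<Lambda>" "m \<in> \<Lambda>" "l \<noteq> m" for l m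
    using that by (auto simp: dist_real_def not_less[symmetric])
  obtain q D \<mu> where q: "q > 1" and \<mu>: "sampling_sequence e q D \<mu>" "range \<mu> \<subseteq> \<Lambda>"
    by (rule lower_density_sampling_sequence[OF e sep assms(3)])
  have inj: "inj \<mu>" using sampling_sequence_separated[OF \<mu>(1) e] e by (force intro!: injI)
  obtain A0 where A0: "A0 > 0" "\<And>\<mu> c. sampling_sequence e q D \<mu> \<Longrightarrow> (\<lambda>k. (c k)\<^sup>2) summable_on UNIV \<Longrightarrow>
    A0 * (\<Sum>\<^sub>\<infinity>k. (c k)\<^sup>2) \<le> (\<Sum>\<^sub>\<infinity>i. (shift_series G c (\<mu> i))\<^sup>2)"
    using sampling_lower_bound[OF cont dec det e q, of D] by metis
  obtain B0 where B0: "B0 > 0"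
    "\<And>I (f :: real \<Rightarrow> real) c. (\<And>i j. i \<in> I \<Longrightarrow> j \<in> I \<Longrightarrow> i \<noteq> j \<Longrightarrow> e \<le> \<bar>f i - f j\<bar>) \<Longrightarrow>
      (\<lambda>k. (c k)\<^sup>2) summable_on UNIV \<Longrightarrow>
      (\<lambda>i. (shift_series G c (f i))\<^sup>2) summable_on I \<and>
      (\<Sum>\<^sub>\<infinity>i\<in>I. (shift_series G c (f i))\<^sup>2) \<le> B0 * (\<Sum>\<^sub>\<infinity>k. (c k)\<^sup>2)"
    using bessel_bound[OF dec e, where ?'i = real] by metis
  obtain A1 B1 where AB1: "A1 > 0" "B1 > 0" "\<And>c. (\<lambda>k. (c k)\<^sup>2) summable_on UNIV \<Longrightarrow>
    integrable lborel (\<lambda>x. (shift_series G c x)\<^sup>2) \<and>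
    A1 * (\<Sum>\<^sub>\<infinity>k. (c k)\<^sup>2) \<le> (\<integral>x. (shift_series G c x)\<^sup>2 \<partial>lborel) \<and>
    (\<integral>x. (shift_series G c x)\<^sup>2 \<partial>lborel) \<le> B1 * (\<Sum>\<^sub>\<infinity>k. (c k)\<^sup>2)"
    using riesz_bounds[OF cont dec det] by metis
  show ?thesis
    unfolding sampling_set_def g
  \<comment> \<open>The samples are compared with the coefficient norm by \<open>A0\<close> and
    \<open>B0\<close>, and the coefficient norm with the \<open>L\<^sup>2\<close> norm by
    \<open>A1\<close> and \<open>B1\<close>; eliminating the coefficients gives these
    quotients.\<close>
  proof (rule exI[of _ "A0 / B1"], rule exI[of _ "B0 / A1"], intro conjI ballI)
    fix f assume "f \<in> shift_invariant_space (\<lambda>x. complex_of_real (G x))"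
    then obtain a b where ab: "(\<lambda>k. (a k)\<^sup>2) summable_on UNIV" "(\<lambda>k. (b k)\<^sup>2) summable_on UNIV"
      and f: "\<And>x. (cmod (f x))\<^sup>2 = (shift_series G a x)\<^sup>2 + (shift_series G b x)\<^sup>2"
      by (rule shift_invariant_space_real_decomposition) blast
    define C where "C = (\<Sum>\<^sub>\<infinity>k. (a k)\<^sup>2) + (\<Sum>\<^sub>\<infinity>k. (b k)\<^sup>2)"
    have l2: "l2_norm_sq f = (\<integral>x. (shift_series G a x)\<^sup>2 \<partial>lborel) + (\<integral>x. (shift_series G b x)\<^sup>2 \<partial>lborel)"
      unfolding l2_norm_sq_def f using AB1(3)[OF ab(1)] AB1(3)[OF ab(2)] by (intro Bochner_Integration.integral_add) auto
    have l2_bounds: "A1 * C \<le> l2_norm_sq f" "l2_norm_sq f \<le> B1 * C"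
      unfolding l2 C_def using AB1(3)[OF ab(1)] AB1(3)[OF ab(2)] by (auto simp: distrib_left)
    have bes: "(\<lambda>l. (shift_series G c l)\<^sup>2) summable_on \<Lambda> \<and>
      (\<Sum>\<^sub>\<infinity>l\<in>\<Lambda>. (shift_series G c l)\<^sup>2) \<le> B0 * (\<Sum>\<^sub>\<infinity>k. (c k)\<^sup>2)"
      if "(\<lambda>k. (c k)\<^sup>2) summable_on UNIV" for c
      by (rule B0(2)[of \<Lambda> "\<lambda>x. x"]) (use sep that in auto)
    have sum: "(\<lambda>l. (cmod (f l))\<^sup>2) summable_on \<Lambda>"
      and sum_eq: "(\<Sum>\<^sub>\<infinity>l\<in>\<Lambda>. (cmod (f l))\<^sup>2) = (\<Sum>\<^sub>\<infinity>l\<in>\<Lambda>. (shift_series G a l)\<^sup>2) + (\<Sum>\<^sub>\<infinity>l\<in>\<Lambda>. (shift_series G b l)\<^sup>2)"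
      unfolding f using bes[OF ab(1)] bes[OF ab(2)] by (auto intro: summable_on_add infsum_add)
    \<comment> \<open>The selected sequence already gives the bound; the remaining points of
      \<Lambda> only add nonnegative terms.\<close>
    have lower: "A0 * (\<Sum>\<^sub>\<infinity>k. (c k)\<^sup>2) \<le> (\<Sum>\<^sub>\<infinity>l\<in>\<Lambda>. (shift_series G c l)\<^sup>2)" if c: "(\<lambda>k. (c k)\<^sup>2) summable_on UNIV" for c
    proof -
      let ?h = "\<lambda>l. (shift_series G c l)\<^sup>2"
      have s: "?h summable_on \<Lambda>" using bes[OF c] by blast
      have "A0 * (\<Sum>\<^sub>\<infinity>k. (c k)\<^sup>2) \<le> (\<Sum>\<^sub>\<infinity>i. ?h (\<mu> i))" by (rule A0(2)[OF \<mu>(1) c])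
      also have "\<dots> = infsum ?h (range \<mu>)" using infsum_reindex[OF inj, of ?h] by (simp add: o_def)
      also have "\<dots> \<le> infsum ?h \<Lambda>"
        by (rule infsum_mono2[OF summable_on_subset[OF s \<mu>(2)] s \<mu>(2)]) auto
      finally show ?thesis .
    qed
    show "(\<lambda>l. (cmod (f l))\<^sup>2) summable_on \<Lambda>" by (rule sum)
    have "A0 / B1 * l2_norm_sq f \<le> A0 / B1 * (B1 * C)"
      using l2_bounds A0(1) AB1 by (intro mult_left_mono) auto
    also have "\<dots> = A0 * C" using AB1 by simp
    also have "\<dots> \<le> (\<Sum>\<^sub>\<infinity>l\<in>\<Lambda>. (cmod (f l))\<^sup>2)"
      unfolding sum_eq C_def distrib_left by (intro add_mono lower ab)
    finally show "A0 / B1 * l2_norm_sq f \<le> (\<Sum>\<^sub>\<infinity>l\<in>\<Lambda>. (cmod (f l))\<^sup>2)" .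
    have "(\<Sum>\<^sub>\<infinity>l\<in>\<Lambda>. (cmod (f l))\<^sup>2) \<le> B0 * C"
      unfolding sum_eq C_def distrib_left using bes[OF ab(1)] bes[OF ab(2)] by (intro add_mono) auto
    also have "\<dots> = B0 / A1 * (A1 * C)" using AB1 by simp
    also have "\<dots> \<le> B0 / A1 * l2_norm_sq f"
      using l2_bounds B0(1) AB1 by (intro mult_left_mono) auto
    finally show "(\<Sum>\<^sub>\<infinity>l\<in>\<Lambda>. (cmod (f l))\<^sup>2) \<le> B0 / A1 * l2_norm_sq f" .
  qed (use A0 B0 AB1 in auto)
qed

end
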